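(* Let $(\Sigma_P,\theta,\mu)$ be a Markov shift over a finite alphabet. Let $x=(x_1,x_2,\dots)\in\Sigma_P$ be a periodic point of prime period $p$ such that $(x_1,\dots,x_p)$ is a reduced word and the local escape rate $\rho(x,\mathbbm{1})$ exists. Let $\varphi$ be a ceiling function with values in $\mathbb{N}$ which is constant on $n$-cylinders, where $n$ is a positive multiple of $p$. For $\nu\in\mathbb{N}$ let $A_\nu=[x_1,\dots,x_{\nu p}]$, $\mu_\nu=\mu(A_\nu)$, and for $\nu>n/p$ let $s_1(\nu),\dots,s_k(\nu)$ (for fixed $k\in\mathbb{N}$) be as defined in the context, and $z_\nu=e^{\rho(A_\nu,\varphi)}$. Then, as $\nu\to\infty$, \[\big|z_\nu-(1+s_1\mu_\nu+s_2\mu_\nu^2+\dots+s_k\mu_\nu^k)\big|=o(\mu_\nu^k).\]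
   Context: Markov shift: $P=(p_{a,b})$ non-negative irreducible row-stochastic on finite $S$, $\Sigma_P=\{x\in S^{\mathbb{N}}:p_{x_i,x_{i+1}}>0\}$, $\theta$ the shift, $\pi$ the positive stationary probability vector, $\mu([a_1,\dots,a_n])=\pi_{a_1}\prod_{i<n}p_{a_i,a_{i+1}}$; metric $d(x,y)=e^{-\beta|x\wedge y|}$ ($\beta>0$, $|x\wedge y|$ the length of the common prefix). A word $(a_1,\dots,a_m)$ is reduced if there is $a_m'\ne a_m$ with $(a_1,\dots,a_{m-1},a_m')$ admissible. Ceiling function/special flow/escape rate: for $\varphi$ with $\inf\varphi>0$, $S_j\varphi=\sum_{i<j}\varphi\circ\theta^i$, $N_t(y)=\min\{j\ge0:S_j\varphi(y)>t\}$, $\overline{X}=\{(y,s):0\le s<\varphi(y)\}$ with $\overline{\mu}$ the restriction of $\mu\otimes$Lebesgue, $\Phi_t(y,s)=(y,s+t)$ if $t<\varphi(y)-s$, else $(\theta^{N-1}y,s+t-S_{N-1}\varphi(y))$, $N=N_{s+t}(y)$; for a hole $A$ (measurable, $\bigcup\theta^{-j}A=X$ a.e.), $\rho(A,\varphi)=\lim_{t\to\infty}-\frac1t\log\overline{\mu}(\{(y,s):\forall\tau\in[0,t]:\Phi_\tau(y,s)\notin A\times\mathbb{R}\})$; local escape rate $\rho(x,\varphi)=\lim_{r\to0}\rho(B_r(x),\varphi)/\mu(B_r(x))$, $\mathbbm{1}$ the constant $1$. Matrix: with $\varphi=\sum_{C\in C_n}k_C\mathbbm{1}_C$, blocks $\overline{C}_n=\{C\times[k-1,k):C\in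 C_n,1\le k\le k_C\}$ (fixed enumeration), $\overline{M}$ is the block matrix with $\overline{M}_{C\times[k-1,k),C\times[k,k+1)}=1$ for $k<k_C$, $\overline{M}_{[a_1..a_n]\times[k_C-1,k_C),[a_2..a_n,a]\times[0,1)}=p_{a_n,a}$ ($a\in S$), all other entries $0$. $G$ is the polynomial with $\det(\mathrm{id}-z\overline{M})=(1-z)G(z)$; $t$ is the index of $[x_1,\dots,x_n]\times[0,1)$, $r$ the index of $[x_{\nu p-n+1},\dots,x_{\nu p}]\times[0,1)$, $C_{t,r}(z)=(-1)^{t+r}\det[\mathrm{id}-z\overline{M}]_{t,r}$ (row $t$, column $r$ deleted). Let $c_o=p_{x_1,x_2}\cdots p_{x_p,x_{p+1}}$, $o=S_p\varphi(x)$, $s=\nu-n/p$, $k_0=so$, $\mu_t=\mu([x_1,\dots,x_n])$, $\mu_w=\mu([x_1,\dots,x_p])$, $g_1(z)=\frac{(1-z)G(z)}{1-c_oz^o}$, $g_{2,\nu}(z)=\frac{1}{\mu_t}C_{t,r}(z)z^{k_0}-\frac{c_o^{1-n/p}}{\mu_w}\cdot\frac{(1-z)G(z)z^{os}}{1-c_oz^o}$. Then $s_1(\nu),\dots,s_k(\nu)$ are the unique reals such that, with $z(u)=1+\sum_{j=1}^ks_ju^j$, the function $u\mapsto g_1(z(u))+u\,g_{2,\nu}(z(u))$ has vanishing Taylor coefficients at $u=0$ of orders $1,\dots,k$. *)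

theory Defs
  imports "HOL-Probability.Probability" "HOL-Library.Landau_Symbols"
    "Jordan_Normal_Form.Determinant"
begin

text \<open>Alphabet S = UNIV of a finite type. Sequences x = (x_1,x_2,...) are
  functions nat => 'a, with x_1 = x 0. Words are lists.\<close>

fun mpow :: "('a::finite \<Rightarrow> 'a \<Rightarrow> real) \<Rightarrow> nat \<Rightarrow> 'a \<Rightarrow> 'a \<Rightarrow> real" where
  "mpow P 0 = (\<lambda>a b. if a = b then 1 else 0)"
| "mpow P (Suc m) = (\<lambda>a b. \<Sum>c\<in>UNIV. mpow P m a c * P c b)"

definition stochastic_irreducible :: "('a::finite \<Rightarrow> 'a \<Rightarrow> real) \<Rightarrow> bool" where
  "stochastic_irreducible P \<longleftrightarrow>
     (\<forall>a b. P a b \<ge> 0) \<and> (\<forall>a. (\<Sum>b\<in>UNIV. P a b) = 1) \<and>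
     (\<forall>a b. \<exists>m. mpow P m a b > 0)"

definition stationary_vector :: "('a::finite \<Rightarrow> 'a \<Rightarrow> real) \<Rightarrow> ('a \<Rightarrow> real) \<Rightarrow> bool" where
  "stationary_vector P \<pi> \<longleftrightarrow> (\<forall>a. \<pi> a > 0) \<and> (\<Sum>a\<in>UNIV. \<pi> a) = 1 \<and>
     (\<forall>b. (\<Sum>a\<in>UNIV. \<pi> a * P a b) = \<pi> b)"

definition SigmaP :: "('a \<Rightarrow> 'a \<Rightarrow> real) \<Rightarrow> (nat \<Rightarrow> 'a) set" where
  "SigmaP P = {x. \<forall>i. P (x i) (x (Suc i)) > 0}"

definition shift :: "(nat \<Rightarrow> 'a) \<Rightarrow> nat \<Rightarrow> 'a" ("\<theta>") where
  "\<theta> x = (\<lambda>i. x (Suc i))"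

definition cyl :: "('a \<Rightarrow> 'a \<Rightarrow> real) \<Rightarrow> 'a list \<Rightarrow> (nat \<Rightarrow> 'a) set" where
  "cyl P w = {y \<in> SigmaP P. \<forall>i<length w. y i = w ! i}"

definition admissible :: "('a \<Rightarrow> 'a \<Rightarrow> real) \<Rightarrow> 'a list \<Rightarrow> bool" where
  "admissible P w \<longleftrightarrow> (\<forall>i. Suc i < length w \<longrightarrow> P (w ! i) (w ! Suc i) > 0)"

definition reduced_word :: "('a \<Rightarrow> 'a \<Rightarrow> real) \<Rightarrow> 'a list \<Rightarrow> bool" where
  "reduced_word P w \<longleftrightarrow> w \<noteq> [] \<and>
     (\<exists>a'. a' \<noteq> last w \<and> admissible P (butlast w @ [a']))"

definition markov_measure ::
  "('a::finite \<Rightarrow> 'a \<Rightarrow> real) \<Rightarrow> ('a \<Rightarrow> real) \<Rightarrow> (nat \<Rightarrow> 'a) measure \<Rightarrow> bool" where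
  "markov_measure P \<pi> M \<longleftrightarrow> prob_space M \<and>
     sets M = sets (Pi\<^sub>M UNIV (\<lambda>_. count_space UNIV)) \<and>
     (\<forall>w. w \<noteq> [] \<longrightarrow>
        measure M {y. \<forall>i<length w. y i = w ! i}
          = \<pi> (hd w) * (\<Prod>i<length w - 1. P (w ! i) (w ! Suc i)))"

definition dist_seq :: "real \<Rightarrow> (nat \<Rightarrow> 'a) \<Rightarrow> (nat \<Rightarrow> 'a) \<Rightarrow> real" where
  "dist_seq \<beta> x y = (if x = y then 0 else exp (- \<beta> * real (LEAST k. x k \<noteq> y k)))"

definition seq_ball :: "('a \<Rightarrow> 'a \<Rightarrow> real) \<Rightarrow> real \<Rightarrow> (nat \<Rightarrow> 'a) \<Rightarrow> real \<Rightarrow> (nat \<Rightarrow> 'a) set" where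
  "seq_ball P \<beta> x r = {y \<in> SigmaP P. dist_seq \<beta> x y < r}"

definition birk :: "((nat \<Rightarrow> 'a) \<Rightarrow> real) \<Rightarrow> nat \<Rightarrow> (nat \<Rightarrow> 'a) \<Rightarrow> real" where
  "birk \<phi> j y = (\<Sum>i<j. \<phi> ((\<theta> ^^ i) y))"

definition Nt :: "((nat \<Rightarrow> 'a) \<Rightarrow> real) \<Rightarrow> real \<Rightarrow> (nat \<Rightarrow> 'a) \<Rightarrow> nat" where
  "Nt \<phi> t y = (LEAST j. birk \<phi> j y > t)"

text \<open>Flow Phi_t(y,s); the first component is theta^(N-1) y with N = N_(s+t)(y)
  (this also covers the case t < phi(y) - s, where N = 1).\<close>
definition flow :: "((nat \<Rightarrow> 'a) \<Rightarrow> real) \<Rightarrow> real \<Rightarrow> (nat \<Rightarrow> 'a) \<times> real \<Rightarrow> (nat \<Rightarrow> 'a) \<times> real" where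
  "flow \<phi> t ys = (let y = fst ys; s = snd ys in
     if t < \<phi> y - s then (y, s + t)
     else (let N = Nt \<phi> (s + t) y in ((\<theta> ^^ (N - 1)) y, s + t - birk \<phi> (N - 1) y)))"

definition survivors ::
  "('a \<Rightarrow> 'a \<Rightarrow> real) \<Rightarrow> ((nat \<Rightarrow> 'a) \<Rightarrow> real) \<Rightarrow> (nat \<Rightarrow> 'a) set \<Rightarrow> real \<Rightarrow> ((nat \<Rightarrow> 'a) \<times> real) set" where
  "survivors P \<phi> A t = {(y, s). y \<in> SigmaP P \<and> 0 \<le> s \<and> s < \<phi> y \<and>
      (\<forall>\<tau>\<in>{0..t}. fst (flow \<phi> \<tau> (y, s)) \<notin> A)}"

definition escape_rate ::
  "('a \<Rightarrow> 'a \<Rightarrow> real) \<Rightarrow> (nat \<Rightarrow> 'a) measure \<Rightarrow> (nat \<Rightarrow> 'a) set \<Rightarrow> ((nat \<Rightarrow> 'a) \<Rightarrow> real) \<Rightarrow> real" where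
  "escape_rate P M A \<phi> =
     Lim at_top (\<lambda>t. - (1 / t) * ln (measure (M \<Otimes>\<^sub>M lborel) (survivors P \<phi> A t)))"

definition local_escape_rate_exists ::
  "('a \<Rightarrow> 'a \<Rightarrow> real) \<Rightarrow> (nat \<Rightarrow> 'a) measure \<Rightarrow> real \<Rightarrow> (nat \<Rightarrow> 'a) \<Rightarrow> ((nat \<Rightarrow> 'a) \<Rightarrow> real) \<Rightarrow> bool" where
  "local_escape_rate_exists P M \<beta> x \<phi> \<longleftrightarrow>
     (\<exists>L. ((\<lambda>r. escape_rate P M (seq_ball P \<beta> x r) \<phi> / measure M (seq_ball P \<beta> x r))
            \<longlongrightarrow> L) (at_right 0))"

text \<open>Index set of blocks C x [k-1,k), C an admissible n-word, 1 <= k <= k_C.\<close>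
definition blocks :: "('a::finite \<Rightarrow> 'a \<Rightarrow> real) \<Rightarrow> nat \<Rightarrow> ('a list \<Rightarrow> nat) \<Rightarrow> ('a list \<times> nat) set" where
  "blocks P n kC = {(C, k). length C = n \<and> admissible P C \<and> 1 \<le> k \<and> k \<le> kC C}"

definition Mbar_entry ::
  "('a \<Rightarrow> 'a \<Rightarrow> real) \<Rightarrow> ('a list \<Rightarrow> nat) \<Rightarrow> 'a list \<times> nat \<Rightarrow> 'a list \<times> nat \<Rightarrow> real" where
  "Mbar_entry P kC b b' = (let C = fst b; k = snd b; C' = fst b'; k' = snd b' in
     if k < kC C then (if C' = C \<and> k' = Suc k then 1 else 0)
     else if k = kC C \<and> k' = 1 \<and> (\<exists>a. C' = tl C @ [a]) then P (last C) (last C')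
     else 0)"

definition id_minus_zM ::
  "('a \<Rightarrow> 'a \<Rightarrow> real) \<Rightarrow> ('a list \<Rightarrow> nat) \<Rightarrow> nat \<Rightarrow> (nat \<Rightarrow> 'a list \<times> nat) \<Rightarrow> real poly mat" where
  "id_minus_zM P kC N e = mat N N (\<lambda>(i, j).
      (if i = j then 1 else 0) - [:0, Mbar_entry P kC (e i) (e j):])"

text \<open>G with det(id - z Mbar) = (1 - z) G(z).\<close>
definition Gpoly ::
  "('a \<Rightarrow> 'a \<Rightarrow> real) \<Rightarrow> ('a list \<Rightarrow> nat) \<Rightarrow> nat \<Rightarrow> (nat \<Rightarrow> 'a list \<times> nat) \<Rightarrow> real poly" where
  "Gpoly P kC N e = det (id_minus_zM P kC N e) div [:1, -1:]"

definition taylor_vanish :: "(real \<Rightarrow> real) \<Rightarrow> nat \<Rightarrow> bool" where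
  "taylor_vanish f k \<longleftrightarrow> (\<forall>m\<in>{1..k}. (deriv ^^ m) f 0 / fact m = 0)"

definition s_coeffs :: "(real \<Rightarrow> real) \<Rightarrow> (real \<Rightarrow> real) \<Rightarrow> nat \<Rightarrow> nat \<Rightarrow> real" where
  "s_coeffs g1 g2 k = (THE s. (\<forall>j. j \<notin> {1..k} \<longrightarrow> s j = 0) \<and>
      taylor_vanish (\<lambda>u. let z = 1 + (\<Sum>j=1..k. s j * u ^ j) in g1 z + u * g2 z) k)"

end

theory Submission
  imports Defs
begin

text \<open>Let \<open>D(z) = det (id - z Mbar)\<close>, let \<open>w\<close> be the word of length \<open>L = \<nu> p\<close> defining the hole, and for a word
  \<open>v\<close> of length \<open>L\<close> let \<open>O v (z)\<close> be the generating function, by elapsed flow time, of the expected number of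
  occurrences of \<open>w\<close> in a sequence starting with \<open>v\<close>. It is a rational function with denominator \<open>D\<close>, harmonic
  for the flow away from \<open>w\<close>, and \<open>D \<cdot> O w = g1 + \<mu> g2\<close>. At the root \<open>z\<close> of \<open>g1 + \<mu> g2\<close> near \<open>1\<close> it vanishes at
  \<open>w\<close>, and it has constant sign at all other words because the word is reduced: an overlap of \<open>v \<noteq> w\<close> with \<open>w\<close> has
  to be completed by a transition of probability less than \<open>1\<close>. Hence up to sign \<open>O\<close> is a positive eigenfunction of the
  open system, and the measure of the survivors lies between constant multiples of \<open>z\<close> to the power \<open>-t\<close>, which
  gives \<open>exp \<rho> = z\<close>. After multiplication by \<open>1 - co z ^ ob\<close> the equation \<open>g1 + u g2 = 0\<close> reads
  \<open>D(z) + u z ^ (ob s) Y(z) = 0\<close> with polynomials \<open>D\<close>, \<open>Y\<close> independent of \<open>\<nu>\<close> and \<open>D'(1) \<noteq> 0\<close>. Its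
  formal solution in powers of \<open>u\<close> has coefficients which, after rescaling \<open>u\<close> by \<open>(1 + \<delta>) ^ (ob s)\<close>, are bounded
  in \<open>\<nu>\<close>; choosing \<open>\<delta>\<close> small compared with the exponential decay of \<open>\<mu>\<close> makes the truncation error \<open>o(\<mu> ^ k)\<close>.\<close>

subsection \<open>Roots of perturbed polynomials\<close>

text \<open>The sign of O and the position of the root must be controlled uniformly in \<nu>,
  although powers of z with exponents of order \<nu> occur. The window |z - 1| <=
  \<open>sqrt co ^ \<nu>\<close> reconciles this: it is exponentially small, so all these powers
  tend to 1 uniformly, yet it is much wider than the deviation of the root, which has order at most
  \<open>co ^ \<nu>\<close>, so a sign change is visible at its ends. A root found there is
  identified with exp \<rho> afterwards by the decay estimate. At the root the relation O w = 0
  expresses D(z) through the geometric sum of the self-overlaps of w. Inserted into O v, it leaves a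
  comparison of the overlaps of v with those of w. Overlaps of v with w in more than n letters start
  at offsets congruent modulo p, and near z = 1 they are dominated by those of w with an extra
  factor \<open>\<kappa>\<close> < 1, the probability of the last transition of w; this gap does not
  depend on \<nu>. The derivative D'(1) is, up to a nonzero factor, the mean of the ceiling
  function. All analytic estimates use the norm \<open>pnorm\<close> in place of Cauchy estimates on
  complex discs.\<close>

definition pnorm :: "real \<Rightarrow> real poly \<Rightarrow> real" where
  "pnorm r p = poly (map_poly abs p) r"

lemma pnorm_0 [simp]: "pnorm r 0 = 0"
  by (simp add: pnorm_def)

lemma pnorm_pCons [simp]: "pnorm r (pCons a p) = \<bar>a\<bar> + r * pnorm r p"
  by (simp add: pnorm_def map_poly_pCons)

lemma pnorm_nonneg: "0 \<le> r \<Longrightarrow> 0 \<le> pnorm r p"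
  by (induction p) auto

lemma pnorm_mono: "0 \<le> r \<Longrightarrow> r \<le> r' \<Longrightarrow> pnorm r p \<le> pnorm r' p"
  by (induction p) (auto intro!: mult_mono pnorm_nonneg)

lemma pnorm_add: "0 \<le> r \<Longrightarrow> pnorm r (p + q) \<le> pnorm r p + pnorm r q"
proof (induction p q rule: poly_induct2)
  case (pCons a p b q)
  have "r * pnorm r (p + q) \<le> r * (pnorm r p + pnorm r q)"
    using pCons by (intro mult_left_mono) auto
  moreover have "\<bar>a + b\<bar> \<le> \<bar>a\<bar> + \<bar>b\<bar>" by simp
  ultimately show ?case by (simp add: algebra_simps)
qed simp

lemma pnorm_smult: "pnorm r (Polynomial.smult c p) = \<bar>c\<bar> * pnorm r p"
  by (induction p) (auto simp: abs_mult algebra_simps)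

lemma pnorm_mult: "0 \<le> r \<Longrightarrow> pnorm r (p * q) \<le> pnorm r p * pnorm r q"
proof (induction p)
  case (pCons a p)
  have "pnorm r (pCons a p * q) = pnorm r (Polynomial.smult a q + pCons 0 (p * q))" by simp
  also have "\<dots> \<le> pnorm r (Polynomial.smult a q) + pnorm r (pCons 0 (p * q))"
    by (rule pnorm_add) fact
  also have "\<dots> = \<bar>a\<bar> * pnorm r q + r * pnorm r (p * q)" by (simp add: pnorm_smult)
  also have "r * pnorm r (p * q) \<le> r * (pnorm r p * pnorm r q)"
    using pCons by (intro mult_left_mono) auto
  finally show ?case by (simp add: algebra_simps)
qed simp

lemma pnorm_power: "0 \<le> r \<Longrightarrow> pnorm r (p ^ m) \<le> pnorm r p ^ m"
proof (induction m)
  case (Suc m)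
  have "pnorm r (p ^ Suc m) \<le> pnorm r p * pnorm r (p ^ m)"
    using pnorm_mult Suc.prems by simp
  also have "\<dots> \<le> pnorm r p * pnorm r p ^ m"
    using Suc by (intro mult_left_mono pnorm_nonneg) auto
  finally show ?case by simp
qed (simp add: one_pCons)

text \<open>Together with submultiplicativity this makes \<open>pnorm r\<close> behave like a sup
  norm on the disc of radius r: a polynomial of norm at most \<delta> maps radius r into radius
  \<delta>. Bounds obtained in this way depend on a polynomial only through its norm.\<close>

lemma pnorm_pcompose: "0 \<le> r \<Longrightarrow> pnorm r (p \<circ>\<^sub>p q) \<le> pnorm (pnorm r q) p"
proof (induction p)
  case (pCons a p)
  have "pnorm r (pCons a p \<circ>\<^sub>p q) \<le> pnorm r [:a:] + pnorm r (q * (p \<circ>\<^sub>p q))"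
    unfolding pcompose_pCons by (rule pnorm_add) fact
  also have "\<dots> \<le> \<bar>a\<bar> + pnorm r q * pnorm r (p \<circ>\<^sub>p q)"
    using pnorm_mult pCons.prems by simp
  also have "\<dots> \<le> \<bar>a\<bar> + pnorm r q * pnorm (pnorm r q) p"
    using pCons by (intro add_left_mono mult_left_mono pnorm_nonneg) auto
  finally show ?case by simp
qed simp

lemma pnorm_altdef: "pnorm r p = (\<Sum>i\<le>degree p. \<bar>coeff p i\<bar> * r ^ i)"
  unfolding pnorm_def poly_altdef by (simp add: degree_map_poly coeff_map_poly)

lemma coeff_le_pnorm: "0 \<le> r \<Longrightarrow> \<bar>coeff p i\<bar> * r ^ i \<le> pnorm r p"
proof (induction p arbitrary: i)
  case (pCons a p)
  show ?case
  proof (cases i)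
    case 0
    then show ?thesis using pCons.prems pnorm_nonneg by (simp add: mult_nonneg_nonneg)
  next
    case (Suc j)
    have "r * (\<bar>coeff p j\<bar> * r ^ j) \<le> r * pnorm r p"
      using pCons by (intro mult_left_mono) auto
    then show ?thesis using Suc by (simp add: algebra_simps)
  qed
qed simp

lemma poly_le_pnorm: "\<bar>x\<bar> \<le> r \<Longrightarrow> \<bar>poly p x\<bar> \<le> pnorm r p"
proof (induction p)
  case (pCons a p)
  have "\<bar>poly (pCons a p) x\<bar> \<le> \<bar>a\<bar> + \<bar>x\<bar> * \<bar>poly p x\<bar>"
    by (simp add: abs_triangle_ineq[THEN order_trans] abs_mult)
  also have "\<bar>x\<bar> * \<bar>poly p x\<bar> \<le> r * pnorm r p"
    using pCons by (intro mult_mono) auto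
  finally show ?case by simp
qed simp

text \<open>On half the radius each of the two summands of the Horner step is at most
  \<open>pnorm \<delta> p\<close> times |a - b|; their sum is paid for by the factor \<delta> that
  \<open>pCons\<close> adds to the norm.\<close>

lemma poly_lipschitz_pnorm:
  assumes "\<delta> > 0" "\<bar>a\<bar> \<le> \<delta> / 2" "\<bar>b\<bar> \<le> \<delta> / 2"
  shows "\<bar>poly p a - poly p b\<bar> \<le> 2 / \<delta> * pnorm \<delta> p * \<bar>a - b\<bar>"
proof (induction p)
  case (pCons c p)
  have "poly (pCons c p) a - poly (pCons c p) b = (a - b) * poly p a + b * (poly p a - poly p b)"
    by (simp add: algebra_simps)
  also have "\<bar>\<dots>\<bar> \<le> \<bar>a - b\<bar> * \<bar>poly p a\<bar> + \<bar>b\<bar> * \<bar>poly p a - poly p b\<bar>"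
    by (simp add: abs_triangle_ineq[THEN order_trans] abs_mult)
  also have "\<dots> \<le> \<bar>a - b\<bar> * pnorm \<delta> p + \<delta> / 2 * (2 / \<delta> * pnorm \<delta> p * \<bar>a - b\<bar>)"
    using assms pCons by (intro add_mono mult_mono poly_le_pnorm) auto
  also have "\<dots> = 2 * pnorm \<delta> p * \<bar>a - b\<bar>"
    using assms by (simp add: field_simps)
  also have "\<dots> \<le> 2 / \<delta> * pnorm \<delta> (pCons c p) * \<bar>a - b\<bar>"
    using assms by (intro mult_right_mono) (auto simp: field_simps)
  finally show ?case .
qed simp

lemma pnorm_le_of_coeffs:
  assumes "coeff s 0 = 0" "degree s \<le> k" "\<And>i. \<bar>coeff s i\<bar> \<le> C" "0 \<le> r" "r \<le> 1"
  shows "pnorm r s \<le> real k * C * r"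
proof -
  have C: "0 \<le> C" using assms(3)[of 0] by linarith
  have "pnorm r s = (\<Sum>i\<le>k. \<bar>coeff s i\<bar> * r ^ i)"
    unfolding pnorm_altdef using assms(2)
    by (intro sum.mono_neutral_left) (auto simp: coeff_eq_0)
  also have "\<dots> = (\<Sum>i\<in>{1..k}. \<bar>coeff s i\<bar> * r ^ i)"
    using assms(1) by (intro sum.mono_neutral_right) (auto simp: not_le)
  also have "\<dots> \<le> (\<Sum>i\<in>{1..k}. C * r)"
  proof (intro sum_mono mult_mono)
    fix i assume "i \<in> {1..k}"
    then show "r ^ i \<le> r" using assms power_decreasing[of 1 i r] by auto
  qed (use assms C in auto)
  finally show ?thesis by simp
qed

text \<open>As in the Schwarz lemma, every surviving monomial contains at least \<open>Suc k\<close>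
  factors |x| / r, each at most 1.\<close>

lemma poly_le_of_coeffs_vanish:
  assumes "\<And>i. i \<le> k \<Longrightarrow> coeff p i = 0" "r > 0" "\<bar>x\<bar> \<le> r"
  shows "\<bar>poly p x\<bar> \<le> pnorm r p / r ^ Suc k * \<bar>x\<bar> ^ Suc k"
proof -
  have "\<bar>poly p x\<bar> \<le> (\<Sum>i\<le>degree p. \<bar>coeff p i\<bar> * \<bar>x\<bar> ^ i)"
    unfolding poly_altdef by (rule order_trans[OF sum_abs]) (simp add: abs_mult power_abs)
  also have "\<dots> \<le> (\<Sum>i\<le>degree p. \<bar>coeff p i\<bar> * r ^ i * (\<bar>x\<bar> / r) ^ Suc k)"
  proof (intro sum_mono)
    fix i
    show "\<bar>coeff p i\<bar> * \<bar>x\<bar> ^ i \<le> \<bar>coeff p i\<bar> * r ^ i * (\<bar>x\<bar> / r) ^ Suc k"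
    proof (cases "i \<le> k")
      case False
      have "\<bar>x\<bar> ^ i = r ^ i * (\<bar>x\<bar> / r) ^ i" using assms by (simp add: power_divide)
      also have "\<dots> \<le> r ^ i * (\<bar>x\<bar> / r) ^ Suc k"
        using assms False by (intro mult_left_mono power_decreasing) auto
      finally have "\<bar>x\<bar> ^ i \<le> r ^ i * (\<bar>x\<bar> / r) ^ Suc k" .
      from mult_left_mono[OF this abs_ge_zero[of "coeff p i"]] show ?thesis by (simp only: mult.assoc)
    qed (simp add: assms)
  qed
  also have "\<dots> = pnorm r p * (\<bar>x\<bar> / r) ^ Suc k"
    by (simp only: pnorm_altdef sum_distrib_right)
  finally show ?thesis by (simp add: power_divide)
qed

text \<open>One Newton step for formal series: changing the coefficient of order m of s affects the
  composition first at order m, and there linearly with slope p'(0). This serves both uniqueness and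
  construction of \<open>root_mod\<close>.\<close>

lemma coeff_pcompose_congruent:
  fixes p s s' :: "real poly"
  assumes "coeff s 0 = 0" "coeff s' 0 = 0" "\<And>i. i < m \<Longrightarrow> coeff s i = coeff s' i" "0 < m"
  shows "i < m \<Longrightarrow> coeff (p \<circ>\<^sub>p s) i = coeff (p \<circ>\<^sub>p s') i"
    and "coeff (p \<circ>\<^sub>p s) m - coeff (p \<circ>\<^sub>p s') m = coeff p 1 * (coeff s m - coeff s' m)"
proof -
  have "(\<forall>i<m. coeff (p \<circ>\<^sub>p s) i = coeff (p \<circ>\<^sub>p s') i) \<and>
    coeff (p \<circ>\<^sub>p s) m - coeff (p \<circ>\<^sub>p s') m = coeff p 1 * (coeff s m - coeff s' m)"
  proof (induction p)
    case (pCons a p)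
    have eq: "coeff s j * coeff (p \<circ>\<^sub>p s) (i - j) = coeff s' j * coeff (p \<circ>\<^sub>p s') (i - j)"
      if "j \<le> i" "i < m \<or> i = m \<and> j < m" for i j
      using that pCons assms by (cases "j = 0") auto
    have A: "coeff (s * (p \<circ>\<^sub>p s)) i = coeff (s' * (p \<circ>\<^sub>p s')) i" if "i < m" for i
      unfolding coeff_mult using that by (intro sum.cong) (auto intro: eq)
    have "(\<Sum>j<m. coeff s j * coeff (p \<circ>\<^sub>p s) (m - j)) = (\<Sum>j<m. coeff s' j * coeff (p \<circ>\<^sub>p s') (m - j))"
      by (intro sum.cong) (auto intro: eq)
    moreover have "coeff (p \<circ>\<^sub>p s) 0 = coeff p 0" "coeff (p \<circ>\<^sub>p s') 0 = coeff p 0"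
      using assms by (simp_all flip: poly_0_coeff_0 add: poly_pcompose)
    ultimately have "coeff (s * (p \<circ>\<^sub>p s)) m - coeff (s' * (p \<circ>\<^sub>p s')) m = coeff p 0 * (coeff s m - coeff s' m)"
      unfolding coeff_mult by (simp add: lessThan_Suc_atMost[symmetric] algebra_simps)
    with A show ?case using assms(4) by (simp add: pcompose_pCons)
  qed simp
  then show "i < m \<Longrightarrow> coeff (p \<circ>\<^sub>p s) i = coeff (p \<circ>\<^sub>p s') i"
    and "coeff (p \<circ>\<^sub>p s) m - coeff (p \<circ>\<^sub>p s') m = coeff p 1 * (coeff s m - coeff s' m)" by auto
qed

text \<open>The truncated implicit function: d and q are expansions around z = 1, s(u) stands for z
  - 1, and u for the measure of the hole.\<close>

definition root_mod :: "real poly \<Rightarrow> real poly \<Rightarrow> nat \<Rightarrow> real poly \<Rightarrow> bool" where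
  "root_mod d q k s \<longleftrightarrow> coeff s 0 = 0 \<and> degree s \<le> k \<and>
     (\<forall>i\<le>k. coeff (d \<circ>\<^sub>p s + pCons 0 (q \<circ>\<^sub>p s)) i = 0)"

text \<open>Because of the factor u in front of q, only coefficients of s of order below i enter the
  q part at order i. As d'(0) is nonzero, the equation of order i then determines coefficient
  i.\<close>

lemma root_mod_unique:
  assumes "coeff d 1 \<noteq> 0" "root_mod d q k s" "root_mod d q k s'"
  shows "s = s'"
proof (rule poly_eqI)
  fix i show "coeff s i = coeff s' i"
  proof (induction i rule: less_induct)
    case (less i)
    consider "i = 0" | "i > k" | "0 < i" "i \<le> k" by linarith
    then show ?case
    proof cases
      case 3
      note c = coeff_pcompose_congruent[of s s' i]
      have 0: "coeff s 0 = 0" "coeff s' 0 = 0" using assms by (auto simp: root_mod_def)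
      have "coeff (q \<circ>\<^sub>p s) (i - 1) = coeff (q \<circ>\<^sub>p s') (i - 1)"
        by (rule c(1)) (use 0 less 3 in auto)
      then have "coeff (pCons 0 (q \<circ>\<^sub>p s)) i = coeff (pCons 0 (q \<circ>\<^sub>p s')) i"
        using 3 by (cases i) auto
      moreover have "coeff (d \<circ>\<^sub>p s + pCons 0 (q \<circ>\<^sub>p s)) i = 0"
        "coeff (d \<circ>\<^sub>p s' + pCons 0 (q \<circ>\<^sub>p s')) i = 0"
        using assms 3 by (auto simp: root_mod_def)
      ultimately have "coeff (d \<circ>\<^sub>p s) i - coeff (d \<circ>\<^sub>p s') i = 0" by simp
      then show ?thesis using c(2)[of d] 0 less 3 assms by auto
    qed (use assms in \<open>auto simp: root_mod_def coeff_eq_0\<close>)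
  qed
qed

lemma pnorm_radius_exists:
  assumes "C \<ge> 0" "\<delta> > 0"
  obtains r where "r > 0" "r \<le> 1"
    "\<And>s. coeff s 0 = 0 \<Longrightarrow> degree s \<le> k \<Longrightarrow> (\<And>i. \<bar>coeff s i\<bar> \<le> C) \<Longrightarrow> pnorm r s \<le> \<delta>"
proof
  \<comment> \<open>The radius that brings the linear bound k C r below \<delta>; the summand 1
    keeps the denominator positive when k C = 0.\<close>
  let ?r = "min 1 (\<delta> / (real k * C + 1))"
  have p: "real k * C + 1 > 0" using assms by (simp add: add_nonneg_pos)
  show "?r > 0" using assms p by simp
  show "?r \<le> 1" by simp
  fix s :: "real poly" assume s: "coeff s 0 = 0" "degree s \<le> k" "\<And>i. \<bar>coeff s i\<bar> \<le> C"
  have "pnorm ?r s \<le> real k * C * ?r"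
    using s \<open>?r > 0\<close> by (intro pnorm_le_of_coeffs) auto
  also have "\<dots> \<le> (real k * C + 1) * (\<delta> / (real k * C + 1))"
    using assms p by (intro mult_mono) auto
  finally show "pnorm ?r s \<le> \<delta>" using p by simp
qed

lemma pnorm_perturbed_pcompose:
  assumes "0 \<le> r" "pnorm r s \<le> \<delta>" "pnorm \<delta> q \<le> B"
  shows "pnorm r (d \<circ>\<^sub>p s + pCons 0 (q \<circ>\<^sub>p s)) \<le> pnorm \<delta> d + r * B"
proof -
  have "pnorm r (d \<circ>\<^sub>p s + pCons 0 (q \<circ>\<^sub>p s)) \<le> pnorm r (d \<circ>\<^sub>p s) + r * pnorm r (q \<circ>\<^sub>p s)"
    using pnorm_add[OF assms(1), of "d \<circ>\<^sub>p s" "pCons 0 (q \<circ>\<^sub>p s)"] by simp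
  also have "\<dots> \<le> pnorm (pnorm r s) d + r * pnorm (pnorm r s) q"
    using assms by (intro add_mono mult_left_mono pnorm_pcompose) auto
  also have "\<dots> \<le> pnorm \<delta> d + r * pnorm \<delta> q"
    using assms by (intro add_mono mult_left_mono pnorm_mono pnorm_nonneg) auto
  also have "\<dots> \<le> pnorm \<delta> d + r * B"
    using assms by (intro add_mono mult_left_mono) auto
  finally show ?thesis .
qed

text \<open>The point is that C depends on q only through B, so that it serves a whole family
  indexed by \<nu>. The next coefficient is the residual of order \<open>Suc k\<close> divided by -
  d'(0), and this residual is estimated by its norm at a radius that all bounded approximants map
  into radius \<delta>.\<close>

lemma root_mod_bounded:
  assumes d: "coeff d 0 = 0" "coeff d 1 \<noteq> 0" and \<delta>: "\<delta> > 0"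
  shows "\<exists>C\<ge>0. \<forall>q. pnorm \<delta> q \<le> B \<longrightarrow> (\<exists>s. root_mod d q k s \<and> (\<forall>i. \<bar>coeff s i\<bar> \<le> C))"
proof (induction k)
  case 0
  have "root_mod d q 0 0" for q
    using d by (simp add: root_mod_def flip: poly_0_coeff_0 add: poly_pcompose)
  then show ?case by (intro exI[of _ 0]) (auto intro!: exI[of _ 0])
next
  case (Suc k)
  then obtain C where C: "C \<ge> 0"
    "\<And>q. pnorm \<delta> q \<le> B \<Longrightarrow> \<exists>s. root_mod d q k s \<and> (\<forall>i. \<bar>coeff s i\<bar> \<le> C)" by blast
  obtain r where r: "r > 0" "r \<le> 1" 
    "\<And>s. coeff s 0 = 0 \<Longrightarrow> degree s \<le> k \<Longrightarrow> (\<And>i. \<bar>coeff s i\<bar> \<le> C) \<Longrightarrow> pnorm r s \<le> \<delta>"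
    using pnorm_radius_exists[OF C(1) \<delta>] by blast
  define C' where "C' = C + \<bar>(pnorm \<delta> d + r * B) / r ^ Suc k / coeff d 1\<bar>"
  show ?case
  proof (intro exI[of _ C'] conjI allI impI)
    show "C' \<ge> 0" using C by (simp add: C'_def)
    fix q assume q: "pnorm \<delta> q \<le> B"
    obtain s where s: "root_mod d q k s" "\<And>i. \<bar>coeff s i\<bar> \<le> C" using C(2)[OF q] by blast
    have s0: "coeff s 0 = 0" "degree s \<le> k" using s(1) by (auto simp: root_mod_def)
    define H where "H = d \<circ>\<^sub>p s + pCons 0 (q \<circ>\<^sub>p s)"
    define e where "e = - coeff H (Suc k) / coeff d 1"
    define s' where "s' = s + monom e (Suc k)"
    have s'0: "coeff s' 0 = 0" using s0 by (simp add: s'_def)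
    note c = coeff_pcompose_congruent[of s' s "Suc k", OF s'0 s0(1)]
    have agree: "\<And>i. i < Suc k \<Longrightarrow> coeff s' i = coeff s i" by (simp add: s'_def)
    have "\<bar>coeff H (Suc k)\<bar> * r ^ Suc k \<le> pnorm \<delta> d + r * B"
      using coeff_le_pnorm[of r H "Suc k"] r
        pnorm_perturbed_pcompose[of r s \<delta> q B d, OF _ r(3)[OF s0 s(2)] q]
      by (simp add: H_def)
    then have "\<bar>coeff H (Suc k)\<bar> \<le> (pnorm \<delta> d + r * B) / r ^ Suc k"
      using r by (simp add: field_simps)
    also have "\<dots> \<le> \<bar>(pnorm \<delta> d + r * B) / r ^ Suc k\<bar>" by (rule abs_ge_self)
    finally have e: "\<bar>e\<bar> \<le> \<bar>(pnorm \<delta> d + r * B) / r ^ Suc k / coeff d 1\<bar>"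
      by (simp only: e_def abs_divide[of _ "coeff d 1"] abs_minus_cancel divide_right_mono abs_ge_zero)
    have "coeff s (Suc k) = 0" using s0 by (simp add: coeff_eq_0)
    then have "coeff (d \<circ>\<^sub>p s' + pCons 0 (q \<circ>\<^sub>p s')) i = 0" if "i \<le> Suc k" for i
    proof (cases "i = Suc k")
      case True
      have "coeff (d \<circ>\<^sub>p s' + pCons 0 (q \<circ>\<^sub>p s')) i = coeff H (Suc k) + coeff d 1 * e"
        using c(2)[OF agree, of d] c(1)[OF agree, of k q] \<open>coeff s (Suc k) = 0\<close>
        by (simp add: H_def True s'_def)
      then show ?thesis using d by (simp add: e_def)
    next
      case False
      then have "coeff (d \<circ>\<^sub>p s') i = coeff (d \<circ>\<^sub>p s) i"
        "coeff (pCons 0 (q \<circ>\<^sub>p s')) i = coeff (pCons 0 (q \<circ>\<^sub>p s)) i"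
        using that c(1)[OF agree] by (auto simp: coeff_pCons split: nat.split)
      then show ?thesis using s(1) that False unfolding root_mod_def by (metis coeff_add le_SucE)
    qed
    moreover have "degree s' \<le> Suc k"
      unfolding s'_def using s0 by (intro degree_add_le) (auto simp: degree_monom_le)
    moreover have "\<bar>coeff s' i\<bar> \<le> C'" for i
    proof -
      have "\<bar>coeff s' i\<bar> \<le> \<bar>coeff s i\<bar> + \<bar>e\<bar>" by (simp add: s'_def abs_triangle_ineq)
      then show ?thesis using s(2)[of i] e by (simp add: C'_def)
    qed
    ultimately show "\<exists>s. root_mod d q (Suc k) s \<and> (\<forall>i. \<bar>coeff s i\<bar> \<le> C')"
      using s'0 by (intro exI[of _ s']) (auto simp: root_mod_def)
  qed
qed

text \<open>A constant factor of q is absorbed by replacing u with u / c.\<close>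

lemma root_mod_rescale:
  assumes "root_mod d (Polynomial.smult c q) k s" "c \<noteq> 0"
  shows "root_mod d q k (s \<circ>\<^sub>p [:0, inverse c:])"
proof -
  let ?l = "[:0, inverse c:]"
  have "d \<circ>\<^sub>p (s \<circ>\<^sub>p ?l) + pCons 0 (q \<circ>\<^sub>p (s \<circ>\<^sub>p ?l)) = (d \<circ>\<^sub>p s + pCons 0 (Polynomial.smult c q \<circ>\<^sub>p s)) \<circ>\<^sub>p ?l"
    using assms by (simp add: pcompose_add pcompose_assoc pcompose_smult pcompose_pCons)
  then show ?thesis using assms
    by (auto simp: root_mod_def coeff_pcompose_linear degree_pcompose poly_0_coeff_0)
qed

section \<open>Taylor coefficients of quotients of polynomials\<close>

primrec quot_num :: "real poly \<Rightarrow> real poly \<Rightarrow> nat \<Rightarrow> real poly" where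
  "quot_num F b 0 = F"
| "quot_num F b (Suc m) = pderiv (quot_num F b m) * b - Polynomial.smult (real (Suc m)) (quot_num F b m * pderiv b)"

text \<open>The numerator over \<open>b ^ Suc m\<close> comes from the quotient rule. The identity
  is carried along on a neighbourhood of 0, since the next \<open>deriv\<close> looks at nearby
  points.\<close>

lemma higher_deriv_quotient:
  fixes f :: "real \<Rightarrow> real"
  assumes "\<forall>\<^sub>F u in nhds 0. f u = poly F u / poly b u" "poly b 0 \<noteq> 0"
  shows "\<forall>\<^sub>F u in nhds 0. (deriv ^^ m) f u = poly (quot_num F b m) u / poly b u ^ Suc m"
proof (induction m)
  case (Suc m)
  have "open {u. poly b u \<noteq> 0}" by (intro open_Collect_neq continuous_intros)
  then have b: "\<forall>\<^sub>F u in nhds 0. poly b u \<noteq> 0"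
    using assms(2) by (auto simp: eventually_nhds)
  have "\<forall>\<^sub>F u in nhds 0. \<forall>\<^sub>F v in nhds u. (deriv ^^ m) f v = poly (quot_num F b m) v / poly b v ^ Suc m"
    using Suc by (simp add: eventually_eventually)
  with b show ?case
  proof eventually_elim
    case (elim u)
    let ?n = "poly (quot_num F b m) u" and ?n' = "poly (pderiv (quot_num F b m)) u"
    let ?b = "poly b u" and ?b' = "poly (pderiv b) u"
    have "((\<lambda>v. poly (quot_num F b m) v / poly b v ^ Suc m) has_field_derivative
       (?n' * ?b ^ Suc m - ?n * (real (Suc m) * (?b ^ m * ?b'))) / (?b ^ Suc m * ?b ^ Suc m)) (at u)"
    proof (intro DERIV_divide poly_DERIV)
      show "((\<lambda>v. poly b v ^ Suc m) has_field_derivative real (Suc m) * (?b ^ m * ?b')) (at u)"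
        using DERIV_power_Suc[OF poly_DERIV[of b], where n = m] by (simp add: algebra_simps)
    qed (use elim(1) in auto)
    also have "(?n' * ?b ^ Suc m - ?n * (real (Suc m) * (?b ^ m * ?b'))) / (?b ^ Suc m * ?b ^ Suc m)
       = (?b ^ m * (?n' * ?b - real (Suc m) * (?n * ?b'))) / (?b ^ m * ?b ^ Suc (Suc m))"
      by (simp add: algebra_simps)
    also have "\<dots> = poly (quot_num F b (Suc m)) u / ?b ^ Suc (Suc m)"
      using elim(1) by simp
    finally have "((\<lambda>v. poly (quot_num F b m) v / poly b v ^ Suc m) has_field_derivative
       poly (quot_num F b (Suc m)) u / poly b u ^ Suc (Suc m)) (at u)" .
    then have "deriv (\<lambda>v. poly (quot_num F b m) v / poly b v ^ Suc m) u = poly (quot_num F b (Suc m)) u / poly b u ^ Suc (Suc m)"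
      by (rule DERIV_imp_deriv)
    then show ?case using deriv_cong_ev[OF elim(2) refl] by simp
  qed
qed (use assms in auto)

text \<open>Each differentiation lowers a positive order of vanishing by exactly one: the cofactor
  at 0 is multiplied by j - m and by b(0), both nonzero.\<close>

lemma quot_num_monom:
  assumes "m \<le> j" "poly b 0 \<noteq> 0"
  shows "\<exists>h. quot_num (monom 1 j * g) b m = monom 1 (j - m) * h \<and> (poly h 0 = 0 \<longleftrightarrow> poly g 0 = 0)"
  using assms(1)
proof (induction m)
  case (Suc m)
  then obtain h where h: "quot_num (monom 1 j * g) b m = monom 1 (j - m) * h"
    "poly h 0 = 0 \<longleftrightarrow> poly g 0 = 0" by auto
  obtain a where a: "j - m = Suc a" using Suc.prems by (metis Suc_diff_Suc Suc_le_lessD)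
  let ?h = "Polynomial.smult (real (Suc a)) (h * b) + monom 1 1 * (pderiv h * b - Polynomial.smult (real (Suc m)) (h * pderiv b))"
  have m': "monom (of_nat (Suc a) * 1) (Suc a - 1) = Polynomial.smult (real (Suc a)) (monom 1 a)"
    by (simp add: smult_monom)
  have m: "monom 1 (Suc a) = monom (1::real) 1 * monom 1 a" by (simp add: mult_monom)
  have "quot_num (monom 1 j * g) b (Suc m) = monom 1 a * ?h"
    unfolding quot_num.simps h a pderiv_mult pderiv_monom m' unfolding m
    by (simp add: algebra_simps smult_add_right smult_diff_right)
  moreover have "poly ?h 0 = real (Suc a) * poly h 0 * poly b 0" by (simp add: poly_monom)
  moreover have "a = j - Suc m" using a by simp
  ultimately show ?case using h assms(2) by (intro exI[of _ ?h]) auto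
qed auto

text \<open>Dividing by b does not change the order of vanishing at 0. \<open>taylor_vanish\<close>
  inspects orders from 1 on; order 0 is supplied by the assumption on F.\<close>

lemma taylor_vanish_quotient_iff:
  assumes f: "\<forall>\<^sub>F u in nhds 0. f u = poly F u / poly b u" and b: "poly b 0 \<noteq> 0" and F: "coeff F 0 = 0"
  shows "taylor_vanish f k \<longleftrightarrow> (\<forall>i\<le>k. coeff F i = 0)"
proof -
  have d: "(deriv ^^ m) f 0 = poly (quot_num F b m) 0 / poly b 0 ^ Suc m" for m
    using higher_deriv_quotient[OF f b, of m] by (rule eventually_nhds_x_imp_x)
  have tv: "taylor_vanish f k \<longleftrightarrow> (\<forall>m\<in>{1..k}. poly (quot_num F b m) 0 = 0)"
    unfolding taylor_vanish_def d using b by simp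
  show ?thesis
  proof
    assume L: "taylor_vanish f k"
    show "\<forall>i\<le>k. coeff F i = 0"
    proof (rule ccontr)
      assume "\<not> ?thesis"
      then obtain i0 where i0: "i0 \<le> k" "coeff F i0 \<noteq> 0" by blast
      define i where "i = (LEAST i. coeff F i \<noteq> 0)"
      have i: "coeff F i \<noteq> 0" "\<And>j. j < i \<Longrightarrow> coeff F j = 0"
        unfolding i_def using i0 LeastI[of "\<lambda>i. coeff F i \<noteq> 0"] by (auto dest: not_less_Least)
      have ik: "i \<le> k" using i0 i by (meson le_trans not_le)
      have "i > 0" using i F by (cases i) auto
      have "monom 1 i dvd F" using i by (simp add: monom_1_dvd_iff')
      then obtain g where g: "F = monom 1 i * g" by (rule dvdE)
      have "coeff F i = coeff g 0" unfolding g by (simp add: coeff_monom_mult)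
      then have "poly g 0 \<noteq> 0" using i by (simp add: poly_0_coeff_0)
      then have "poly (quot_num F b i) 0 \<noteq> 0"
        using quot_num_monom[of i i b g] b by (auto simp: g)
      then show False using L tv ik \<open>i > 0\<close> by auto
    qed
  next
    assume R: "\<forall>i\<le>k. coeff F i = 0"
    then have "monom 1 (Suc k) dvd F" by (simp add: monom_1_dvd_iff' less_Suc_eq_le)
    then obtain g where g: "F = monom 1 (Suc k) * g" by (rule dvdE)
    have "poly (quot_num F b m) 0 = 0" if "m \<le> k" for m
      using quot_num_monom[of m "Suc k" b g] b that by (auto simp: g poly_monom)
    then show "taylor_vanish f k" using tv by auto
  qed
qed

text \<open>This evaluates the description operator in \<open>s_coeffs\<close>. Coefficient
  functions supported on {1..k} correspond to polynomials of degree at most k without constant term,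
  and composition with \<open>[:1, 1:]\<close> moves the point z = 1 to 0.\<close>

lemma s_coeffs_eq_root_mod:
  fixes g1 g2 :: "real \<Rightarrow> real" and D Q b :: "real poly"
  assumes g: "\<And>z u. poly b z \<noteq> 0 \<Longrightarrow> g1 z + u * g2 z = (poly D z + u * poly Q z) / poly b z"
    and b: "poly b 1 \<noteq> 0" and D: "poly D 1 = 0" "poly (pderiv D) 1 \<noteq> 0"
    and S: "root_mod (D \<circ>\<^sub>p [:1, 1:]) (Q \<circ>\<^sub>p [:1, 1:]) k S"
  shows "s_coeffs g1 g2 k = coeff S"
proof -
  let ?d = "D \<circ>\<^sub>p [:1, 1:]" and ?q = "Q \<circ>\<^sub>p [:1, 1:]"
  define p where "p s = (\<Sum>j=1..k. monom (s j) j)" for s :: "nat \<Rightarrow> real"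
  have pp: "poly (p s) u = (\<Sum>j=1..k. s j * u ^ j)" for s u
    by (simp add: p_def poly_sum poly_monom)
  have cp: "coeff (p s) i = (if i \<in> {1..k} then s i else 0)" for s i
    by (simp add: p_def coeff_sum)
  have p0: "coeff (p s) 0 = 0" for s by (simp add: cp)
  have dp: "degree (p s) \<le> k" for s
    by (rule degree_le) (simp add: cp)
  have d0: "coeff ?d 0 = 0" using D by (simp flip: poly_0_coeff_0 add: poly_pcompose)
  have "coeff ?d 1 = poly (pderiv ?d) 0" by (simp add: poly_0_coeff_0 coeff_pderiv)
  also have "\<dots> = poly (pderiv D) 1" by (simp add: pderiv_pcompose poly_pcompose pderiv_pCons)
  finally have d1: "coeff ?d 1 \<noteq> 0" using D by simp
  have iff: "taylor_vanish (\<lambda>u. let z = 1 + (\<Sum>j=1..k. s j * u ^ j) in g1 z + u * g2 z) k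
     \<longleftrightarrow> root_mod ?d ?q k (p s)" for s
  proof -
    let ?F = "?d \<circ>\<^sub>p p s + pCons 0 (?q \<circ>\<^sub>p p s)" and ?b = "b \<circ>\<^sub>p ([:1, 1:] \<circ>\<^sub>p p s)"
    have ps0: "poly (p s) 0 = 0" using p0[of s] by (simp add: poly_0_coeff_0)
    have b0: "poly ?b 0 \<noteq> 0" using b ps0 by (simp add: poly_pcompose)
    have "open {u. poly ?b u \<noteq> 0}" by (intro open_Collect_neq continuous_intros)
    then have "\<forall>\<^sub>F u in nhds 0. poly ?b u \<noteq> 0"
      using b0 by (auto simp: eventually_nhds)
    then have "\<forall>\<^sub>F u in nhds 0. (let z = 1 + (\<Sum>j=1..k. s j * u ^ j) in g1 z + u * g2 z) = poly ?F u / poly ?b u"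
    proof eventually_elim
      case (elim u)
      then show ?case using g[of "1 + poly (p s) u" u]
        by (simp add: Let_def pp poly_pcompose)
    qed
    moreover have "coeff ?F 0 = 0" using d0 ps0 by (simp flip: poly_0_coeff_0 add: poly_pcompose)
    ultimately have "taylor_vanish (\<lambda>u. let z = 1 + (\<Sum>j=1..k. s j * u ^ j) in g1 z + u * g2 z) k
       \<longleftrightarrow> (\<forall>i\<le>k. coeff ?F i = 0)"
      by (rule taylor_vanish_quotient_iff[OF _ b0])
    then show ?thesis using p0[of s] dp[of s] by (simp only: root_mod_def simp_thms)
  qed
  show ?thesis
    unfolding s_coeffs_def
  proof (rule the_equality)
    have pS: "p (coeff S) = S"
      by (rule poly_eqI) (use S in \<open>auto simp: cp root_mod_def coeff_eq_0 not_less_eq_eq\<close>)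
    have "coeff S j = 0" if "j \<notin> {1..k}" for j
      using S that by (cases "j = 0") (auto simp: root_mod_def coeff_eq_0)
    then show "(\<forall>j. j \<notin> {1..k} \<longrightarrow> coeff S j = 0) \<and>
      taylor_vanish (\<lambda>u. let z = 1 + (\<Sum>j=1..k. coeff S j * u ^ j) in g1 z + u * g2 z) k"
      unfolding iff pS using S by blast
  next
    fix s assume s: "(\<forall>j. j \<notin> {1..k} \<longrightarrow> s j = 0) \<and>
      taylor_vanish (\<lambda>u. let z = 1 + (\<Sum>j=1..k. s j * u ^ j) in g1 z + u * g2 z) k"
    then have "p s = S" using root_mod_unique[OF d1 _ S] unfolding iff by blast
    then show "s = coeff S" using s by (auto simp: fun_eq_iff cp)
  qed
qed

text \<open>The map a -> d(a) + v q(a) is a small perturbation of multiplication by d'(0) and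
  expands distances by at least half that slope. This converts a small residual into a small
  distance from the exact root, with \<eta> independent of q.\<close>

lemma separation_near_simple_root:
  assumes d: "coeff d 0 = 0" "coeff d 1 \<noteq> 0" and \<delta>: "\<delta> > 0"
  obtains \<eta> where "\<eta> > 0" "\<And>q v a b. pnorm \<delta> q \<le> B \<Longrightarrow> \<bar>v\<bar> \<le> \<eta> \<Longrightarrow> \<bar>a\<bar> \<le> \<eta> \<Longrightarrow> \<bar>b\<bar> \<le> \<eta> \<Longrightarrow>
    \<bar>coeff d 1\<bar> / 2 * \<bar>a - b\<bar> \<le> \<bar>(poly d a + v * poly q a) - (poly d b + v * poly q b)\<bar>"
proof -
  obtain e0 where e0: "d = pCons 0 e0" using d by (cases d) auto
  obtain c e where e: "e0 = pCons c e" by (cases e0)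
  have c: "c = coeff d 1" by (simp add: e0 e)
  have pd: "poly d x = c * x + poly (pCons 0 (pCons 0 e)) x" for x by (simp add: e0 e algebra_simps)
  \<comment> \<open>Chosen so that the part of d of order at least two has Lipschitz constant at
    most |c| / 4 on radius \<delta>' / 2.\<close>
  define \<delta>' where "\<delta>' = min 1 (\<bar>c\<bar> / (8 * (pnorm 1 e + 1)))"
  have e1: "pnorm 1 e + 1 > 0" using pnorm_nonneg[of 1 e] by simp
  have \<delta>'0: "\<delta>' > 0" "\<delta>' \<le> 1" using e1 d c by (auto simp: \<delta>'_def)
  have "2 * \<delta>' * pnorm \<delta>' e \<le> 2 * (\<bar>c\<bar> / (8 * (pnorm 1 e + 1))) * (pnorm 1 e + 1)"
    using \<delta>'0 e1 pnorm_mono[of \<delta>' 1 e] by (intro mult_mono) (auto simp: \<delta>'_def pnorm_nonneg)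
  also have "\<dots> = \<bar>c\<bar> / 4" using e1 by (simp add: field_simps)
  finally have small: "2 * \<delta>' * pnorm \<delta>' e \<le> \<bar>c\<bar> / 4" .
  \<comment> \<open>The last bound gives v q the Lipschitz constant |c| / 4 as well, which leaves
    |c| / 2 of the slope.\<close>
  define \<eta> where "\<eta> = min (\<delta> / 2) (min (\<delta>' / 2) (\<bar>c\<bar> * \<delta> / (8 * (\<bar>B\<bar> + 1))))"
  have "\<eta> > 0" using \<delta> \<delta>'0 d c by (simp add: \<eta>_def)
  moreover have "\<bar>coeff d 1\<bar> / 2 * \<bar>a - b\<bar> \<le> \<bar>(poly d a + v * poly q a) - (poly d b + v * poly q b)\<bar>"
    if q: "pnorm \<delta> q \<le> B" and v: "\<bar>v\<bar> \<le> \<eta>" and a: "\<bar>a\<bar> \<le> \<eta>" and b: "\<bar>b\<bar> \<le> \<eta>" for q v a b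
  proof -
    let ?r = "pCons 0 (pCons 0 e)"
    have "\<bar>poly ?r a - poly ?r b\<bar> \<le> 2 / \<delta>' * pnorm \<delta>' ?r * \<bar>a - b\<bar>"
      using a b \<delta>'0 by (intro poly_lipschitz_pnorm) (auto simp: \<eta>_def)
    also have "2 / \<delta>' * pnorm \<delta>' ?r = 2 * \<delta>' * pnorm \<delta>' e" using \<delta>'0 by simp
    also have "\<dots> * \<bar>a - b\<bar> \<le> \<bar>c\<bar> / 4 * \<bar>a - b\<bar>" using small by (intro mult_right_mono) auto
    finally have 1: "\<bar>poly ?r a - poly ?r b\<bar> \<le> \<bar>c\<bar> / 4 * \<bar>a - b\<bar>" .
    have B: "0 \<le> B" using q pnorm_nonneg[of \<delta> q] \<delta> by linarith
    have "\<bar>v * (poly q a - poly q b)\<bar> \<le> \<bar>c\<bar> * \<delta> / (8 * (\<bar>B\<bar> + 1)) * (2 / \<delta> * pnorm \<delta> q * \<bar>a - b\<bar>)"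
      unfolding abs_mult using v a b \<delta> B by (intro mult_mono poly_lipschitz_pnorm) (auto simp: \<eta>_def)
    also have "\<dots> \<le> \<bar>c\<bar> * \<delta> / (8 * (\<bar>B\<bar> + 1)) * (2 / \<delta> * (\<bar>B\<bar> + 1) * \<bar>a - b\<bar>)"
      using q \<delta> B by (intro mult_left_mono mult_right_mono) auto
    also have "\<dots> = \<bar>c\<bar> / 4 * \<bar>a - b\<bar>"
    proof -
      have R: "x * \<delta> / (8 * E) * (2 / \<delta> * E * t) = x / 4 * t" if "E > 0" for x E t
        using that \<delta> by (simp add: field_simps)
      show ?thesis by (rule R) simp
    qed
    finally have 2: "\<bar>v * (poly q a - poly q b)\<bar> \<le> \<bar>c\<bar> / 4 * \<bar>a - b\<bar>" .
    have "(poly d a + v * poly q a) - (poly d b + v * poly q b)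
      = c * (a - b) + (poly ?r a - poly ?r b) + v * (poly q a - poly q b)"
      by (simp only: pd) (simp add: algebra_simps)
    moreover have "\<bar>c * (a - b)\<bar> = \<bar>c\<bar> * \<bar>a - b\<bar>" by (simp add: abs_mult)
    moreover have "\<bar>X\<bar> = C * t \<Longrightarrow> \<bar>Y\<bar> \<le> C / 4 * t \<Longrightarrow> \<bar>Z\<bar> \<le> C / 4 * t \<Longrightarrow> C / 2 * t \<le> \<bar>X + Y + Z\<bar>" for X Y Z C t :: real
      by (simp add: field_simps abs_if split: if_splits)
    ultimately show ?thesis using 1 2 unfolding c[symmetric] by metis
  qed
  ultimately show ?thesis using that by blast
qed

lemma implicit_root_expansion:
  fixes D Y :: "real poly" and co c1 :: real and \<mu> z :: "nat \<Rightarrow> real" and ob n0 k :: nat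
  assumes D: "poly D 1 = 0" "poly (pderiv D) 1 \<noteq> 0"
    and co: "0 < co" "co < 1" and c1: "c1 > 0"
    and \<mu>: "\<forall>\<^sub>F \<nu> in sequentially. \<mu> \<nu> = c1 * co ^ \<nu>"
    and z: "z \<longlonglongrightarrow> 1"
    and root: "\<forall>\<^sub>F \<nu> in sequentially. poly D (z \<nu>) + \<mu> \<nu> * (z \<nu> ^ (ob * (\<nu> - n0)) * poly Y (z \<nu>)) = 0"
    and g: "\<forall>\<^sub>F \<nu> in sequentially. \<forall>z u. co * z ^ ob \<noteq> 1 \<longrightarrow>
      g1 z + u * g2 \<nu> z = (poly D z + u * (z ^ (ob * (\<nu> - n0)) * poly Y z)) / (1 - co * z ^ ob)"
  shows "(\<lambda>\<nu>. \<bar>z \<nu> - (1 + (\<Sum>j=1..k. s_coeffs g1 (g2 \<nu>) k j * \<mu> \<nu> ^ j))\<bar>) \<in> o(\<lambda>\<nu>. \<mu> \<nu> ^ k)"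
proof -
  \<comment> \<open>Choice of \<delta>: on the disc of radius \<delta> around 1 the power z^(ob s)
    may be as large as (1 + \<delta>)^(ob s). Even the power \<open>Suc k\<close> of this growth has
    to lose against a single factor \<open>co\<close> per step of \<nu>.\<close>
  have "((\<lambda>\<delta>::real. ((1 + \<delta>) ^ ob) ^ Suc k * co) \<longlongrightarrow> ((1 + 0) ^ ob) ^ Suc k * co) (at_right 0)"
    by (intro tendsto_intros)
  then have "\<forall>\<^sub>F \<delta> in at_right (0::real). ((1 + \<delta>) ^ ob) ^ Suc k * co < 1"
    using co by (intro order_tendstoD(2)) auto
  then have "\<forall>\<^sub>F \<delta> in at_right (0::real). ((1 + \<delta>) ^ ob) ^ Suc k * co < 1 \<and> \<delta> > 0"
    using eventually_at_right_less by eventually_elim auto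
  then obtain \<delta> :: real where \<delta>: "((1 + \<delta>) ^ ob) ^ Suc k * co < 1" "\<delta> > 0"
    using eventually_happens'[OF trivial_limit_at_right_real] by blast
  define \<theta>\<^sub>0 where "\<theta>\<^sub>0 = (1 + \<delta>) ^ ob"
  have \<theta>: "\<theta>\<^sub>0 \<ge> 1" using \<delta> by (simp add: \<theta>\<^sub>0_def)
  define \<sigma> where "\<sigma> = \<theta>\<^sub>0 ^ Suc k * co"
  have \<sigma>: "0 < \<sigma>" "\<sigma> < 1" using \<delta> \<theta> co by (auto simp: \<sigma>_def \<theta>\<^sub>0_def)
  define d where "d = D \<circ>\<^sub>p [:1, 1:]"
  define y where "y = Y \<circ>\<^sub>p [:1, 1:]"
  define B where "B = pnorm \<delta> y"
  define Q where "Q \<nu> = monom 1 (ob * (\<nu> - n0)) * Y" for \<nu>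
  define q where "q \<nu> = Q \<nu> \<circ>\<^sub>p [:1, 1:]" for \<nu>
  \<comment> \<open>Normalised so that the norm is at most B for every \<nu>.\<close>
  define q' where "q' \<nu> = Polynomial.smult (inverse (\<theta>\<^sub>0 ^ (\<nu> - n0))) (q \<nu>)" for \<nu>
  have d0: "coeff d 0 = 0" using D by (simp add: d_def flip: poly_0_coeff_0) (simp add: poly_pcompose)
  have "coeff d 1 = poly (pderiv d) 0" by (simp add: poly_0_coeff_0 coeff_pderiv)
  also have "\<dots> = poly (pderiv D) 1" by (simp add: d_def pderiv_pcompose poly_pcompose pderiv_pCons)
  finally have d1: "coeff d 1 \<noteq> 0" using D by simp
  have q_alt: "q \<nu> = [:1, 1:] ^ (ob * (\<nu> - n0)) * y" for \<nu>
  proof (rule poly_ext)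
    show "poly (q \<nu>) w = poly ([:1, 1:] ^ (ob * (\<nu> - n0)) * y) w" for w
      by (simp add: q_def Q_def y_def poly_pcompose poly_monom)
  qed
  have q'B: "pnorm \<delta> (q' \<nu>) \<le> B" for \<nu>
  proof -
    have "pnorm \<delta> (q \<nu>) \<le> pnorm \<delta> ([:1, 1:] ^ (ob * (\<nu> - n0))) * pnorm \<delta> y"
      unfolding q_alt using \<delta> by (intro pnorm_mult) auto
    also have "\<dots> \<le> pnorm \<delta> [:1, 1:] ^ (ob * (\<nu> - n0)) * pnorm \<delta> y"
      using \<delta> by (intro mult_right_mono pnorm_power pnorm_nonneg) auto
    also have "\<dots> = \<theta>\<^sub>0 ^ (\<nu> - n0) * B" by (simp add: \<theta>\<^sub>0_def power_mult B_def)
    finally show ?thesis using \<theta> by (simp add: q'_def pnorm_smult field_simps)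
  qed
  obtain C where C: "C \<ge> 0" "\<And>q. pnorm \<delta> q \<le> B \<Longrightarrow> \<exists>s. root_mod d q k s \<and> (\<forall>i. \<bar>coeff s i\<bar> \<le> C)"
    using root_mod_bounded[OF d0 d1 \<delta>(2), of B k] by blast
  then have "\<exists>s. \<forall>\<nu>. root_mod d (q' \<nu>) k (s \<nu>) \<and> (\<forall>i. \<bar>coeff (s \<nu>) i\<bar> \<le> C)"
    using q'B by (intro choice) auto
  then obtain s where s: "\<And>\<nu>. root_mod d (q' \<nu>) k (s \<nu>)" "\<And>\<nu> i. \<bar>coeff (s \<nu>) i\<bar> \<le> C" by blast
  have s0: "coeff (s \<nu>) 0 = 0" "degree (s \<nu>) \<le> k" for \<nu>
    using s(1)[of \<nu>] by (auto simp: root_mod_def)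
  \<comment> \<open>The solution for the original equation is the bounded one with rescaled
    variable: its value at \<mu> is the value of s at v.\<close>
  define S where "S \<nu> = s \<nu> \<circ>\<^sub>p [:0, \<theta>\<^sub>0 ^ (\<nu> - n0):]" for \<nu>
  have S: "root_mod d (q \<nu>) k (S \<nu>)" for \<nu>
    using root_mod_rescale[of d "inverse (\<theta>\<^sub>0 ^ (\<nu> - n0))" "q \<nu>" k "s \<nu>"] s(1)[of \<nu>] \<theta>
    by (simp add: q'_def S_def)
  define v where "v \<nu> = \<theta>\<^sub>0 ^ (\<nu> - n0) * \<mu> \<nu>" for \<nu>
  have sc: "\<forall>\<^sub>F \<nu> in sequentially. s_coeffs g1 (g2 \<nu>) k = coeff (S \<nu>)"
    using g
  proof eventually_elim
    case (elim \<nu>)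
    show ?case
    proof (rule s_coeffs_eq_root_mod)
      show "poly (1 - Polynomial.smult co (monom 1 ob)) 1 \<noteq> 0" using co by (simp add: poly_monom)
      show "root_mod (D \<circ>\<^sub>p [:1, 1:]) (Q \<nu> \<circ>\<^sub>p [:1, 1:]) k (S \<nu>)" using S[of \<nu>] by (simp add: d_def q_def)
      show "g1 z + u * g2 \<nu> z = (poly D z + u * poly (Q \<nu>) z) / poly (1 - Polynomial.smult co (monom 1 ob)) z"
        if "poly (1 - Polynomial.smult co (monom 1 ob)) z \<noteq> 0" for z u
        using elim that by (simp add: Q_def poly_monom)
    qed (use D in auto)
  qed
  have approx: "1 + (\<Sum>j=1..k. coeff (S \<nu>) j * \<mu> \<nu> ^ j) = 1 + poly (s \<nu>) (v \<nu>)" for \<nu>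
  proof -
    have "(\<Sum>j=1..k. coeff (S \<nu>) j * \<mu> \<nu> ^ j) = (\<Sum>j=1..k. coeff (s \<nu>) j * v \<nu> ^ j)"
      by (simp add: S_def coeff_pcompose_linear v_def power_mult_distrib algebra_simps)
    also have "\<dots> = (\<Sum>j\<le>degree (s \<nu>). coeff (s \<nu>) j * v \<nu> ^ j)"
      using s0[of \<nu>] by (intro sum.mono_neutral_cong) (auto simp: coeff_eq_0 not_less_eq_eq)
    finally show ?thesis by (simp add: poly_altdef)
  qed
  obtain \<eta> where \<eta>: "\<eta> > 0" "\<And>q v a b. pnorm \<delta> q \<le> B \<Longrightarrow> \<bar>v\<bar> \<le> \<eta> \<Longrightarrow> \<bar>a\<bar> \<le> \<eta> \<Longrightarrow> \<bar>b\<bar> \<le> \<eta> \<Longrightarrow>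
    \<bar>coeff d 1\<bar> / 2 * \<bar>a - b\<bar> \<le> \<bar>(poly d a + v * poly q a) - (poly d b + v * poly q b)\<bar>"
    using separation_near_simple_root[OF d0 d1 \<delta>(2), of B] by blast
  obtain r where r: "r > 0" "r \<le> 1" "\<And>\<nu>. pnorm r (s \<nu>) \<le> min \<delta> \<eta>"
    using pnorm_radius_exists[OF C(1), of "min \<delta> \<eta>" k] \<delta> \<eta>(1) s(2) s0 by (metis min_less_iff_conj)
  define C' where "C' = (pnorm \<delta> d + r * B) / r ^ Suc k"
  have C'0: "C' \<ge> 0" unfolding C'_def B_def using r \<delta> by (intro divide_nonneg_nonneg add_nonneg_nonneg mult_nonneg_nonneg pnorm_nonneg) auto
  have resid: "\<bar>poly d (poly (s \<nu>) w) + w * poly (q' \<nu>) (poly (s \<nu>) w)\<bar> \<le> C' * \<bar>w\<bar> ^ Suc k" if "\<bar>w\<bar> \<le> r" for \<nu> w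
  proof -
    let ?H = "d \<circ>\<^sub>p s \<nu> + pCons 0 (q' \<nu> \<circ>\<^sub>p s \<nu>)"
    have "\<bar>poly ?H w\<bar> \<le> pnorm r ?H / r ^ Suc k * \<bar>w\<bar> ^ Suc k"
      using s(1)[of \<nu>] r that by (intro poly_le_of_coeffs_vanish) (auto simp: root_mod_def)
    also have "\<dots> \<le> C' * \<bar>w\<bar> ^ Suc k"
      unfolding C'_def using pnorm_perturbed_pcompose[of r "s \<nu>" \<delta> "q' \<nu>" B d] r r(3)[of \<nu>] q'B
      by (intro mult_right_mono divide_right_mono) auto
    finally show ?thesis by (simp add: poly_pcompose)
  qed
  \<comment> \<open>Of the \<open>Suc k\<close> factors \<mu> one is spent, in the form c1 co^\<nu>,
    on absorbing the growth of the rescaling. The remaining \<sigma>^\<nu> tends to 0, which is the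
    source of the little o.\<close>
  have v_bound: "\<forall>\<^sub>F \<nu> in sequentially. \<bar>v \<nu>\<bar> \<le> c1 * (\<theta>\<^sub>0 * co) ^ \<nu> \<and> \<bar>v \<nu>\<bar> ^ Suc k \<le> c1 * \<sigma> ^ \<nu> * \<bar>\<mu> \<nu> ^ k\<bar>"
    using \<mu>
  proof eventually_elim
    case (elim \<nu>)
    have le: "\<theta>\<^sub>0 ^ (\<nu> - n0) \<le> \<theta>\<^sub>0 ^ \<nu>" using \<theta> by (intro power_increasing) auto
    have v1: "\<bar>v \<nu>\<bar> \<le> \<theta>\<^sub>0 ^ \<nu> * \<bar>\<mu> \<nu>\<bar>"
      using le \<theta> by (simp add: v_def abs_mult mult_right_mono)
    have "\<bar>v \<nu>\<bar> ^ Suc k \<le> (\<theta>\<^sub>0 ^ \<nu> * \<bar>\<mu> \<nu>\<bar>) ^ Suc k" using v1 by (intro power_mono) auto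
    also have "\<dots> = (\<theta>\<^sub>0 ^ Suc k) ^ \<nu> * \<bar>\<mu> \<nu>\<bar> * \<bar>\<mu> \<nu> ^ k\<bar>"
      by (simp only: power_mult_distrib power_abs power_mult[symmetric] mult.commute[of "Suc k"] power_Suc) (simp add: mult.commute)
    also have "\<dots> = c1 * \<sigma> ^ \<nu> * \<bar>\<mu> \<nu> ^ k\<bar>"
      using co c1 by (simp add: elim \<sigma>_def power_mult_distrib abs_mult)
    finally show ?case using v1 co c1 by (simp add: elim power_mult_distrib abs_mult algebra_simps)
  qed
  have "\<theta>\<^sub>0 * co \<le> \<sigma>" unfolding \<sigma>_def using co \<theta> by (intro mult_right_mono) (auto intro: self_le_power simp del: power_Suc)
  then have t\<theta>: "\<bar>\<theta>\<^sub>0 * co\<bar> < 1" using \<sigma> \<theta> co by auto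
  have "(\<lambda>\<nu>. c1 * (\<theta>\<^sub>0 * co) ^ \<nu>) \<longlonglongrightarrow> c1 * 0"
    using t\<theta> by (intro tendsto_mult tendsto_const LIMSEQ_power_zero) auto
  then have "\<forall>\<^sub>F \<nu> in sequentially. c1 * (\<theta>\<^sub>0 * co) ^ \<nu> < min r \<eta>"
    using r \<eta> by (intro order_tendstoD(2)) auto
  moreover have "\<forall>\<^sub>F \<nu> in sequentially. \<bar>z \<nu> - 1\<bar> < \<eta>"
    using tendstoD[OF z \<eta>(1)] by (simp add: dist_real_def)
  ultimately have main: "\<forall>\<^sub>F \<nu> in sequentially. \<bar>z \<nu> - (1 + (\<Sum>j=1..k. s_coeffs g1 (g2 \<nu>) k j * \<mu> \<nu> ^ j))\<bar>
      \<le> (2 / \<bar>coeff d 1\<bar> * C' * c1) * \<sigma> ^ \<nu> * \<bar>\<mu> \<nu> ^ k\<bar>"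
    using sc v_bound root
  proof eventually_elim
    case (elim \<nu>)
    have v: "\<bar>v \<nu>\<bar> \<le> r" "\<bar>v \<nu>\<bar> \<le> \<eta>" using elim by auto
    have ps: "\<bar>poly (s \<nu>) (v \<nu>)\<bar> \<le> \<eta>"
      using poly_le_pnorm[OF v(1), of "s \<nu>"] r(3)[of \<nu>] by simp
    have zero: "poly d (z \<nu> - 1) + v \<nu> * poly (q' \<nu>) (z \<nu> - 1) = 0"
      using elim \<theta> by (simp add: d_def q'_def q_def Q_def v_def poly_pcompose poly_monom field_simps)
    \<comment> \<open>The exact root has residual 0 and the truncated series has residual of order
      v^(k+1), so separation bounds their distance.\<close>
    have "\<bar>coeff d 1\<bar> / 2 * \<bar>(z \<nu> - 1) - poly (s \<nu>) (v \<nu>)\<bar> \<le> C' * \<bar>v \<nu>\<bar> ^ Suc k"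
      using \<eta>(2)[OF q'B[of \<nu>] v(2), of "z \<nu> - 1" "poly (s \<nu>) (v \<nu>)"] elim ps resid[OF v(1), of \<nu>]
      unfolding zero by linarith
    also have "\<dots> \<le> C' * (c1 * \<sigma> ^ \<nu> * \<bar>\<mu> \<nu> ^ k\<bar>)"
      using elim C'0 by (intro mult_left_mono) auto
    finally have "\<bar>(z \<nu> - 1) - poly (s \<nu>) (v \<nu>)\<bar> \<le> 2 / \<bar>coeff d 1\<bar> * C' * c1 * \<sigma> ^ \<nu> * \<bar>\<mu> \<nu> ^ k\<bar>"
      using d1 by (simp add: field_simps)
    then show ?case using elim approx[of \<nu>] by (simp add: algebra_simps)
  qed
  define K where "K = 2 / \<bar>coeff d 1\<bar> * C' * c1"
  have "(\<lambda>\<nu>. K * \<sigma> ^ \<nu>) \<longlonglongrightarrow> K * 0"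
    using \<sigma> by (intro tendsto_mult tendsto_const LIMSEQ_power_zero) auto
  then have lim: "\<forall>\<^sub>F \<nu> in sequentially. K * \<sigma> ^ \<nu> < c" if "c > 0" for c
    using that by (intro order_tendstoD(2)) auto
  show ?thesis
  proof (rule landau_o.smallI)
    fix c :: real assume "c > 0"
    from lim[OF this] main show "\<forall>\<^sub>F \<nu> in sequentially. norm \<bar>z \<nu> - (1 + (\<Sum>j=1..k. s_coeffs g1 (g2 \<nu>) k j * \<mu> \<nu> ^ j))\<bar>
      \<le> c * norm (\<mu> \<nu> ^ k)"
    proof eventually_elim
      case (elim \<nu>)
      have "K * \<sigma> ^ \<nu> * \<bar>\<mu> \<nu> ^ k\<bar> \<le> c * \<bar>\<mu> \<nu> ^ k\<bar>"
        using elim by (intro mult_right_mono) auto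
      then show ?case using elim unfolding K_def by simp
    qed
  qed
qed

subsection \<open>The matrix of the tower\<close>

lemma admissible_iff_successively: "admissible P w \<longleftrightarrow> successively (\<lambda>a b. P a b > 0) w"
  by (simp add: admissible_def successively_conv_nth)

lemma admissible_tl_snoc:
  "admissible P C \<Longrightarrow> C \<noteq> [] \<Longrightarrow> P (last C) a > 0 \<Longrightarrow> admissible P (tl C @ [a])"
  by (cases C) (auto simp: admissible_iff_successively successively_append_iff successively_Cons split: if_splits)

lemma finite_lists_of_length: "finite {w :: 'a::finite list. length w = n}"
  using finite_lists_length_eq[of "UNIV :: 'a set" n] by simp

lemma sum_lists_Suc_snoc:
  fixes f :: "'a::finite list \<Rightarrow> 'b::comm_monoid_add"
  shows "(\<Sum>w | length w = Suc n. f w) = (\<Sum>w | length w = n. \<Sum>a\<in>UNIV. f (w @ [a]))"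
  unfolding sum.cartesian_product
  by (rule sum.reindex_bij_witness[of _ "\<lambda>(w, a). w @ [a]" "\<lambda>w. (butlast w, last w)"])
     (auto simp: length_Suc_conv_rev)

lemma sum_lists_Suc_Cons:
  fixes f :: "'a::finite list \<Rightarrow> 'b::comm_monoid_add"
  shows "(\<Sum>w | length w = Suc n. f w) = (\<Sum>w | length w = n. \<Sum>a\<in>UNIV. f (a # w))"
  unfolding sum.cartesian_product
  by (rule sum.reindex_bij_witness[of _ "\<lambda>(w, a). a # w" "\<lambda>w. (tl w, hd w)"])
     (auto simp: length_Suc_conv)

section \<open>Stationary weights and maximum principle for the chain of n-words\<close>

definition word_weight :: "('a \<Rightarrow> 'a \<Rightarrow> real) \<Rightarrow> ('a \<Rightarrow> real) \<Rightarrow> 'a list \<Rightarrow> real" where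
  "word_weight P \<pi> w = \<pi> (hd w) * (\<Prod>i<length w - 1. P (w ! i) (w ! Suc i))"

lemma word_weight_snoc:
  assumes "w \<noteq> []"
  shows "word_weight P \<pi> (w @ [a]) = word_weight P \<pi> w * P (last w) a"
proof -
  obtain m where m: "length w = Suc m" using assms by (cases w) auto
  have "(\<Prod>i<m. P ((w @ [a]) ! i) ((w @ [a]) ! Suc i)) = (\<Prod>i<m. P (w ! i) (w ! Suc i))"
    using m by (intro prod.cong) (auto simp: nth_append)
  then show ?thesis using assms m
    by (simp add: word_weight_def last_conv_nth nth_append)
qed

lemma word_weight_Cons:
  assumes "w \<noteq> []" "\<pi> (hd w) \<noteq> 0"
  shows "word_weight P \<pi> (a # w) = \<pi> a * P a (hd w) / \<pi> (hd w) * word_weight P \<pi> w"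
proof -
  obtain m where m: "length w = Suc m" using assms by (cases w) auto
  show ?thesis using assms m
    by (simp add: word_weight_def prod.lessThan_Suc_shift hd_conv_nth del: prod.lessThan_Suc)
qed

lemma word_weight_pos_iff:
  assumes "stochastic_irreducible P" "stationary_vector P \<pi>" "w \<noteq> []"
  shows "word_weight P \<pi> w > 0 \<longleftrightarrow> admissible P w"
proof -
  have P: "\<And>a b. P a b \<ge> 0" using assms by (auto simp: stochastic_irreducible_def)
  have "word_weight P \<pi> w > 0 \<longleftrightarrow> (\<Prod>i<length w - 1. P (w ! i) (w ! Suc i)) > 0"
    using assms by (simp add: word_weight_def stationary_vector_def zero_less_mult_iff) (metis less_le_not_le)
  also have "\<dots> \<longleftrightarrow> (\<forall>i<length w - 1. P (w ! i) (w ! Suc i) \<noteq> 0)"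
  proof -
    have "(\<Prod>i<length w - 1. P (w ! i) (w ! Suc i)) \<ge> 0" using P by (intro prod_nonneg) auto
    then have "(\<Prod>i<length w - 1. P (w ! i) (w ! Suc i)) > 0 \<longleftrightarrow> (\<Prod>i<length w - 1. P (w ! i) (w ! Suc i)) \<noteq> 0"
      by linarith
    then show ?thesis by (auto simp: prod_zero_iff)
  qed
  also have "\<dots> \<longleftrightarrow> admissible P w"
  proof -
    have "P a b \<noteq> 0 \<longleftrightarrow> P a b > 0" for a b using P[of a b] by auto
    then show ?thesis unfolding admissible_def by (auto simp: less_diff_conv)
  qed
  finally show ?thesis .
qed

lemma word_weight_nonneg:
  assumes "stochastic_irreducible P" "stationary_vector P \<pi>"
  shows "word_weight P \<pi> w \<ge> 0"
  using assms unfolding word_weight_def stochastic_irreducible_def stationary_vector_def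
  by (intro mult_nonneg_nonneg prod_nonneg) (auto intro: less_imp_le)

text \<open>Words of length n + 1 are summed once by their last letter and once by their first
  letter, where stationarity of \<pi> applies. Thus cylinder weights are invariant under the chain C
  -> tl C @ [a].\<close>

lemma word_weight_stationary:
  assumes pi: "stationary_vector P \<pi>" and n: "n > 0"
  shows "(\<Sum>C | length C = n. word_weight P \<pi> C * (\<Sum>a\<in>UNIV. P (last C) a * g (tl C @ [a])))
       = (\<Sum>C | length C = n. word_weight P \<pi> C * g C)"
proof -
  have ne: "C \<noteq> []" if "length C = n" for C :: "'a list" using that n by auto
  have pos: "\<pi> a > 0" for a using pi by (auto simp: stationary_vector_def)
  have "(\<Sum>C | length C = n. word_weight P \<pi> C * (\<Sum>a\<in>UNIV. P (last C) a * g (tl C @ [a])))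
      = (\<Sum>W | length W = Suc n. word_weight P \<pi> W * g (tl W))"
    unfolding sum_lists_Suc_snoc
    by (intro sum.cong) (auto simp: word_weight_snoc ne sum_distrib_left mult.assoc)
  also have "\<dots> = (\<Sum>C | length C = n. \<Sum>a\<in>UNIV. word_weight P \<pi> (a # C) * g C)"
    unfolding sum_lists_Suc_Cons by simp
  also have "\<dots> = (\<Sum>C | length C = n. word_weight P \<pi> C * g C)"
  proof (intro sum.cong refl)
    fix C :: "'a list" assume "C \<in> {C. length C = n}"
    then have C: "C \<noteq> []" using ne by auto
    have "(\<Sum>a\<in>UNIV. word_weight P \<pi> (a # C) * g C)
        = (\<Sum>a\<in>UNIV. \<pi> a * P a (hd C)) * (word_weight P \<pi> C * g C / \<pi> (hd C))"
      unfolding sum_distrib_right using C pos[of "hd C"]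
      by (intro sum.cong refl) (simp add: word_weight_Cons field_simps)
    also have "(\<Sum>a\<in>UNIV. \<pi> a * P a (hd C)) = \<pi> (hd C)" using pi by (simp add: stationary_vector_def)
    finally show "(\<Sum>a\<in>UNIV. word_weight P \<pi> (a # C) * g C) = word_weight P \<pi> C * g C"
      using pos[of "hd C"] by simp
  qed
  finally show ?thesis .
qed

text \<open>Irreducibility in terms of words. One transition out of a is taken first, so that w is
  nonempty even if a = b, where irreducibility alone could supply the power 0.\<close>

lemma admissible_connection:
  assumes P: "stochastic_irreducible P"
  shows "\<exists>w. w \<noteq> [] \<and> admissible P (a # w) \<and> last w = b"
proof -
  have path: "\<exists>w. w \<noteq> [] \<and> hd w = c \<and> last w = d \<and> admissible P w" if "mpow P m c d > 0" for m c d
    using that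
  proof (induction m arbitrary: d)
    case 0
    then have "c = d" by (simp split: if_splits)
    then show ?case by (intro exI[of _ "[c]"]) (simp add: admissible_def)
  next
    case (Suc m)
    have "\<exists>e. mpow P m c e * P e d > 0"
    proof (rule ccontr)
      assume "\<not> ?thesis"
      then have "(\<Sum>e\<in>UNIV. mpow P m c e * P e d) \<le> 0" by (intro sum_nonpos) (auto simp: not_less)
      then show False using Suc.prems by simp
    qed
    then obtain e where e: "mpow P m c e * P e d > 0" by blast
    moreover have "P e d \<ge> 0" using P by (auto simp: stochastic_irreducible_def)
    ultimately have "mpow P m c e > 0" "P e d > 0" by (auto simp: zero_less_mult_iff)
    from Suc.IH[OF this(1)] obtain w where "w \<noteq> []" "hd w = c" "last w = e" "admissible P w" by blast
    then show ?case using \<open>P e d > 0\<close>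
      by (intro exI[of _ "w @ [d]"]) (auto simp: admissible_iff_successively successively_append_iff)
  qed
  have "(\<Sum>b\<in>UNIV. P a b) = 1" using P by (auto simp: stochastic_irreducible_def)
  then obtain c where "P a c \<noteq> 0" by (metis sum.neutral zero_neq_one)
  then have c: "P a c > 0" using P by (auto simp: stochastic_irreducible_def less_le)
  obtain m where "mpow P m c b > 0" using P unfolding stochastic_irreducible_def by blast
  from path[OF this] obtain w where "w \<noteq> []" "hd w = c" "last w = b" "admissible P w" by blast
  then show ?thesis using c
    by (intro exI[of _ w]) (auto simp: admissible_iff_successively successively_Cons)
qed

text \<open>If a value exceeded f Ct, the maximum would be attained away from Ct. Averaging passes
  it to all successors of positive probability, and irreducibility leads from there to Ct, a
  contradiction.\<close>

lemma maximum_principle: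
  fixes f :: "'a::finite list \<Rightarrow> real"
  assumes P: "stochastic_irreducible P" and n: "n > 0"
    and t: "length Ct = n" "admissible P Ct"
    and harm: "\<And>C. length C = n \<Longrightarrow> admissible P C \<Longrightarrow> C \<noteq> Ct \<Longrightarrow>
      f C = (\<Sum>a\<in>UNIV. P (last C) a * f (tl C @ [a]))"
    and C: "length C = n" "admissible P C"
  shows "f C \<le> f Ct"
proof (rule ccontr)
  assume less: "\<not> f C \<le> f Ct"
  let ?A = "{C. length C = n \<and> admissible P C}"
  have fin: "finite ?A" by (rule finite_subset[OF _ finite_lists_of_length[of n]]) auto
  have P0: "\<And>a b. P a b \<ge> 0" "\<And>a. (\<Sum>b\<in>UNIV. P a b) = 1" using P by (auto simp: stochastic_irreducible_def)
  define m where "m = Max (f ` ?A)"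
  have le: "f C' \<le> m" if "C' \<in> ?A" for C' unfolding m_def using fin that by (intro Max_ge) auto
  have "m \<in> f ` ?A" unfolding m_def using fin t by (intro Max_in) auto
  then obtain C0 where C0: "C0 \<in> ?A" "f C0 = m" by auto
  have tm: "f Ct < m" using less le[of C] C by simp
  have step: "f (tl C' @ [a]) = m" if C': "C' \<in> ?A" "f C' = m" and a: "P (last C') a > 0" for C' a
  proof -
    have ne: "C' \<noteq> []" using C' n by auto
    have adm: "tl C' @ [b] \<in> ?A" if "P (last C') b > 0" for b
      using C' ne that n by (auto intro: admissible_tl_snoc)
    have "(\<Sum>b\<in>UNIV. P (last C') b * (m - f (tl C' @ [b]))) = m * (\<Sum>b\<in>UNIV. P (last C') b) - (\<Sum>b\<in>UNIV. P (last C') b * f (tl C' @ [b]))"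
      by (simp add: right_diff_distrib sum_subtractf sum_distrib_left mult.commute)
    also have "\<dots> = 0" using harm[of C'] C' tm P0 by auto
    finally have "(\<Sum>b\<in>UNIV. P (last C') b * (m - f (tl C' @ [b]))) = 0" .
    moreover have "P (last C') b * (m - f (tl C' @ [b])) \<ge> 0" for b
      using P0(1)[of "last C'" b] adm[of b] le[of "tl C' @ [b]"] by (cases "P (last C') b = 0") auto
    ultimately have "P (last C') a * (m - f (tl C' @ [a])) = 0"
      by (subst (asm) sum_nonneg_eq_0_iff) auto
    then show ?thesis using a by simp
  qed
  \<comment> \<open>Reading u letter by letter moves the window of n letters to the end of
    \<open>C0 @ u\<close>.\<close>
  have reach: "f (drop (length u) (C0 @ u)) = m \<and> drop (length u) (C0 @ u) \<in> ?A"
    if "admissible P (C0 @ u)" for u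
    using that
  proof (induction u rule: rev_induct)
    case (snoc a u)
    let ?w = "drop (length u) (C0 @ u)"
    have prems: "successively (\<lambda>a b. P a b > 0) ((C0 @ u) @ [a])"
      using snoc.prems by (simp add: admissible_iff_successively)
    then have adm: "admissible P (C0 @ u)"
      unfolding admissible_iff_successively by (subst (asm) successively_append_iff) simp
    have "length ?w = n" using C0 by simp
    then have ne: "?w \<noteq> []" using n by force
    have lw: "last ?w = last (C0 @ u)" by (rule last_drop) (use C0 n in auto)
    have "P (last (C0 @ u)) a > 0" using prems C0 n
      by (subst (asm) successively_append_iff) auto
    then have "f (tl ?w @ [a]) = m" using step[of ?w a] snoc.IH[OF adm] lw by simp
    moreover have "drop (length (u @ [a])) (C0 @ u @ [a]) = tl ?w @ [a]"
    proof -
      have "drop (length (u @ [a])) (C0 @ u @ [a]) = drop (Suc (length u)) ((C0 @ u) @ [a])" by simp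
      also have "\<dots> = drop (Suc (length u)) (C0 @ u) @ [a]" using C0 n by (subst drop_append) auto
      also have "\<dots> = tl ?w @ [a]" by (simp only: drop_Suc tl_drop)
      finally show ?thesis .
    qed
    moreover have "admissible P (drop (length (u @ [a])) (C0 @ u @ [a]))"
      using snoc.prems unfolding admissible_iff_successively
      by (metis append_take_drop_id successively_append_iff)
    moreover have "length (drop (length (u @ [a])) (C0 @ u @ [a])) = n" using C0 by simp
    ultimately show ?case by simp
  qed (use C0 in auto)
  have ne: "C0 \<noteq> []" "Ct \<noteq> []" using C0 n t by auto
  obtain w where w: "w \<noteq> []" "admissible P (last C0 # w)" "last w = hd Ct"
    using admissible_connection[OF P] by blast
  \<comment> \<open>The connecting word w ends with the first letter of Ct, so appending the other
    letters makes Ct the final window.\<close>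
  have "admissible P (C0 @ w @ tl Ct)"
    using w C0 t ne unfolding admissible_iff_successively
    by (cases Ct) (auto simp: successively_append_iff successively_Cons)
  from reach[OF this] have "f (drop (length (w @ tl Ct)) (C0 @ w @ tl Ct)) = m" by simp
  moreover have "drop (length (w @ tl Ct)) (C0 @ w @ tl Ct) = Ct"
  proof -
    have w': "w = butlast w @ [hd Ct]" using w by (metis append_butlast_last_id)
    have e: "C0 @ w @ tl Ct = (C0 @ butlast w) @ Ct"
      using ne by (subst w') simp
    have l: "length (w @ tl Ct) = length (C0 @ butlast w)"
      using C0 t w n by (cases w) auto
    show ?thesis unfolding l unfolding e by simp
  qed
  ultimately show False using tm by simp
qed

section \<open>Cofactors of the matrix as functions on base words\<close>

lemma finite_blocks: "finite (blocks P n kC)"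
proof -
  have "blocks P n kC \<subseteq> Sigma {C. length C = n} (\<lambda>C. {1..kC C})" by (auto simp: blocks_def)
  then show ?thesis by (rule finite_subset) (intro finite_SigmaI finite_lists_of_length finite_atLeastAtMost)
qed

text \<open>Inside a tower each level has one successor and costs one factor z; branching happens
  only at the top level. The induction runs over the number of levels above k.\<close>

lemma tower_collapse:
  fixes T :: "'a::finite list \<times> nat \<Rightarrow> real" and z d :: real
  assumes P: "stochastic_irreducible P" and n: "n > 0"
    and k1: "\<And>C. length C = n \<Longrightarrow> admissible P C \<Longrightarrow> kC C \<ge> 1"
    and T: "\<And>b. b \<in> blocks P n kC \<Longrightarrow>
      T b = (if b = (Ct, 1) then d else 0) + z * (\<Sum>b'\<in>blocks P n kC. Mbar_entry P kC b b' * T b')"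
    and C: "length C = n" "admissible P C" and k: "1 \<le> k" "k \<le> kC C"
  shows "T (C, k) = (if k = 1 \<and> C = Ct then d else 0) + z ^ Suc (kC C - k) * (\<Sum>a\<in>UNIV. P (last C) a * T (tl C @ [a], 1))"
  using k
proof (induction "kC C - k" arbitrary: k)
  case 0
  then have k: "k = kC C" by simp
  have b: "(C, k) \<in> blocks P n kC" using C 0 by (auto simp: blocks_def)
  have P0: "\<And>a b. P a b \<ge> 0" using P by (auto simp: stochastic_irreducible_def)
  let ?g = "\<lambda>a. (tl C @ [a], 1::nat)"
  have ne: "C \<noteq> []" using C n by auto
  have adm: "?g a \<in> blocks P n kC" if "P (last C) a \<noteq> 0" for a
  proof -
    have "P (last C) a > 0" using P0[of "last C" a] that by simp
    then have "length (tl C @ [a]) = n" "admissible P (tl C @ [a])"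
      using C ne n by (auto intro: admissible_tl_snoc)
    then show ?thesis using k1[of "tl C @ [a]"] by (auto simp: blocks_def)
  qed
  \<comment> \<open>Transitions of probability zero may lead to inadmissible words, which are not
    blocks. They are discarded before the sum is reindexed by letters and restored
    afterwards.\<close>
  have "(\<Sum>b'\<in>blocks P n kC. Mbar_entry P kC (C, k) b' * T b')
     = (\<Sum>b'\<in>?g ` {a. P (last C) a \<noteq> 0}. Mbar_entry P kC (C, k) b' * T b')"
    using finite_blocks adm
    by (intro sum.mono_neutral_right) (auto simp: Mbar_entry_def k Let_def image_iff)
  also have "\<dots> = (\<Sum>a | P (last C) a \<noteq> 0. P (last C) a * T (?g a))"
    by (subst sum.reindex) (auto simp: inj_on_def Mbar_entry_def k)
  also have "\<dots> = (\<Sum>a\<in>UNIV. P (last C) a * T (?g a))"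
    by (intro sum.mono_neutral_left) auto
  finally show ?case using T[OF b] k by auto
next
  case (Suc m)
  have b: "(C, k) \<in> blocks P n kC" "(C, Suc k) \<in> blocks P n kC" using C Suc by (auto simp: blocks_def)
  have less: "k < kC C" using Suc by simp
  have "(\<Sum>b'\<in>blocks P n kC. Mbar_entry P kC (C, k) b' * T b')
     = (\<Sum>b'\<in>{(C, Suc k)}. Mbar_entry P kC (C, k) b' * T b')"
    using finite_blocks b less by (intro sum.mono_neutral_right) (auto simp: Mbar_entry_def Let_def)
  also have "\<dots> = T (C, Suc k)" using less by (simp add: Mbar_entry_def)
  finally have "T (C, k) = (if k = 1 \<and> C = Ct then d else 0) + z * T (C, Suc k)"
    using T[OF b(1)] by simp
  moreover have "T (C, Suc k) = z ^ Suc (kC C - Suc k) * (\<Sum>a\<in>UNIV. P (last C) a * T (tl C @ [a], 1))"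
    using Suc.hyps(1)[of "Suc k"] Suc.hyps(2) Suc.prems less by simp
  moreover have "Suc (kC C - k) = Suc (Suc (kC C - Suc k))" using less by simp
  ultimately show ?case by (simp add: algebra_simps)
qed

locale tower_matrix =
  fixes P :: "'a::finite \<Rightarrow> 'a \<Rightarrow> real" and \<pi> :: "'a \<Rightarrow> real" and n N :: nat
    and kC :: "'a list \<Rightarrow> nat" and e :: "nat \<Rightarrow> 'a list \<times> nat" and Ct :: "'a list"
  assumes P: "stochastic_irreducible P" and pi: "stationary_vector P \<pi>" and n: "n > 0"
    and k1: "\<And>C. length C = n \<Longrightarrow> admissible P C \<Longrightarrow> kC C \<ge> 1"
    and N: "N = card (blocks P n kC)"
    and e: "bij_betw e {..<N} (blocks P n kC)"
    and Ct: "length Ct = n" "admissible P Ct"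
begin

abbreviation "idx \<equiv> inv_into {..<N} e"
abbreviation "Mz \<equiv> id_minus_zM P kC N e"
abbreviation "t \<equiv> idx (Ct, 1)"
abbreviation "D \<equiv> det Mz"

text \<open>By Cramer's rule \<tau> C / D is the entry of the inverse of id - z Mbar from (C, 1) to
  (Ct, 1). The multiple by D is a polynomial, hence available at z = 1, where the inverse has a
  pole.\<close>

definition \<tau> :: "'a list \<Rightarrow> real poly" where "\<tau> C = cofactor Mz t (idx (C, 1))"

lemma idx: "b \<in> blocks P n kC \<Longrightarrow> idx b < N" "b \<in> blocks P n kC \<Longrightarrow> e (idx b) = b" "i < N \<Longrightarrow> idx (e i) = i"
  using e bij_betw_inv_into_right[OF e] bij_betw_inv_into_left[OF e] bij_betwE[OF bij_betw_inv_into[OF e]]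
  by auto

lemma bt: "(Ct, 1) \<in> blocks P n kC" using Ct k1[OF Ct] by (auto simp: blocks_def)

lemma sum_idx: "(\<Sum>l<N. f l) = (\<Sum>b\<in>blocks P n kC. f (idx b))"
  using idx e by (intro sum.reindex_bij_betw[symmetric] bij_betw_inv_into)

lemma Mz_carrier: "Mz \<in> carrier_mat N N" by (simp add: id_minus_zM_def)

lemma Mz_index: "b \<in> blocks P n kC \<Longrightarrow> b' \<in> blocks P n kC \<Longrightarrow>
  Mz $$ (idx b, idx b') = (if b = b' then 1 else 0) - [:0, Mbar_entry P kC b b':]"
proof -
  assume b: "b \<in> blocks P n kC" "b' \<in> blocks P n kC"
  have "Mz $$ (idx b, idx b') = (if idx b = idx b' then 1 else 0) - [:0, Mbar_entry P kC (e (idx b)) (e (idx b')):]"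
    unfolding id_minus_zM_def using idx(1)[OF b(1)] idx(1)[OF b(2)] by simp
  moreover have "idx b = idx b' \<longleftrightarrow> b = b'" using idx(2)[OF b(1)] idx(2)[OF b(2)] by metis
  ultimately show ?thesis by (simp only: idx(2)[OF b(1)] idx(2)[OF b(2)])
qed

text \<open>Row b of column t in the identity that the matrix times its adjugate is D times the unit
  matrix.\<close>

lemma cofactor_system:
  assumes b: "b \<in> blocks P n kC"
  shows "poly (cofactor Mz t (idx b)) z = (if b = (Ct, 1) then poly D z else 0)
    + z * (\<Sum>b'\<in>blocks P n kC. Mbar_entry P kC b b' * poly (cofactor Mz t (idx b')) z)"
proof -
  let ?f = "\<lambda>b. cofactor Mz t (idx b)"
  have tN: "t < N" using idx(1)[OF bt] .
  have "(Mz * adj_mat Mz) $$ (idx b, t) = (D \<cdot>\<^sub>m 1\<^sub>m N) $$ (idx b, t)"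
    using adj_mat(2)[OF Mz_carrier] by simp
  also have "(Mz * adj_mat Mz) $$ (idx b, t) = (\<Sum>l<N. Mz $$ (idx b, l) * cofactor Mz t l)"
    using Mz_carrier idx(1)[OF b] tN
    by (auto simp: scalar_prod_def adj_mat_def atLeast0LessThan intro!: sum.cong)
  also have "\<dots> = (\<Sum>b'\<in>blocks P n kC. Mz $$ (idx b, idx b') * ?f b')" by (rule sum_idx)
  also have "\<dots> = (\<Sum>b'\<in>blocks P n kC. (if b = b' then ?f b' else 0) - [:0, Mbar_entry P kC b b':] * ?f b')"
    by (intro sum.cong refl) (simp add: Mz_index b left_diff_distrib)
  also have "\<dots> = ?f b - (\<Sum>b'\<in>blocks P n kC. [:0, Mbar_entry P kC b b':] * ?f b')"
    unfolding sum_subtractf using b by (subst sum.delta'[OF finite_blocks]) simp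
  also have "(D \<cdot>\<^sub>m 1\<^sub>m N) $$ (idx b, t) = (if b = (Ct, 1) then D else 0)"
    using idx(1)[OF b] tN idx(2)[OF b] idx(2)[OF bt] by auto
  finally have "?f b = (if b = (Ct, 1) then D else 0) + (\<Sum>b'\<in>blocks P n kC. [:0, Mbar_entry P kC b b':] * ?f b')"
    by (simp add: algebra_simps)
  then have "poly (?f b) z = poly ((if b = (Ct, 1) then D else 0) + (\<Sum>b'\<in>blocks P n kC. [:0, Mbar_entry P kC b b':] * ?f b')) z"
    by simp
  also have "\<dots> = (if b = (Ct, 1) then poly D z else 0)
    + z * (\<Sum>b'\<in>blocks P n kC. Mbar_entry P kC b b' * poly (?f b') z)"
    by (simp add: poly_sum sum_distrib_left mult.assoc)
  finally show ?thesis .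
qed

lemma \<tau>_recursion:
  assumes "length C = n" "admissible P C"
  shows "poly (\<tau> C) z = (if C = Ct then poly D z else 0)
    + z ^ kC C * (\<Sum>a\<in>UNIV. P (last C) a * poly (\<tau> (tl C @ [a])) z)"
proof -
  have "poly (cofactor Mz t (idx (C, 1))) z = (if 1 = (1::nat) \<and> C = Ct then poly D z else 0) +
     z ^ Suc (kC C - 1) * (\<Sum>a\<in>UNIV. P (last C) a * poly (cofactor Mz t (idx (tl C @ [a], 1))) z)"
    using k1[OF assms] by (intro tower_collapse[OF P n k1 cofactor_system] assms) auto
  then show ?thesis using k1[OF assms] by (simp add: \<tau>_def)
qed

lemma weight_Ct: "word_weight P \<pi> Ct > 0"
  using word_weight_pos_iff[OF P pi] Ct n by force

lemma weight_inadmissible: "length C = n \<Longrightarrow> \<not> admissible P C \<Longrightarrow> word_weight P \<pi> C = 0"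
  using word_weight_pos_iff[OF P pi, of C] word_weight_nonneg[OF P pi, of C] n by force

text \<open>The solvability condition of the averaging equation: pairing with the stationary weights
  makes f cancel against its average.\<close>

lemma weighted_average:
  assumes "\<And>C. length C = n \<Longrightarrow> admissible P C \<Longrightarrow>
    f C = (if C = Ct then x else 0) + y C + (\<Sum>a\<in>UNIV. P (last C) a * f (tl C @ [a]))"
  shows "word_weight P \<pi> Ct * x + (\<Sum>C | length C = n. word_weight P \<pi> C * y C) = 0"
proof -
  let ?S = "{C :: 'a list. length C = n}"
  have "(\<Sum>C\<in>?S. word_weight P \<pi> C * f C) = (\<Sum>C\<in>?S. (if C = Ct then word_weight P \<pi> C * x else 0)
    + word_weight P \<pi> C * y C + word_weight P \<pi> C * (\<Sum>a\<in>UNIV. P (last C) a * f (tl C @ [a])))"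
  proof (intro sum.cong refl)
    fix C assume "C \<in> ?S"
    then show "word_weight P \<pi> C * f C = (if C = Ct then word_weight P \<pi> C * x else 0)
      + word_weight P \<pi> C * y C + word_weight P \<pi> C * (\<Sum>a\<in>UNIV. P (last C) a * f (tl C @ [a]))"
      using assms[of C] weight_inadmissible[of C] by (cases "admissible P C") (auto simp: algebra_simps)
  qed
  also have "\<dots> = word_weight P \<pi> Ct * x + (\<Sum>C\<in>?S. word_weight P \<pi> C * y C) + (\<Sum>C\<in>?S. word_weight P \<pi> C * f C)"
    using finite_lists_of_length[of n, where 'a='a] Ct
    by (simp add: sum.distrib word_weight_stationary[OF pi n] sum.delta')
  finally show ?thesis by simp
qed

text \<open>At z = 1 the only source in the recursion of \<tau> is D(1) at Ct, and the solvability
  condition forces it to vanish.\<close>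

lemma D_1: "poly D 1 = 0"
proof -
  have "word_weight P \<pi> Ct * poly D 1 + (\<Sum>C | length C = n. word_weight P \<pi> C * 0) = 0"
  proof (rule weighted_average)
    fix C :: "'a list" assume "length C = n" "admissible P C"
    from \<tau>_recursion[OF this, of 1]
    show "poly (\<tau> C) 1 = (if C = Ct then poly D 1 else 0) + 0 + (\<Sum>a\<in>UNIV. P (last C) a * poly (\<tau> (tl C @ [a])) 1)"
      by simp
  qed
  then have "word_weight P \<pi> Ct * poly D 1 = 0"
    by (simp only: mult_zero_right sum.neutral_const add_0_right)
  then show ?thesis using weight_Ct by (metis mult_eq_0_iff less_irrefl)
qed

text \<open>Since D(1) = 0, the values of \<tau> at 1 are harmonic at every word; the maximum
  principle is applied to them and to their negatives.\<close>

lemma \<tau>_1_constant: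
  assumes "length C = n" "admissible P C"
  shows "poly (\<tau> C) 1 = poly (\<tau> Ct) 1"
proof (rule antisym)
  have harm: "poly (\<tau> C) 1 = (\<Sum>a\<in>UNIV. P (last C) a * poly (\<tau> (tl C @ [a])) 1)"
    if "length C = n" "admissible P C" for C
    using \<tau>_recursion[OF that, of 1] by (simp only: D_1 power_one mult_1 if_cancel add_0)
  show "poly (\<tau> C) 1 \<le> poly (\<tau> Ct) 1"
    by (rule maximum_principle[OF P n Ct _ assms, where f = "\<lambda>C. poly (\<tau> C) 1"]) (rule harm)
  have "- poly (\<tau> C) 1 \<le> - poly (\<tau> Ct) 1"
  proof (rule maximum_principle[OF P n Ct _ assms, where f = "\<lambda>C. - poly (\<tau> C) 1"])
    fix C :: "'a list" assume "length C = n" "admissible P C"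
    from harm[OF this] show "- poly (\<tau> C) 1 = (\<Sum>a\<in>UNIV. P (last C) a * - poly (\<tau> (tl C @ [a])) 1)"
      by (simp add: sum_negf)
  qed
  then show "poly (\<tau> Ct) 1 \<le> poly (\<tau> C) 1" by simp
qed

text \<open>Replacing row \<open>t\<close> of the matrix by a unit vector leaves its determinant equal to the cofactor,
  and a kernel vector of the new matrix is harmonic off \<open>Ct\<close> and vanishes there.\<close>
lemma \<tau>_1_nonzero: "poly (\<tau> Ct) 1 \<noteq> 0"
proof
  assume zero: "poly (\<tau> Ct) 1 = 0"
  have tN: "t < N" using idx(1)[OF bt] .
  define A where "A = mat N N (\<lambda>(i, j). if i = t then (if j = t then 1 else 0) else Mz $$ (i, j))"
  have A: "A \<in> carrier_mat N N" by (simp add: A_def)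
  have del: "mat_delete A t t = mat_delete Mz t t"
    using Mz_carrier by (intro eq_matI) (auto simp: mat_delete_def A_def)
  have "det A = (\<Sum>j<N. A $$ (t, j) * cofactor A t j)"
    by (rule laplace_expansion_row[OF A tN])
  also have "\<dots> = (\<Sum>j<N. if j = t then cofactor A t t else 0)"
    using tN by (intro sum.cong) (auto simp: A_def)
  also have "\<dots> = cofactor A t t" using tN by simp
  also have "\<dots> = \<tau> Ct" by (simp only: \<tau>_def cofactor_def del)
  finally have detA: "det A = \<tau> Ct" .
  interpret ev: comm_ring_hom "\<lambda>p :: real poly. poly p 1" by unfold_locales auto
  define A1 where "A1 = map_mat (\<lambda>p. poly p 1) A"
  have A1: "A1 \<in> carrier_mat N N" using A by (simp add: A1_def)
  have "det A1 = 0" using zero by (simp add: A1_def ev.hom_det detA)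
  then obtain v where v: "v \<in> carrier_vec N" "v \<noteq> 0\<^sub>v N" "A1 *\<^sub>v v = 0\<^sub>v N"
    using det_0_iff_vec_prod_zero_field[OF A1] by blast
  have row: "(\<Sum>j<N. A1 $$ (i, j) * v $ j) = 0" if "i < N" for i
  proof -
    have "(A1 *\<^sub>v v) $ i = 0" using v that by simp
    then show ?thesis using A1 v(1) that by (simp add: scalar_prod_def atLeast0LessThan)
  qed
  define F where "F b = v $ idx b" for b
  have "(\<Sum>j<N. A1 $$ (t, j) * v $ j) = (\<Sum>j<N. if j = t then v $ t else 0)"
    using tN by (intro sum.cong) (auto simp: A1_def A_def)
  then have F0: "F (Ct, 1) = 0" using row[OF tN] tN by (simp add: F_def)
  \<comment> \<open>The residual at the block (Ct, 1), so that the system assumed by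
    \<open>tower_collapse\<close> holds at this block as well.\<close>
  define d where "d = - (\<Sum>b'\<in>blocks P n kC. Mbar_entry P kC (Ct, 1) b' * F b')"
  have Feq: "F b = (if b = (Ct, 1) then d else 0) + 1 * (\<Sum>b'\<in>blocks P n kC. Mbar_entry P kC b b' * F b')"
    if b: "b \<in> blocks P n kC" for b
  proof (cases "b = (Ct, 1)")
    case True
    then show ?thesis using F0 by (simp add: d_def)
  next
    case False
    then have bt': "idx b \<noteq> t" using idx(2)[OF b] idx(2)[OF bt] by metis
    have "0 = (\<Sum>j<N. A1 $$ (idx b, j) * v $ j)" using row[OF idx(1)[OF b]] by simp
    also have "\<dots> = (\<Sum>b'\<in>blocks P n kC. A1 $$ (idx b, idx b') * F b')" unfolding F_def by (rule sum_idx)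
    also have "\<dots> = (\<Sum>b'\<in>blocks P n kC. (if b = b' then F b' else 0) - Mbar_entry P kC b b' * F b')"
      using bt' idx(1)[OF b] idx(1) Mz_index[OF b]
      by (intro sum.cong refl) (auto simp: A1_def A_def left_diff_distrib)
    also have "\<dots> = F b - (\<Sum>b'\<in>blocks P n kC. Mbar_entry P kC b b' * F b')"
      unfolding sum_subtractf using b by (subst sum.delta'[OF finite_blocks]) simp
    finally show ?thesis using False by simp
  qed
  have coll: "F (C, k) = (if k = 1 \<and> C = Ct then d else 0)
      + 1 ^ Suc (kC C - k) * (\<Sum>a\<in>UNIV. P (last C) a * F (tl C @ [a], 1))"
    if "length C = n" "admissible P C" "1 \<le> k" "k \<le> kC C" for C k
    by (rule tower_collapse[OF P n k1 Feq]) (use that in auto)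
  have harm: "F (C, 1) = (\<Sum>a\<in>UNIV. P (last C) a * F (tl C @ [a], 1))"
    if "length C = n" "admissible P C" "C \<noteq> Ct" for C
    using coll[OF that(1,2), of 1] k1[OF that(1,2)] that(3) by simp
  have "F (C, 1) = F (Ct, 1)" if C: "length C = n" "admissible P C" for C
  proof (rule antisym)
    show "F (C, 1) \<le> F (Ct, 1)"
      by (rule maximum_principle[OF P n Ct _ C, where f = "\<lambda>C. F (C, 1)"]) (rule harm)
    have "- F (C, 1) \<le> - F (Ct, 1)"
    proof (rule maximum_principle[OF P n Ct _ C, where f = "\<lambda>C. - F (C, 1)"])
      fix C :: "'a list" assume "length C = n" "admissible P C" "C \<noteq> Ct"
      from harm[OF this] show "- F (C, 1) = (\<Sum>a\<in>UNIV. P (last C) a * - F (tl C @ [a], 1))"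
        by (simp add: sum_negf)
    qed
    then show "F (Ct, 1) \<le> F (C, 1)" by simp
  qed
  then have F1: "F (C, 1) = 0" if "length C = n" "admissible P C" for C using F0 that by simp
  have "F b = 0" if b: "b \<in> blocks P n kC" for b
  proof -
    obtain C k where Ck: "b = (C, k)" "length C = n" "admissible P C" "1 \<le> k" "k \<le> kC C"
      using b by (auto simp: blocks_def)
    have "P (last C) a * F (tl C @ [a], 1) = 0" for a
    proof (cases "P (last C) a > 0")
      case True
      then have "length (tl C @ [a]) = n" "admissible P (tl C @ [a])"
        using Ck n by (auto intro!: admissible_tl_snoc)
      then show ?thesis using F1 by simp
    next
      case False
      then have "P (last C) a = 0" using P by (auto simp: stochastic_irreducible_def less_le)
      then show ?thesis by simp
    qed
    then have "(\<Sum>a\<in>UNIV. P (last C) a * F (tl C @ [a], 1)) = 0" by (intro sum.neutral) blast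
    then show ?thesis
      using coll[OF Ck(2-5)] F1[OF Ck(2,3)] Ck(1) by (cases "k = 1") auto
  qed
  then have "v $ i = 0" if "i < N" for i
    using idx(3)[OF that] bij_betwE[OF e] that unfolding F_def by (metis lessThan_iff)
  then have "v = 0\<^sub>v N" using v(1) by (intro eq_vecI) auto
  then show False using v(2) by simp
qed

text \<open>Differentiating the recursion at 1 and pairing with the stationary weights gives mu_t
  D'(1) = - c m, with mu_t the weight of Ct, c the nonzero constant value of \<tau> at 1 and m > 0
  the mean of the ceiling.\<close>

lemma pderiv_D_1: "poly (pderiv D) 1 \<noteq> 0"
proof
  assume zero: "poly (pderiv D) 1 = 0"
  let ?c = "poly (\<tau> Ct) 1"
  have "poly (pderiv (\<tau> C)) 1 = (if C = Ct then poly (pderiv D) 1 else 0) + real (kC C) * ?c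
    + (\<Sum>a\<in>UNIV. P (last C) a * poly (pderiv (\<tau> (tl C @ [a]))) 1)"
    if C: "length C = n" "admissible P C" for C
  proof -
    have "\<tau> C = (if C = Ct then D else 0) + monom 1 (kC C) * (\<Sum>a\<in>UNIV. Polynomial.smult (P (last C) a) (\<tau> (tl C @ [a])))"
      using \<tau>_recursion[OF C] by (intro poly_ext) (simp add: poly_monom poly_sum)
    then have "poly (pderiv (\<tau> C)) 1 = poly (pderiv ((if C = Ct then D else 0) + monom 1 (kC C) * (\<Sum>a\<in>UNIV. Polynomial.smult (P (last C) a) (\<tau> (tl C @ [a]))))) 1"
      by simp
    also have "\<dots> = (if C = Ct then poly (pderiv D) 1 else 0) + real (kC C) * (\<Sum>a\<in>UNIV. P (last C) a * poly (\<tau> (tl C @ [a])) 1)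
    + (\<Sum>a\<in>UNIV. P (last C) a * poly (pderiv (\<tau> (tl C @ [a]))) 1)"
      by (simp add: pderiv_add pderiv_mult pderiv_monom poly_monom poly_sum higher_pderiv_sum[where n = 1, simplified] pderiv_smult)
    also have "(\<Sum>a\<in>UNIV. P (last C) a * poly (\<tau> (tl C @ [a])) 1) = ?c"
      using \<tau>_recursion[OF C, of 1] \<tau>_1_constant[OF C] by (simp only: D_1 power_one mult_1 if_cancel add_0)
    finally show ?thesis .
  qed
  from weighted_average[of "\<lambda>C. poly (pderiv (\<tau> C)) 1", OF this] zero
  have "?c * (\<Sum>C | length C = n. word_weight P \<pi> C * real (kC C)) = 0"
    by (simp add: sum_distrib_left algebra_simps)
  then have "(\<Sum>C | length C = n. word_weight P \<pi> C * real (kC C)) = 0" using \<tau>_1_nonzero by simp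
  moreover have "(\<Sum>C | length C = n. word_weight P \<pi> C * real (kC C)) > 0"
    using weight_Ct k1[OF Ct] Ct word_weight_nonneg[OF P pi]
    by (intro sum_pos2[of _ Ct] finite_lists_of_length) auto
  ultimately show False by simp
qed

end

subsection \<open>Decay of the set of survivors\<close>

lemma shift_funpow: "(\<theta> ^^ j) y = (\<lambda>i. y (i + j))"
  by (induction j) (auto simp: shift_def)

lemma shift_funpow_SigmaP: "y \<in> SigmaP P \<Longrightarrow> (\<theta> ^^ j) y \<in> SigmaP P"
  by (auto simp: shift_funpow SigmaP_def)

section \<open>The Markov measure on cylinders\<close>

locale markov_shift =
  fixes P :: "'a::finite \<Rightarrow> 'a \<Rightarrow> real" and \<pi> :: "'a \<Rightarrow> real" and M :: "(nat \<Rightarrow> 'a) measure"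
  assumes P: "stochastic_irreducible P" and pi: "stationary_vector P \<pi>" and M: "markov_measure P \<pi> M"
begin

sublocale prob_space M using M by (simp add: markov_measure_def)

lemma sets_M: "sets M = sets (Pi\<^sub>M UNIV (\<lambda>_. count_space UNIV))"
  using M by (simp add: markov_measure_def)

lemma space_M: "space M = UNIV"
  using sets_eq_imp_space_eq[OF sets_M] by (simp add: space_PiM)

lemma coordinate_measurable [measurable]: "(\<lambda>y. y i) \<in> measurable M (count_space UNIV)"
  unfolding measurable_cong_sets[OF sets_M refl] by (rule measurable_component_singleton) simp

lemma measure_word:
  "w \<noteq> [] \<Longrightarrow> measure M {y. \<forall>i<length w. y i = w ! i} = word_weight P \<pi> w"
  using M by (simp add: markov_measure_def word_weight_def)

lemma word_set_measurable: "{y. \<forall>i<length w. y i = w ! i} \<in> sets M"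
proof -
  have "{y \<in> space M. \<forall>i<length w. y i = w ! i} \<in> sets M" by measurable
  then show ?thesis by (simp add: space_M)
qed

lemma AE_SigmaP: "AE y in M. y \<in> SigmaP P"
proof -
  have "AE y in M. P (y i) (y (Suc i)) > 0" for i
  proof -
    define W where "W = {w. length w = Suc (Suc i) \<and> P (w ! i) (w ! Suc i) = 0}"
    have fin: "finite W" by (rule finite_subset[OF _ finite_lists_of_length[of "Suc (Suc i)"]]) (auto simp: W_def)
    have "{y. \<forall>j<length w. y j = w ! j} \<in> null_sets M" if "w \<in> W" for w
    proof -
      have "word_weight P \<pi> w = 0" using that by (auto simp: W_def word_weight_def prod_zero_iff)
      then have "measure M {y. \<forall>j<length w. y j = w ! j} = 0" using that by (subst measure_word) (auto simp: W_def)
      then show ?thesis using word_set_measurable by (simp add: null_sets_def emeasure_eq_measure)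
    qed
    then have "(\<Union>w\<in>W. {y. \<forall>j<length w. y j = w ! j}) \<in> null_sets M"
      using fin by (intro null_sets.finite_UN) auto
    then have "AE y in M. y \<notin> (\<Union>w\<in>W. {y. \<forall>j<length w. y j = w ! j})" by (rule AE_not_in)
    then show ?thesis
    proof eventually_elim
      case (elim y)
      let ?w = "map y [0..<Suc (Suc i)]"
      have w: "\<forall>j<length ?w. y j = ?w ! j" by (simp del: upt_Suc)
      have "P (y i) (y (Suc i)) \<noteq> 0"
      proof
        assume "P (y i) (y (Suc i)) = 0"
        then have "?w \<in> W" by (simp add: W_def del: upt_Suc)
        then show False using elim w by blast
      qed
      moreover have "P (y i) (y (Suc i)) \<ge> 0" using P by (auto simp: stochastic_irreducible_def)
      ultimately show ?case by linarith
    qed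
  qed
  then have "AE y in M. \<forall>i. P (y i) (y (Suc i)) > 0" by (simp add: AE_all_countable)
  then show ?thesis by (simp add: SigmaP_def)
qed

lemma SigmaP_measurable [measurable]: "SigmaP P \<in> sets M"
proof -
  have "{y \<in> space M. \<forall>i. (\<lambda>(a, b). P a b > 0) (y i, y (Suc i))} \<in> sets M" by measurable
  then show ?thesis by (simp add: space_M SigmaP_def)
qed

lemma cyl_altdef: "cyl P w = SigmaP P \<inter> {y. \<forall>i<length w. y i = w ! i}"
  by (auto simp: cyl_def)

lemma cyl_measurable: "cyl P w \<in> sets M"
  unfolding cyl_altdef by (intro sets.Int SigmaP_measurable word_set_measurable)

lemma measure_cyl: "w \<noteq> [] \<Longrightarrow> measure M (cyl P w) = word_weight P \<pi> w"
proof -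
  assume w: "w \<noteq> []"
  have "measure M (cyl P w) = measure M {y. \<forall>i<length w. y i = w ! i}"
    by (rule measure_eq_AE[OF _ cyl_measurable word_set_measurable])
       (use AE_SigmaP in eventually_elim, auto simp: cyl_def)
  then show ?thesis using measure_word[OF w] by simp
qed

lemma cyl_eq_empty: "\<not> admissible P w \<Longrightarrow> cyl P w = {}"
  by (auto simp: cyl_def admissible_def SigmaP_def) (metis Suc_lessD)

end

text \<open>Rounding t to an integer changes the logarithm by a bounded amount, which is of order 1
  / t after division.\<close>

lemma ln_rate_limit:
  fixes a :: "real \<Rightarrow> real"
  assumes c: "c > 0" "C > 0" and z: "z > 0"
    and bd: "\<And>t. t \<ge> 0 \<Longrightarrow> c * inverse z ^ (nat \<lfloor>t\<rfloor> + 1) \<le> a t \<and> a t \<le> C * inverse z ^ nat \<lfloor>t\<rfloor>"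
  shows "Lim at_top (\<lambda>t. - (1 / t) * ln (a t)) = ln z"
proof (rule tendsto_Lim)
  define B where "B = \<bar>ln c\<bar> + \<bar>ln C\<bar> + 2 * \<bar>ln z\<bar>"
  have est: "\<bar>- (1 / t) * ln (a t) - ln z\<bar> \<le> B * inverse t" if t: "t \<ge> 1" for t
  proof -
    let ?m = "nat \<lfloor>t\<rfloor>"
    have m: "real ?m \<le> t" "t \<le> real ?m + 1" using t by linarith+
    have pos: "c * inverse z ^ (?m + 1) > 0" using c z by simp
    then have a0: "a t > 0" using bd[of t] t by linarith
    have lnp: "ln (x * inverse z ^ k) = ln x - real k * ln z" if "x > 0" for x k
      using that z by (simp add: ln_mult ln_realpow ln_inverse)
    have "ln (c * inverse z ^ (?m + 1)) \<le> ln (a t)" using bd[of t] t pos a0 by (subst ln_le_cancel_iff) auto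
    then have 1: "ln c - (real ?m + 1) * ln z \<le> ln (a t)" using lnp[of c "?m + 1"] c by (simp add: add.commute)
    have "ln (a t) \<le> ln (C * inverse z ^ ?m)" using bd[of t] t a0 c z by (subst ln_le_cancel_iff) auto
    then have 2: "ln (a t) \<le> ln C - real ?m * ln z" using lnp[of C ?m] c by simp
    have d1: "\<bar>(t - real ?m) * ln z\<bar> \<le> \<bar>ln z\<bar>" unfolding abs_mult using m by (intro mult_left_le_one_le) (simp, linarith+)
    have "(real ?m + 1) * ln z = real ?m * ln z + ln z" "(t - real ?m) * ln z = t * ln z - real ?m * ln z"
      by (simp_all add: algebra_simps)
    then have "\<bar>ln (a t) + t * ln z\<bar> \<le> B" using 1 2 d1 unfolding B_def by linarith
    moreover have "- (1 / t) * ln (a t) - ln z = - (ln (a t) + t * ln z) * inverse t"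
      using t by (simp add: field_simps)
    ultimately show ?thesis using t by (simp add: abs_mult mult_right_mono)
  qed
  have "((\<lambda>t::real. B * inverse t) \<longlongrightarrow> B * 0) at_top"
    by (intro tendsto_mult tendsto_const tendsto_inverse_0_at_top filterlim_ident)
  then have lim0: "((\<lambda>t::real. B * inverse t) \<longlongrightarrow> 0) at_top" by simp
  have "\<forall>\<^sub>F t in at_top. norm (- (1 / t) * ln (a t) - ln z) \<le> B * inverse t"
    using eventually_ge_at_top[of 1] by eventually_elim (simp only: real_norm_def est)
  then have "((\<lambda>t. - (1 / t) * ln (a t) - ln z) \<longlongrightarrow> 0) at_top"
    by (rule Lim_null_comparison[OF _ lim0])
  then show "((\<lambda>t. - (1 / t) * ln (a t)) \<longlongrightarrow> ln z) at_top" by (simp add: LIM_zero_iff)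
qed simp

section \<open>The special flow with integer heights\<close>

locale cylinder_flow = markov_shift +
  fixes n :: nat and kC :: "'a list \<Rightarrow> nat" and \<phi> :: "(nat \<Rightarrow> 'a) \<Rightarrow> real"
  assumes n: "n > 0"
    and phi_cyl: "\<And>y. y \<in> SigmaP P \<Longrightarrow> \<phi> y = real (kC (map y [0..<n]))"
    and phi_pos: "\<And>y. y \<in> SigmaP P \<Longrightarrow> \<phi> y \<ge> 1"
begin

definition height :: "nat \<Rightarrow> (nat \<Rightarrow> 'a) \<Rightarrow> nat" where
  "height j y = (\<Sum>i<j. kC (map y [i..<i + n]))"

lemma phi_shift: "y \<in> SigmaP P \<Longrightarrow> \<phi> ((\<theta> ^^ i) y) = real (kC (map y [i..<i + n]))"
proof -
  assume y: "y \<in> SigmaP P"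
  have "map (\<lambda>l. y (l + i)) [0..<n] = map y [i..<i + n]"
    by (rule nth_equalityI) (auto simp: add.commute)
  then show ?thesis using phi_cyl[OF shift_funpow_SigmaP[OF y, of i]] by (simp add: shift_funpow)
qed

lemma birk_eq_height: "y \<in> SigmaP P \<Longrightarrow> birk \<phi> j y = real (height j y)"
  by (simp add: birk_def height_def phi_shift)

lemma kC_ge_1: "y \<in> SigmaP P \<Longrightarrow> kC (map y [i..<i + n]) \<ge> 1"
  using phi_shift[of y i] phi_pos[OF shift_funpow_SigmaP, of y i] by simp

lemma height_strict_mono: "y \<in> SigmaP P \<Longrightarrow> strict_mono (\<lambda>j. height j y)"
  using kC_ge_1 by (intro strict_monoI_Suc) (auto simp: height_def Suc_le_eq)

lemma height_add: "height (j + l) y = height j y + height l ((\<theta> ^^ j) y)"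
proof -
  have "map (\<lambda>i. y (i + j)) [i..<i + n] = map y [i + j..<i + j + n]" for i
    by (rule nth_equalityI) (auto simp: add_ac)
  then show ?thesis
    by (simp add: height_def shift_funpow sum.nat_group[symmetric] lessThan_atLeast0 sum.atLeastLessThan_concat[of 0 j "j + l", symmetric]
        sum.shift_bounds_nat_ivl[of _ 0 j l, simplified add_0 add.commute[of l j]])
qed

lemma Nt_eq: "y \<in> SigmaP P \<Longrightarrow> birk \<phi> j y \<le> r \<Longrightarrow> r < birk \<phi> (Suc j) y \<Longrightarrow> Nt \<phi> r y = Suc j"
  unfolding Nt_def
proof (rule Least_equality)
  fix l assume y: "y \<in> SigmaP P" and "birk \<phi> j y \<le> r" "birk \<phi> l y > r"
  then have "height j y < height l y" using birk_eq_height[OF y] by simp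
  then have "j < l" using strict_mono_less[OF height_strict_mono[OF y]] by blast
  then show "Suc j \<le> l" by simp
qed auto

lemma Nt_cases:
  assumes y: "y \<in> SigmaP P" and r: "r \<ge> 0"
  obtains j where "Nt \<phi> r y = Suc j" "birk \<phi> j y \<le> r"
proof -
  have "real l \<le> birk \<phi> l y" for l
    using strict_mono_imp_increasing[OF height_strict_mono[OF y], of l] birk_eq_height[OF y] by simp
  moreover obtain l where "r < real l" using reals_Archimedean2 by blast
  ultimately have ex: "\<exists>l. birk \<phi> l y > r" by (meson less_le_trans)
  have N: "birk \<phi> (Nt \<phi> r y) y > r" unfolding Nt_def by (rule LeastI_ex[OF ex])
  then have "Nt \<phi> r y \<noteq> 0" using r by (auto simp: birk_def intro: Nat.gr0I)
  then obtain j where j: "Nt \<phi> r y = Suc j" by (cases "Nt \<phi> r y") auto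
  then have "\<not> birk \<phi> j y > r" unfolding Nt_def by (metis lessI not_less_Least)
  then show ?thesis using that j by simp
qed

lemma fst_flow:
  assumes y: "y \<in> SigmaP P" and s: "0 \<le> s" "s < \<phi> y" "\<tau> \<ge> 0"
  shows "fst (flow \<phi> \<tau> (y, s)) = (\<theta> ^^ (Nt \<phi> (s + \<tau>) y - 1)) y"
proof (cases "\<tau> < \<phi> y - s")
  case True
  then have "Nt \<phi> (s + \<tau>) y = Suc 0" using y s by (intro Nt_eq) (auto simp: birk_def)
  then show ?thesis using True by (simp add: flow_def)
qed (simp add: flow_def Let_def)

text \<open>The flow stands over \<open>(\<theta> ^^ j) y\<close> exactly while
  \<open>height j y\<close> <= s + \<tau> < \<open>height (Suc j) y\<close>. This replaces a
  condition over a continuum of times by a countable one, from which measurability follows.\<close>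

lemma survivors_eq:
  assumes t: "t \<ge> 0"
  shows "survivors P \<phi> A t = {(y, s). y \<in> SigmaP P \<and> 0 \<le> s \<and> s < \<phi> y \<and>
    (\<forall>j. real (height j y) \<le> s + t \<longrightarrow> (\<theta> ^^ j) y \<notin> A)}"
proof -
  have "(\<forall>\<tau>\<in>{0..t}. fst (flow \<phi> \<tau> (y, s)) \<notin> A) \<longleftrightarrow> (\<forall>j. real (height j y) \<le> s + t \<longrightarrow> (\<theta> ^^ j) y \<notin> A)"
    if y: "y \<in> SigmaP P" and s: "0 \<le> s" "s < \<phi> y" for y s
  proof (intro iffI allI impI ballI)
    fix j assume L: "\<forall>\<tau>\<in>{0..t}. fst (flow \<phi> \<tau> (y, s)) \<notin> A" and j: "real (height j y) \<le> s + t"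
    \<comment> \<open>The first time \<tau> >= 0 at which the flow stands over
      \<open>(\<theta> ^^ j) y\<close>; for j = 0 it is 0.\<close>
    define \<tau> where "\<tau> = max s (birk \<phi> j y) - s"
    have \<tau>: "\<tau> \<in> {0..t}" using j t birk_eq_height[OF y] by (auto simp: \<tau>_def)
    have "Nt \<phi> (s + \<tau>) y = Suc j"
    proof (rule Nt_eq[OF y])
      have "height j y < height (Suc j) y" using height_strict_mono[OF y] by (simp add: strict_mono_def)
      moreover have "s < birk \<phi> (Suc j) y"
      proof -
        have "height (Suc 0) y \<le> height (Suc j) y"
          using strict_mono_mono[OF height_strict_mono[OF y]] by (auto dest: monoD)
        then have "birk \<phi> (Suc 0) y \<le> birk \<phi> (Suc j) y" using birk_eq_height[OF y] by simp
        then show ?thesis using s by (simp add: birk_def)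
      qed
      ultimately show "s + \<tau> < birk \<phi> (Suc j) y" using birk_eq_height[OF y] by (simp add: \<tau>_def)
    qed (simp add: \<tau>_def)
    then show "(\<theta> ^^ j) y \<notin> A" using bspec[OF L \<tau>] fst_flow[OF y s, of \<tau>] \<tau> by simp
  next
    fix \<tau> assume R: "\<forall>j. real (height j y) \<le> s + t \<longrightarrow> (\<theta> ^^ j) y \<notin> A" and \<tau>: "\<tau> \<in> {0..t}"
    obtain j where j: "Nt \<phi> (s + \<tau>) y = Suc j" "birk \<phi> j y \<le> s + \<tau>"
      using Nt_cases[OF y, of "s + \<tau>"] s \<tau> by auto
    then have "real (height j y) \<le> s + t" using \<tau> birk_eq_height[OF y, of j] by auto
    then show "fst (flow \<phi> \<tau> (y, s)) \<notin> A" using R j fst_flow[OF y s, of \<tau>] \<tau> by simp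
  qed
  then show ?thesis unfolding survivors_def by blast
qed

definition avoiding :: "'a list \<Rightarrow> nat \<Rightarrow> (nat \<Rightarrow> 'a) set" where
  "avoiding w t = {y \<in> SigmaP P. \<forall>j. height j y \<le> t \<longrightarrow> (\<theta> ^^ j) y \<notin> cyl P w}"

lemma shift_in_cyl_iff:
  "y \<in> SigmaP P \<Longrightarrow> (\<theta> ^^ j) y \<in> cyl P w \<longleftrightarrow> (\<forall>i<length w. y (i + j) = w ! i)"
  using shift_funpow_SigmaP[of y P j] by (auto simp: cyl_def shift_funpow)

lemma window_measurable [measurable]: "(\<lambda>y. map y [i..<i + n]) \<in> measurable M (count_space UNIV)"
proof -
  have "(\<lambda>y. map y [i..<i + n]) -` {u} \<inter> space M \<in> sets M" for u
  proof (cases "length u = n")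
    case True
    have "map y [i..<i + n] = u \<longleftrightarrow> (\<forall>l<n. y (l + i) = u ! l)" for y :: "nat \<Rightarrow> 'a"
      using True by (simp add: list_eq_iff_nth_eq add.commute[of i])
    then have "(\<lambda>y. map y [i..<i + n]) -` {u} \<inter> space M = {y \<in> space M. \<forall>l<n. y (l + i) = u ! l}"
      by blast
    also have "\<dots> \<in> sets M" by measurable
    finally show ?thesis .
  next
    case False
    then have "(\<lambda>y. map y [i..<i + n]) -` {u} \<inter> space M = {}" by auto
    then show ?thesis by simp
  qed
  then show ?thesis by (subst measurable_count_space_eq2_countable) auto
qed

lemma height_measurable [measurable]: "height j \<in> measurable M (count_space UNIV)"
  unfolding height_def by measurable

lemma survivors_measurable:
  assumes t: "t \<ge> 0"
  shows "survivors P \<phi> (cyl P w) t \<in> sets (M \<Otimes>\<^sub>M lborel)"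
proof -
  have "survivors P \<phi> (cyl P w) t = {ys \<in> space (M \<Otimes>\<^sub>M lborel). fst ys \<in> SigmaP P \<and> 0 \<le> snd ys
      \<and> snd ys < real (height 1 (fst ys)) \<and>
      (\<forall>j. real (height j (fst ys)) \<le> snd ys + t \<longrightarrow> \<not> (\<forall>i<length w. fst ys (i + j) = w ! i))}"
    unfolding survivors_eq[OF t]
    by (auto simp: shift_in_cyl_iff space_pair_measure space_M height_def phi_cyl)
  also have "\<dots> \<in> sets (M \<Otimes>\<^sub>M lborel)" by measurable
  finally show ?thesis .
qed

lemma avoiding_measurable: "avoiding w t \<in> sets M"
proof -
  have "avoiding w t = {y \<in> space M. y \<in> SigmaP P \<and>
      (\<forall>j. height j y \<le> t \<longrightarrow> \<not> (\<forall>i<length w. y (i + j) = w ! i))}"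
    by (auto simp: avoiding_def shift_in_cyl_iff space_M)
  also have "\<dots> \<in> sets M" by measurable
  finally show ?thesis .
qed

text \<open>The survivors lie between two rectangles. For the inner one s < 1 gives s + t < floor t
  + 2, and heights are integers, so those to be checked are at most floor t + 1; its unit fibre
  exists because \<phi> >= 1.\<close>

lemma measure_survivors_bounds:
  assumes t: "t \<ge> 0" and K: "\<And>y. y \<in> SigmaP P \<Longrightarrow> \<phi> y \<le> K"
  shows "measure M (avoiding w (nat \<lfloor>t\<rfloor> + 1)) \<le> measure (M \<Otimes>\<^sub>M lborel) (survivors P \<phi> (cyl P w) t)"
    and "measure (M \<Otimes>\<^sub>M lborel) (survivors P \<phi> (cyl P w) t) \<le> \<bar>K\<bar> * measure M (avoiding w (nat \<lfloor>t\<rfloor>))"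
proof -
  have rect: "measure (M \<Otimes>\<^sub>M lborel) (B \<times> {0..<c}) = c * measure M B"
    "B \<times> {0..<c} \<in> fmeasurable (M \<Otimes>\<^sub>M lborel)" if "B \<in> sets M" "c \<ge> 0" for B and c :: real
  proof -
    have e: "emeasure (M \<Otimes>\<^sub>M lborel) (B \<times> {0..<c}) = ennreal (c * measure M B)"
      using that by (simp add: lborel.emeasure_pair_measure_Times emeasure_eq_measure ennreal_mult[symmetric] mult.commute)
    then show "measure (M \<Otimes>\<^sub>M lborel) (B \<times> {0..<c}) = c * measure M B"
      using that by (simp add: measure_def)
    show "B \<times> {0..<c} \<in> fmeasurable (M \<Otimes>\<^sub>M lborel)"
      using e that by (intro fmeasurableI) auto
  qed
  have up: "survivors P \<phi> (cyl P w) t \<subseteq> avoiding w (nat \<lfloor>t\<rfloor>) \<times> {0..<\<bar>K\<bar>}"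
  proof
    fix ys assume "ys \<in> survivors P \<phi> (cyl P w) t"
    then obtain y s where ys: "ys = (y, s)" and y: "y \<in> SigmaP P" "0 \<le> s" "s < \<phi> y"
      "\<forall>j. real (height j y) \<le> s + t \<longrightarrow> (\<theta> ^^ j) y \<notin> cyl P w"
      unfolding survivors_eq[OF t] by blast
    have "(\<theta> ^^ j) y \<notin> cyl P w" if "height j y \<le> nat \<lfloor>t\<rfloor>" for j
    proof -
      have "real (height j y) \<le> s + t" using that t y(2) by linarith
      then show ?thesis using y by blast
    qed
    then show "ys \<in> avoiding w (nat \<lfloor>t\<rfloor>) \<times> {0..<\<bar>K\<bar>}"
      using y K[OF y(1)] by (auto simp: ys avoiding_def)
  qed
  have lo: "avoiding w (nat \<lfloor>t\<rfloor> + 1) \<times> {0..<1} \<subseteq> survivors P \<phi> (cyl P w) t"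
  proof
    fix ys assume "ys \<in> avoiding w (nat \<lfloor>t\<rfloor> + 1) \<times> {0..<1::real}"
    then obtain y s where ys: "ys = (y, s)" "0 \<le> s" "s < 1" and y: "y \<in> SigmaP P"
      "\<forall>j. height j y \<le> nat \<lfloor>t\<rfloor> + 1 \<longrightarrow> (\<theta> ^^ j) y \<notin> cyl P w" by (auto simp: avoiding_def)
    have "(\<theta> ^^ j) y \<notin> cyl P w" if "real (height j y) \<le> s + t" for j
    proof -
      have "height j y \<le> nat \<lfloor>t\<rfloor> + 1" using that t ys by linarith
      then show ?thesis using y by blast
    qed
    then show "ys \<in> survivors P \<phi> (cyl P w) t"
      unfolding survivors_eq[OF t] using ys y phi_pos[OF y(1)] by auto
  qed
  have fm: "survivors P \<phi> (cyl P w) t \<in> fmeasurable (M \<Otimes>\<^sub>M lborel)"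
    using fmeasurableI2[OF rect(2)[OF avoiding_measurable] up survivors_measurable[OF t]] by simp
  show "measure M (avoiding w (nat \<lfloor>t\<rfloor> + 1)) \<le> measure (M \<Otimes>\<^sub>M lborel) (survivors P \<phi> (cyl P w) t)"
    using measure_mono_fmeasurable[OF lo fmeasurableD[OF rect(2)[OF avoiding_measurable]] fm]
      rect(1)[OF avoiding_measurable, of 1 w "nat \<lfloor>t\<rfloor> + 1"] by simp
  show "measure (M \<Otimes>\<^sub>M lborel) (survivors P \<phi> (cyl P w) t) \<le> \<bar>K\<bar> * measure M (avoiding w (nat \<lfloor>t\<rfloor>))"
    using measure_mono_fmeasurable[OF up survivors_measurable[OF t] rect(2)[OF avoiding_measurable]]
      rect(1)[OF avoiding_measurable] by simp
qed

lemma avoiding_step: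
  assumes y: "y \<in> SigmaP P" "y \<notin> cyl P w"
  shows "y \<in> avoiding w t \<longleftrightarrow> (kC (map y [0..<n]) \<le> t \<longrightarrow> \<theta> y \<in> avoiding w (t - kC (map y [0..<n])))"
proof -
  let ?k = "kC (map y [0..<n])"
  have h1: "height (Suc j) y = ?k + height j (\<theta> y)" for j
    using height_add[of 1 j y] by (simp add: height_def)
  have \<theta>y: "\<theta> y \<in> SigmaP P" using shift_funpow_SigmaP[OF y(1), of 1] by simp
  have "y \<in> avoiding w t \<longleftrightarrow> (\<forall>j. height (Suc j) y \<le> t \<longrightarrow> (\<theta> ^^ Suc j) y \<notin> cyl P w)"
  proof -
    have split: "(\<forall>j. R j) \<longleftrightarrow> R 0 \<and> (\<forall>j. R (Suc j))" for R :: "nat \<Rightarrow> bool"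
      by (metis not0_implies_Suc)
    have "height 0 y \<le> t \<longrightarrow> (\<theta> ^^ 0) y \<notin> cyl P w" using y by simp
    then show ?thesis
      unfolding avoiding_def mem_Collect_eq split[of "\<lambda>j. height j y \<le> t \<longrightarrow> (\<theta> ^^ j) y \<notin> cyl P w"]
      using y(1) by blast
  qed
  also have "\<dots> \<longleftrightarrow> (\<forall>j. ?k + height j (\<theta> y) \<le> t \<longrightarrow> (\<theta> ^^ j) (\<theta> y) \<notin> cyl P w)"
    unfolding h1 by (simp add: funpow_swap1)
  also have "\<dots> \<longleftrightarrow> (?k \<le> t \<longrightarrow> \<theta> y \<in> avoiding w (t - ?k))"
    using \<theta>y by (auto simp: avoiding_def)
  finally show ?thesis .
qed

text \<open>One base step uses flow time \<open>kC (take n v)\<close> and replaces \<rho>^t h(v) by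
  its average over the next letter. Strong induction on t therefore propagates the bounds, with the
  same c1 and c2, from times below the first height. The prefix g collects letters already read, so
  that conditioning on them is just lengthening a cylinder.\<close>

lemma avoiding_decay_on_words:
  fixes h :: "'a list \<Rightarrow> real" and c1 c2 \<rho> :: real
  assumes w: "length w = L" "n \<le> L" and \<rho>: "\<rho> > 0" and hw: "h w = 0"
    and harm: "\<And>v. length v = L \<Longrightarrow> admissible P v \<Longrightarrow> v \<noteq> w \<Longrightarrow>
      \<rho> ^ kC (take n v) * h v = (\<Sum>b\<in>UNIV. P (last v) b * h (tl v @ [b]))"
    and base: "\<And>v t. length v = L \<Longrightarrow> admissible P v \<Longrightarrow> v \<noteq> w \<Longrightarrow> t < kC (take n v) \<Longrightarrow>
      c1 * (\<rho> ^ t * h v) \<le> 1 \<and> 1 \<le> c2 * (\<rho> ^ t * h v)"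
    and v: "length v = L"
  shows "c1 * (\<rho> ^ t * h v) * measure M (cyl P (g @ v)) \<le> measure M {y \<in> cyl P (g @ v). (\<theta> ^^ length g) y \<in> avoiding w t} \<and>
    measure M {y \<in> cyl P (g @ v). (\<theta> ^^ length g) y \<in> avoiding w t} \<le> c2 * (\<rho> ^ t * h v) * measure M (cyl P (g @ v))"
  using v
proof (induction t arbitrary: g v rule: less_induct)
  case (less t)
  let ?S = "\<lambda>g v t. {y \<in> cyl P (g @ v). (\<theta> ^^ length g) y \<in> avoiding w t}"
  let ?k = "kC (take n v)"
  have vne: "v \<noteq> []" using less.prems w n by auto
  have pre: "map ((\<theta> ^^ length g) y) [0..<n] = take n v" "(\<theta> ^^ length g) y \<in> SigmaP P" "y \<in> SigmaP P"
    "(\<theta> ^^ length g) y \<in> cyl P w \<longleftrightarrow> v = w" if "y \<in> cyl P (g @ v)" for y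
  proof -
    have eq: "y (i + length g) = v ! i" if "i < L" for i
    proof -
      have "y (i + length g) = (g @ v) ! (i + length g)"
        using \<open>y \<in> cyl P (g @ v)\<close> that less.prems unfolding cyl_def by auto
      then show ?thesis by (simp add: nth_append)
    qed
    show "map ((\<theta> ^^ length g) y) [0..<n] = take n v"
      using eq less.prems w by (intro nth_equalityI) (auto simp: shift_funpow)
    show y: "y \<in> SigmaP P" using that by (simp add: cyl_def)
    then show "(\<theta> ^^ length g) y \<in> SigmaP P" by (rule shift_funpow_SigmaP)
    show "(\<theta> ^^ length g) y \<in> cyl P w \<longleftrightarrow> v = w"
      unfolding shift_in_cyl_iff[OF y] using eq w less.prems by (auto simp: list_eq_iff_nth_eq)
  qed
  consider "v = w" | "\<not> admissible P (g @ v)" | "v \<noteq> w" "admissible P (g @ v)" by blast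
  then show ?case
  proof cases
    case 1
    \<comment> \<open>A point whose current window is w is in the hole at height 0; h w = 0 turns
      both bounds into 0.\<close>
    have empty: "?S g v t = {}"
    proof -
      have "(\<theta> ^^ length g) y \<notin> avoiding w t" if "y \<in> cyl P (g @ v)" for y
        using pre[OF that] 1 unfolding avoiding_def
        by (auto simp: height_def intro!: exI[of _ 0])
      then show ?thesis by blast
    qed
    show ?thesis unfolding empty using hw 1 by simp
  next
    case 2
    then have "cyl P (g @ v) = {}" by (rule cyl_eq_empty)
    then show ?thesis by simp
  next
    case 3
    have adm: "admissible P v" using 3(2)
      by (auto simp: admissible_iff_successively successively_append_iff)
    have step: "(\<theta> ^^ length g) y \<in> avoiding w t \<longleftrightarrow> (?k \<le> t \<longrightarrow> (\<theta> ^^ Suc (length g)) y \<in> avoiding w (t - ?k))"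
      if "y \<in> cyl P (g @ v)" for y
      using avoiding_step[of "(\<theta> ^^ length g) y" w t] pre[OF that] 3 by simp
    show ?thesis
    proof (cases "?k \<le> t")
      case False
      then have "?S g v t = cyl P (g @ v)" using step by auto
      then show ?thesis
        using base[OF less.prems adm 3(1), of t] False
          mult_right_mono[of "c1 * (\<rho> ^ t * h v)" 1 "measure M (cyl P (g @ v))"]
          mult_right_mono[of 1 "c2 * (\<rho> ^ t * h v)" "measure M (cyl P (g @ v))"] by simp
    next
      case True
      let ?g = "g @ [hd v]" and ?v = "\<lambda>b. tl v @ [b]" and ?t = "t - ?k"
      have gv: "?g @ ?v b = (g @ v) @ [b]" for b using vne by simp
      have len: "length (?v b) = L" for b using less.prems vne by (cases v) auto
      have k1: "?k \<ge> 1"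
      proof (rule ccontr)
        assume "\<not> ?k \<ge> 1"
        then have "?k = 0" by simp
        have "measure M (cyl P (g @ v)) > 0"
          using word_weight_pos_iff[OF P pi, of "g @ v"] 3 vne by (simp add: measure_cyl)
        then have "cyl P (g @ v) \<noteq> {}" by auto
        then obtain y where y: "y \<in> cyl P (g @ v)" by blast
        show False using phi_cyl[OF pre(2)[OF y]] phi_pos[OF pre(2)[OF y]] pre(1)[OF y] \<open>?k = 0\<close> by simp
      qed
      have mcyl: "measure M (cyl P (?g @ ?v b)) = measure M (cyl P (g @ v)) * P (last v) b" for b
        unfolding gv using vne by (simp add: measure_cyl word_weight_snoc del: append_assoc)
      have split: "?S g v t = (\<Union>b\<in>UNIV. ?S ?g (?v b) ?t)"
      proof -
        have "y \<in> ?S g v t \<longleftrightarrow> y \<in> cyl P (g @ v) \<and> (\<theta> ^^ length ?g) y \<in> avoiding w ?t" for y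
          using step[of y] True by auto
        moreover have "y \<in> cyl P (g @ v) \<longleftrightarrow> (\<exists>b. y \<in> cyl P (?g @ ?v b))" for y
          unfolding gv by (auto simp: cyl_def nth_append less_Suc_eq)
        ultimately show ?thesis by blast
      qed
      have disj: "disjoint_family (\<lambda>b. ?S ?g (?v b) ?t)"
      proof -
        have "y (length (g @ v)) = b" if "y \<in> cyl P (?g @ ?v b)" for y b
          using that unfolding gv cyl_def by (auto dest!: spec[of _ "length (g @ v)"] simp: nth_append)
        then show ?thesis unfolding disjoint_family_on_def by blast
      qed
      have meas: "?S g v t \<in> sets M" for g v t
      proof -
        have "?S g v t = {y \<in> space M. y \<in> cyl P (g @ v) \<and>
            (\<forall>j. height j ((\<theta> ^^ length g) y) \<le> t \<longrightarrow> \<not> (\<forall>i<length w. y (i + (j + length g)) = w ! i))}"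
          (is "_ = ?R")
        proof -
          have "(\<theta> ^^ length g) y \<in> avoiding w t \<longleftrightarrow>
            (\<forall>j. height j ((\<theta> ^^ length g) y) \<le> t \<longrightarrow> \<not> (\<forall>i<length w. y (i + (j + length g)) = w ! i))"
            if "y \<in> cyl P (g @ v)" for y
          proof -
            have y: "y \<in> SigmaP P" using that by (simp add: cyl_def)
            then show ?thesis using shift_funpow_SigmaP[OF y, of "length g"] shift_in_cyl_iff[of "(\<theta> ^^ length g) y"]
              by (simp add: avoiding_def) (simp add: shift_funpow add.assoc)
          qed
          then show ?thesis by (auto simp: space_M)
        qed
        moreover have "(\<lambda>y. height j ((\<theta> ^^ l) y)) \<in> measurable M (count_space UNIV)" for j l
        proof -
          have "(\<lambda>y. height j ((\<theta> ^^ l) y)) = (\<lambda>y. height (l + j) y - height l y)"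
            by (simp add: height_add)
          then show ?thesis by simp
        qed
        note [measurable] = this cyl_measurable
        have "?R \<in> sets M" by measurable
        ultimately show ?thesis by simp
      qed
      have sum: "measure M (?S g v t) = (\<Sum>b\<in>UNIV. measure M (?S ?g (?v b) ?t))"
      proof -
        have "range (\<lambda>b. ?S ?g (?v b) ?t) \<subseteq> sets M" using meas[of ?g _ ?t] by blast
        then show ?thesis unfolding split using disj by (rule finite_measure_finite_Union[OF finite])
      qed
      have \<rho>t: "\<rho> ^ t * h v = \<rho> ^ ?t * (\<Sum>b\<in>UNIV. P (last v) b * h (?v b))"
      proof -
        have "\<rho> ^ t = \<rho> ^ ?t * \<rho> ^ ?k" using True by (simp flip: power_add)
        then show ?thesis using harm[OF less.prems adm 3(1)] by (simp add: mult.assoc)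
      qed
      have eq: "c * (\<rho> ^ t * h v) * measure M (cyl P (g @ v))
          = (\<Sum>b\<in>UNIV. c * (\<rho> ^ ?t * h (?v b)) * measure M (cyl P (?g @ ?v b)))" for c
        unfolding \<rho>t mcyl by (simp add: sum_distrib_left sum_distrib_right mult_ac)
      have IH: "c1 * (\<rho> ^ ?t * h (?v b)) * measure M (cyl P (?g @ ?v b)) \<le> measure M (?S ?g (?v b) ?t) \<and>
         measure M (?S ?g (?v b) ?t) \<le> c2 * (\<rho> ^ ?t * h (?v b)) * measure M (cyl P (?g @ ?v b))" for b
        using k1 True by (intro less.IH len) auto
      show ?thesis unfolding eq sum using IH by (auto intro!: sum_mono)
    qed
  qed
qed

lemma escape_rate_cyl:
  fixes h :: "'a list \<Rightarrow> real"
  assumes w: "length w = L" "n \<le> L" and z: "z > 0" and hw: "h w = 0"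
    and pos: "\<And>v. length v = L \<Longrightarrow> admissible P v \<Longrightarrow> v \<noteq> w \<Longrightarrow> h v > 0"
    and harm: "\<And>v. length v = L \<Longrightarrow> admissible P v \<Longrightarrow> v \<noteq> w \<Longrightarrow>
      h v = z ^ kC (take n v) * (\<Sum>b\<in>UNIV. P (last v) b * h (tl v @ [b]))"
    and other: "\<exists>v. length v = L \<and> admissible P v \<and> v \<noteq> w"
  shows "escape_rate P M (cyl P w) \<phi> = ln z"
proof -
  define \<rho> where "\<rho> = inverse z"
  have \<rho>: "\<rho> > 0" using z by (simp add: \<rho>_def)
  \<comment> \<open>The finitely many values of \<rho>^t h(v) before the first height is reached,
    all positive. Sums over X and over the reciprocals dominate each single term and supply c1 and
    c2.\<close>
  define X where "X = (\<Union>v\<in>{v. length v = L \<and> admissible P v \<and> v \<noteq> w}. (\<lambda>t. \<rho> ^ t * h v) ` {..<kC (take n v)})"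
  have finX: "finite X" unfolding X_def
    by (intro finite_UN_I finite_imageI finite_subset[OF _ finite_lists_of_length[of L]]) auto
  have X0: "x > 0" if "x \<in> X" for x using that pos \<rho> by (auto simp: X_def)
  define c1 where "c1 = 1 / (1 + \<Sum>X)"
  define c2 where "c2 = 1 + (\<Sum>x\<in>X. 1 / x)"
  have sX: "\<Sum>X \<ge> 0" "(\<Sum>x\<in>X. 1 / x) \<ge> 0"
    by (rule sum_nonneg, use X0 in force)+
  have c0: "c1 > 0" "c2 > 0" using sX by (auto simp: c1_def c2_def)
  have cX: "c1 * x \<le> 1 \<and> 1 \<le> c2 * x" if "x \<in> X" for x
  proof -
    have "x \<le> \<Sum>X" using member_le_sum[OF that, of "\<lambda>x. x"] X0 finX by (auto intro: less_imp_le)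
    then have "c1 * x \<le> 1" using sX by (simp add: c1_def field_simps)
    moreover have "1 / x \<le> (\<Sum>x\<in>X. 1 / x)" using member_le_sum[OF that, of "\<lambda>x. 1 / x"] X0 finX by (auto intro: less_imp_le)
    then have "1 / x \<le> c2" by (simp add: c2_def)
    then have "1 \<le> c2 * x" using X0[OF that] by (simp add: field_simps)
    ultimately show ?thesis by simp
  qed
  have harm': "\<rho> ^ kC (take n v) * h v = (\<Sum>b\<in>UNIV. P (last v) b * h (tl v @ [b]))"
    if "length v = L" "admissible P v" "v \<noteq> w" for v
    using harm[OF that] z by (simp add: \<rho>_def field_simps)
  have base: "c1 * (\<rho> ^ t * h v) \<le> 1 \<and> 1 \<le> c2 * (\<rho> ^ t * h v)"
    if "length v = L" "admissible P v" "v \<noteq> w" "t < kC (take n v)" for v t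
    using that by (intro cX) (auto simp: X_def)
  define H where "H = (\<Sum>v | length v = L. h v * measure M (cyl P v))"
  have L0: "v \<noteq> []" if "length v = L" for v :: "'a list" using that w n by auto
  \<comment> \<open>H is the constant of both exponential bounds; a second admissible word keeps the
    lower one from being 0.\<close>
  have "H > 0"
  proof -
    obtain v where v: "length v = L" "admissible P v" "v \<noteq> w" using other by blast
    have "h u * measure M (cyl P u) \<ge> 0" if "length u = L" for u
    proof (cases "admissible P u \<and> u \<noteq> w")
      case True
      then show ?thesis using pos[of u] that by (simp add: less_imp_le)
    qed (use hw cyl_eq_empty[of u] in auto)
    moreover have "h v * measure M (cyl P v) > 0"
      using pos[OF v] v word_weight_pos_iff[OF P pi L0[OF v(1)]] measure_cyl[OF L0[OF v(1)]] by simp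
    ultimately show ?thesis unfolding H_def using v
      by (intro sum_pos2[of _ v] finite_lists_of_length) auto
  qed
  have decay: "c1 * \<rho> ^ t * H \<le> measure M (avoiding w t) \<and> measure M (avoiding w t) \<le> c2 * \<rho> ^ t * H" for t
  proof -
    let ?S = "\<lambda>v. {y \<in> cyl P v. y \<in> avoiding w t}"
    have "avoiding w t = (\<Union>v\<in>{v. length v = L}. ?S v)"
    proof -
      have "y \<in> cyl P (map y [0..<L])" if "y \<in> avoiding w t" for y
        using that by (auto simp: cyl_def avoiding_def)
      moreover have "length (map y [0..<L]) = L" for y :: "nat \<Rightarrow> 'a" by simp
      ultimately show ?thesis by blast
    qed
    moreover have "disjoint_family_on ?S {v. length v = L}"
      unfolding disjoint_family_on_def cyl_def by (auto simp: list_eq_iff_nth_eq)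
    moreover have "?S v \<in> sets M" for v
    proof -
      have "?S v = cyl P v \<inter> avoiding w t" by auto
      then show ?thesis by (auto intro: cyl_measurable avoiding_measurable)
    qed
    ultimately have "measure M (avoiding w t) = (\<Sum>v | length v = L. measure M (?S v))"
      using finite_measure_finite_Union[OF finite_lists_of_length[of L], of ?S] by auto
    moreover have "c1 * (\<rho> ^ t * h v) * measure M (cyl P v) \<le> measure M (?S v) \<and>
       measure M (?S v) \<le> c2 * (\<rho> ^ t * h v) * measure M (cyl P v)" if "length v = L" for v
      using avoiding_decay_on_words[OF w \<rho> hw harm' base that, of t "[]"] by simp
    moreover have "c * \<rho> ^ t * H = (\<Sum>v | length v = L. c * (\<rho> ^ t * h v) * measure M (cyl P v))" for c
      by (simp add: H_def sum_distrib_left mult_ac)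
    ultimately show ?thesis by (auto intro!: sum_mono)
  qed
  define K where "K = 1 + real (\<Sum>u | length u = n. kC u)"
  have K0: "K > 0" unfolding K_def by (rule add_pos_nonneg) (simp_all del: of_nat_sum)
  have K: "\<phi> y \<le> K" if "y \<in> SigmaP P" for y
  proof -
    have "kC (map y [0..<n]) \<le> (\<Sum>u | length u = n. kC u)"
      by (rule member_le_sum) (auto simp: finite_lists_of_length)
    then have "real (kC (map y [0..<n])) \<le> real (\<Sum>u | length u = n. kC u)" by (simp only: of_nat_le_iff)
    then show ?thesis unfolding K_def phi_cyl[OF that] by linarith
  qed
  show ?thesis unfolding escape_rate_def
  proof (rule ln_rate_limit)
    show "c1 * H > 0" "K * (c2 * H) > 0" using c0 K0 \<open>H > 0\<close> by auto
    fix t :: real assume t: "t \<ge> 0"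
    note b = measure_survivors_bounds[OF t K, of w] decay[of "nat \<lfloor>t\<rfloor> + 1"] decay[of "nat \<lfloor>t\<rfloor>"]
    have upper: "K * measure M (avoiding w (nat \<lfloor>t\<rfloor>)) \<le> K * (c2 * \<rho> ^ nat \<lfloor>t\<rfloor> * H)"
      using b K0 by (intro mult_left_mono) auto
    then show "c1 * H * inverse z ^ (nat \<lfloor>t\<rfloor> + 1) \<le> measure (M \<Otimes>\<^sub>M lborel) (survivors P \<phi> (cyl P w) t) \<and>
      measure (M \<Otimes>\<^sub>M lborel) (survivors P \<phi> (cyl P w) t) \<le> K * (c2 * H) * inverse z ^ nat \<lfloor>t\<rfloor>"
    proof -
      have "c1 * H * inverse z ^ (nat \<lfloor>t\<rfloor> + 1) = c1 * \<rho> ^ (nat \<lfloor>t\<rfloor> + 1) * H"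
        "K * (c2 * H) * inverse z ^ nat \<lfloor>t\<rfloor> = K * (c2 * \<rho> ^ nat \<lfloor>t\<rfloor> * H)"
        by (simp_all add: \<rho>_def mult_ac)
      then show ?thesis using b upper unfolding abs_of_pos[OF K0] by linarith
    qed
  qed (rule z)
qed

end

subsection \<open>The eigenfunction of the open system\<close>

locale periodic_hole = cylinder_flow P \<pi> M n kC \<phi> + tower_matrix P \<pi> n N kC e "map x [0..<n]"
  for P :: "'a::finite \<Rightarrow> 'a \<Rightarrow> real" and \<pi> M n kC \<phi> N e and x :: "nat \<Rightarrow> 'a" +
  fixes p :: nat
  assumes x: "x \<in> SigmaP P" and p: "p > 0" and period: "(\<theta> ^^ p) x = x"
    and minimal: "\<And>q. 0 < q \<Longrightarrow> q < p \<Longrightarrow> (\<theta> ^^ q) x \<noteq> x"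
    and reduced: "reduced_word P (map x [0..<p])" and pn: "p dvd n"
begin

section \<open>Transition probabilities along the periodic orbit\<close>

abbreviation xw :: "nat \<Rightarrow> 'a list" where "xw m \<equiv> map x [0..<m]"

definition tr :: "nat \<Rightarrow> real" where "tr m = P (x m) (x (Suc m))"

definition co :: real where "co = prod tr {0..<p}"

definition ob :: nat where "ob = height p x"

lemma P0: "P a b \<ge> 0" "(\<Sum>b\<in>UNIV. P a b) = 1" using P by (auto simp: stochastic_irreducible_def)

lemma P_le_1: "P a b \<le> 1"
  using member_le_sum[of b UNIV "P a"] P0 by simp

lemma x_add_p: "x (i + p) = x i"
  using fun_cong[OF period, of i] by (simp add: shift_funpow)

lemma x_add_mult_p: "x (i + m * p) = x i"
proof (induction m)
  case (Suc m)
  have "x (i + Suc m * p) = x ((i + m * p) + p)" by (simp add: algebra_simps)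
  then show ?case using Suc by (simp add: x_add_p)
qed simp

text \<open>Agreement over one full period extends to all positions, so the shift by d mod p fixes
  x, and minimality of p makes this remainder 0.\<close>

lemma dvd_if_recurs:
  assumes "\<And>i. i < p \<Longrightarrow> x (i + d) = x i"
  shows "p dvd d"
proof -
  have "x (i + d mod p) = x i" for i
  proof -
    have "x (i + d mod p) = x ((i + d mod p) + (d div p) * p)" by (rule x_add_mult_p[symmetric])
    also have "(i + d mod p) + (d div p) * p = i + d" by simp
    also have "i + d = (i mod p + d) + (i div p) * p" by simp
    also have "x \<dots> = x (i mod p + d)" by (rule x_add_mult_p)
    also have "\<dots> = x (i mod p)" using p by (intro assms) simp
    also have "\<dots> = x (i mod p + (i div p) * p)" by (rule x_add_mult_p[symmetric])
    also have "i mod p + (i div p) * p = i" by simp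
    finally show ?thesis .
  qed
  then have "(\<theta> ^^ (d mod p)) x = x" by (simp add: shift_funpow)
  then have "d mod p = 0" using minimal[of "d mod p"] p by (metis gr0I mod_less_divisor)
  then show ?thesis by presburger
qed

lemma tr_pos: "tr m > 0" using x by (simp add: tr_def SigmaP_def)

lemma tr_le_1: "tr m \<le> 1" by (simp add: tr_def P_le_1)

lemma tr_add_mult_p: "tr (i + m * p) = tr i"
  using x_add_mult_p[of i m] x_add_mult_p[of "Suc i" m] by (simp add: tr_def)

lemma prod_tr_period: "prod tr {a..<a + m * p} = co ^ m"
proof -
  have one: "prod tr {a..<a + p} = co" for a
  proof (induction a)
    case (Suc a)
    have "tr a * prod tr {Suc a..<Suc a + p} = prod tr {a..<Suc a + p}"
      by (subst (2) prod.atLeast_Suc_lessThan) auto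
    also have "\<dots> = prod tr {a..<a + p} * tr (a + p)" by simp
    also have "tr (a + p) = tr a" using tr_add_mult_p[of a 1] by simp
    finally show ?case using Suc tr_pos[of a] by simp
  qed (simp add: co_def)
  show ?thesis
  proof (induction m)
    case (Suc m)
    have "prod tr {a..<a + Suc m * p} = prod tr {a..<a + m * p} * prod tr {a + m * p..<(a + m * p) + p}"
      by (subst prod.atLeastLessThan_concat) (auto simp: algebra_simps)
    then show ?case using Suc one by simp
  qed simp
qed

lemma co_pos: "co > 0" unfolding co_def using tr_pos by (intro prod_pos) auto

lemma prod_tr_bounds: "0 < prod tr A" "prod tr A \<le> 1"
proof -
  show "0 < prod tr A" by (intro prod_pos) (simp add: tr_pos)
  show "prod tr A \<le> 1" by (rule prod_le_1) (simp add: tr_le_1 tr_pos less_imp_le)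
qed

text \<open>The transition into the last letter of a period. The index 2 p - 2 in place of p - 2
  keeps the subtraction of natural numbers correct for p = 1.\<close>

definition \<kappa> :: real where "\<kappa> = tr (2 * p - 2)"

lemma tr_last: assumes "\<nu> * p \<ge> 2" shows "tr (\<nu> * p - 2) = \<kappa>"
proof (cases "\<nu> = 1")
  case True
  have e: "2 * p - 2 = (p - 2) + 1 * p" using assms True by simp
  have "tr (2 * p - 2) = tr (p - 2)" unfolding e by (rule tr_add_mult_p)
  then show ?thesis using True by (simp add: \<kappa>_def)
next
  case False
  moreover have "\<nu> \<noteq> 0" using assms by (intro notI) simp
  ultimately obtain m where m: "\<nu> = m + 2" by (metis add.commute add_2_eq_Suc' not0_implies_Suc One_nat_def)
  have "\<nu> * p - 2 = (2 * p - 2) + m * p" using p by (simp add: m algebra_simps)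
  then show ?thesis using tr_add_mult_p[of "2 * p - 2" m] by (simp add: \<kappa>_def)
qed

text \<open>For p >= 2 the replacement letter of the reduced word has positive probability after the
  same predecessor. For p = 1 the word contains no predecessor; there probability 1 would make
  \<open>x 0\<close> absorbing, against irreducibility.\<close>

lemma \<kappa>_less_1: "\<kappa> < 1"
proof -
  have lt: "P a b < 1" if "P a b' > 0" "b' \<noteq> b" for a b b'
  proof -
    have "(\<Sum>c\<in>{b, b'}. P a c) \<le> (\<Sum>c\<in>UNIV. P a c)" using P0(1) by (intro sum_mono2) auto
    then show ?thesis using that P0(2)[of a] by simp
  qed
  obtain a' where a': "a' \<noteq> last (xw p)" "admissible P (butlast (xw p) @ [a'])"
    using reduced by (auto simp: reduced_word_def)
  have lastx: "last (xw p) = x (p - 1)" using p by (simp add: last_map)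
  show ?thesis
  proof (cases "p = 1")
    case False
    then have p2: "p \<ge> 2" using p by simp
    have len: "length (butlast (xw p)) = p - 1" by simp
    have "P ((butlast (xw p) @ [a']) ! (p - 2)) ((butlast (xw p) @ [a']) ! Suc (p - 2)) > 0"
      using a'(2)[unfolded admissible_def, rule_format, of "p - 2"] p2 len by simp
    moreover have "(butlast (xw p) @ [a']) ! (p - 2) = x (p - 2)"
    proof -
      have "p - 2 < length (butlast (xw p))" "p - 2 < p" using p2 len by auto
      then show ?thesis by (simp add: nth_append nth_butlast)
    qed
    moreover have "(butlast (xw p) @ [a']) ! Suc (p - 2) = a'"
    proof -
      have "Suc (p - 2) = length (butlast (xw p))" using p2 len by simp
      then show ?thesis by (simp only: nth_append_length)
    qed
    ultimately have "P (x (p - 2)) a' > 0" by simp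
    then have "tr (p - 2) < 1"
      using lt[of "x (p - 2)" a' "x (p - 1)"] a'(1) p2 lastx by (simp add: tr_def Suc_diff_Suc numeral_2_eq_2)
    then show ?thesis using tr_last[of 1] p2 by simp
  next
    case True
    have x1: "x (Suc 0) = x 0" using x_add_p[of 0] True by simp
    show ?thesis
    proof (rule ccontr)
      assume "\<not> \<kappa> < 1"
      moreover have "\<kappa> = P (x 0) (x 0)" unfolding \<kappa>_def tr_def using True x1 by simp
      ultimately have "P (x 0) (x 0) \<ge> 1" by linarith
      then have stay: "b = x 0" if "P (x 0) b > 0" for b using lt[OF that, of "x 0"] by force
      obtain w where w: "w \<noteq> []" "admissible P (x 0 # w)" "last w = a'"
        using admissible_connection[OF P] by blast
      have "set u \<subseteq> {x 0}" if "successively (\<lambda>a b. P a b > 0) (x 0 # u)" for u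
        using that
      proof (induction u)
        case (Cons c u)
        then have "c = x 0" using stay by simp
        then show ?case using Cons by simp
      qed simp
      then have "last w = x 0" using w last_in_set[of w] unfolding admissible_iff_successively by blast
      then show False using w a' lastx True by simp
    qed
  qed
qed

lemma co_le_\<kappa>: "co \<le> \<kappa>"
proof -
  have "co = prod tr {p - 1..<(p - 1) + 1 * p}" using prod_tr_period[of "p - 1" 1] by simp
  also have "(p - 1) + 1 * p = Suc (2 * p - 2)" using p by simp
  also have "prod tr {p - 1..<Suc (2 * p - 2)} = prod tr {p - 1..<2 * p - 2} * \<kappa>"
    using p by (simp add: \<kappa>_def)
  also have "\<dots> \<le> 1 * \<kappa>" using prod_tr_bounds tr_pos by (intro mult_right_mono) (auto simp: \<kappa>_def less_imp_le)
  finally show ?thesis by simp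
qed

lemma co_less_1: "co < 1" using co_le_\<kappa> \<kappa>_less_1 by simp

lemma height_mult_p: "height (m * p) x = m * ob"
proof (induction m)
  case (Suc m)
  have "(\<theta> ^^ (m * p)) x = x" by (simp add: shift_funpow x_add_mult_p)
  then show ?case using Suc height_add[of "m * p" p x] by (simp add: ob_def add.commute)
qed (simp add: height_def)

text \<open>The height of the first j steps read off a word alone; it is the true height as long as
  all j windows of n letters fit into the word.\<close>

definition wheight :: "nat \<Rightarrow> 'a list \<Rightarrow> nat" where
  "wheight j v = (\<Sum>i<j. kC (take n (drop i v)))"

lemma wheight_Suc: "wheight (Suc j) v = wheight j v + kC (take n (drop j v))"
  by (simp add: wheight_def)

lemma wheight_tl_snoc:
  assumes "v \<noteq> []" "j + n \<le> length v"
  shows "kC (take n v) + wheight j (tl v @ [b]) = wheight (Suc j) v"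
proof -
  have "take n (drop i (tl v @ [b])) = take n (drop (Suc i) v)" if "i < j" for i
    using that assms by (simp add: drop_Suc tl_drop)
  then have "wheight j (tl v @ [b]) = (\<Sum>i<j. kC (take n (drop (Suc i) v)))"
    unfolding wheight_def by (intro sum.cong) auto
  then show ?thesis by (simp add: wheight_def sum.lessThan_Suc_shift del: sum.lessThan_Suc)
qed

text \<open>Probability that, after a suffix of the form \<open>xw (L - j)\<close> has been read,
  the next \<open>j\<close> letters complete it to \<open>xw L\<close>.\<close>
definition completion :: "nat \<Rightarrow> nat \<Rightarrow> real" where
  "completion L j = prod tr {L - 1 - j..<L - 1}"

lemma completion_Suc: "Suc j < L \<Longrightarrow> completion L (Suc j) = tr (L - 2 - j) * completion L j"
proof -
  assume "Suc j < L"
  then have "L - 1 - Suc j = L - 2 - j" "Suc (L - 2 - j) = L - 1 - j" "L - 2 - j < L - 1" by auto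
  then show ?thesis unfolding completion_def by (subst prod.atLeast_Suc_lessThan) auto
qed

lemma completion_mult_p: "m * p < L \<Longrightarrow> completion L (m * p) = co ^ m"
  using prod_tr_period[of "L - 1 - m * p" m] by (simp add: completion_def)

text \<open>\<open>occ\<close> is \<open>D\<close> times the generating function, in \<open>z\<close>, of the occurrences of \<open>xw L\<close> in a sequence
  that starts with \<open>v\<close>. The occurrences that overlap the end of \<open>v\<close> in more than \<open>n\<close> letters
  contribute \<open>overlaps\<close>; all later ones are counted through the resolvent entries \<open>\<tau> / D\<close>.\<close>
definition overlaps :: "nat \<Rightarrow> real \<Rightarrow> 'a list \<Rightarrow> real" where
  "overlaps L z v = (\<Sum>j<L - n. if drop j v = xw (L - j) then completion L j * z ^ wheight j v else 0)"

definition occ :: "nat \<Rightarrow> real \<Rightarrow> 'a list \<Rightarrow> real" where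
  "occ L z v = poly D z * overlaps L z v
     + completion L (L - n) * (z ^ wheight (L - n) v * poly (\<tau> (drop (L - n) v)) z)"

lemma sum_shift_index:
  fixes f :: "nat \<Rightarrow> 'b::ab_group_add"
  shows "(\<Sum>j<m. f (Suc j)) = (\<Sum>j<m. f j) - f 0 + f m"
  by (induction m) (auto simp: algebra_simps)

text \<open>An overlap of \<open>tl v @ [b]\<close> at offset j is an overlap of v at offset j + 1
  that the letter b has continued correctly, and the probability of b turns
  \<open>completion L j\<close> into \<open>completion L (Suc j)\<close>. The averaged overlap sum
  is thus an index shift, and its term at index 0 is the occurrence v = \<open>xw L\<close>
  itself.\<close>

lemma occ_recursion:
  assumes v: "length v = L" "admissible P v" and L: "n < L"
  shows "occ L z v = (if v = xw L then poly D z else 0)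
    + z ^ kC (take n v) * (\<Sum>b\<in>UNIV. P (last v) b * occ L z (tl v @ [b]))"
proof -
  let ?m = "L - n" and ?k = "kC (take n v)"
  let ?A = "\<lambda>j. if drop j v = xw (L - j) then completion L j * z ^ wheight j v else 0"
  let ?C = "drop ?m v"
  have ne: "v \<noteq> []" using v L by auto
  have drop_eq: "drop j (tl v @ [b]) = drop (Suc j) v @ [b]" if "j < L" for j b
    using that v by (simp add: drop_Suc tl_drop)
  have tm: "z ^ ?k * (\<Sum>b\<in>UNIV. P (last v) b *
      (if drop j (tl v @ [b]) = xw (L - j) then completion L j * z ^ wheight j (tl v @ [b]) else 0)) = ?A (Suc j)"
    if j: "j < ?m" for j
  proof -
    have Lj: "L - j = Suc (L - Suc j)" using j by simp
    have iff: "drop j (tl v @ [b]) = xw (L - j) \<longleftrightarrow> drop (Suc j) v = xw (L - Suc j) \<and> b = x (L - Suc j)" for b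
    proof -
      have jL: "j < L" using j by simp
      show ?thesis unfolding Lj drop_eq[OF jL] by simp
    qed
    show ?thesis
    proof (cases "drop (Suc j) v = xw (L - Suc j)")
      case True
      have "last v = last (drop (Suc j) v)" using j v L n by (intro last_drop[symmetric]) simp
      also have "\<dots> = x (L - Suc j - 1)" unfolding True using j n by (subst last_map) auto
      finally have lv: "last v = x (L - 2 - j)" by (simp add: numeral_2_eq_2)
      have S: "Suc (L - 2 - j) = L - Suc j" using j n by simp
      have "(\<Sum>b\<in>UNIV. P (last v) b *
          (if drop j (tl v @ [b]) = xw (L - j) then completion L j * z ^ wheight j (tl v @ [b]) else 0))
        = (\<Sum>b\<in>UNIV. if b = x (L - Suc j) then P (last v) b * (completion L j * z ^ wheight j (tl v @ [b])) else 0)"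
        unfolding iff using True by (intro sum.cong) auto
      also have "\<dots> = P (last v) (x (L - Suc j)) * (completion L j * z ^ wheight j (tl v @ [x (L - Suc j)]))"
        by simp
      also have "P (last v) (x (L - Suc j)) = tr (L - 2 - j)" unfolding tr_def lv S ..
      finally have sum_eq: "(\<Sum>b\<in>UNIV. P (last v) b *
          (if drop j (tl v @ [b]) = xw (L - j) then completion L j * z ^ wheight j (tl v @ [b]) else 0))
        = completion L (Suc j) * z ^ wheight j (tl v @ [x (L - Suc j)])"
        using j n by (simp add: completion_Suc)
      have "?k + wheight j (tl v @ [x (L - Suc j)]) = wheight (Suc j) v"
        using j v by (intro wheight_tl_snoc ne) simp
      then have "z ^ ?k * z ^ wheight j (tl v @ [x (L - Suc j)]) = z ^ wheight (Suc j) v"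
        by (simp flip: power_add)
      then show ?thesis unfolding sum_eq using True by (simp add: mult.left_commute)
    next
      case False
      then show ?thesis unfolding iff by simp
    qed
  qed
  have "z ^ ?k * (\<Sum>b\<in>UNIV. P (last v) b * overlaps L z (tl v @ [b]))
    = (\<Sum>j<?m. z ^ ?k * (\<Sum>b\<in>UNIV. P (last v) b *
      (if drop j (tl v @ [b]) = xw (L - j) then completion L j * z ^ wheight j (tl v @ [b]) else 0)))"
    unfolding overlaps_def sum_distrib_left by (rule sum.swap)
  also have "\<dots> = (\<Sum>j<?m. ?A (Suc j))" by (intro sum.cong refl tm) simp
  also have "\<dots> = overlaps L z v - ?A 0 + ?A ?m" unfolding overlaps_def by (rule sum_shift_index)
  finally have ovl: "z ^ ?k * (\<Sum>b\<in>UNIV. P (last v) b * overlaps L z (tl v @ [b])) = overlaps L z v - ?A 0 + ?A ?m" .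
  have A0: "?A 0 = (if v = xw L then 1 else 0)" by (simp add: completion_def wheight_def)
  have Lm: "L - ?m = n" using L by simp
  have C: "length ?C = n" "admissible P ?C" "last ?C = last v"
  proof -
    show "length ?C = n" using v L by simp
    show "admissible P ?C" using v(2) unfolding admissible_iff_successively
      by (metis append_take_drop_id successively_append_iff)
    show "last ?C = last v" using v L n by (intro last_drop) simp
  qed
  have takeC: "take n ?C = ?C" using C by simp
  have snoc: "tl ?C @ [b] = drop ?m (tl v @ [b])" for b using L n v by (simp add: drop_eq drop_Suc tl_drop)
  have zk: "z ^ ?k * z ^ wheight ?m (tl v @ [b]) = z ^ wheight ?m v * z ^ kC ?C" for b
  proof -
    have "?k + wheight ?m (tl v @ [b]) = wheight ?m v + kC ?C"
      using wheight_tl_snoc[OF ne, of ?m b] v L wheight_Suc[of ?m v] takeC by simp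
    then show ?thesis by (metis power_add)
  qed
  have "z ^ ?k * (\<Sum>b\<in>UNIV. P (last v) b * (z ^ wheight ?m (tl v @ [b]) * poly (\<tau> (drop ?m (tl v @ [b]))) z))
    = (\<Sum>b\<in>UNIV. P (last v) b * ((z ^ ?k * z ^ wheight ?m (tl v @ [b])) * poly (\<tau> (tl ?C @ [b])) z))"
    unfolding snoc sum_distrib_left by (intro sum.cong refl) (simp only: mult_ac)
  also have "\<dots> = z ^ wheight ?m v * (z ^ kC ?C * (\<Sum>b\<in>UNIV. P (last ?C) b * poly (\<tau> (tl ?C @ [b])) z))"
    unfolding zk sum_distrib_left C(3) by (intro sum.cong refl) (simp only: mult_ac)
  also have "z ^ kC ?C * (\<Sum>b\<in>UNIV. P (last ?C) b * poly (\<tau> (tl ?C @ [b])) z)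
    = poly (\<tau> ?C) z - (if ?C = xw n then poly D z else 0)"
    using \<tau>_recursion[OF C(1,2), of z] by linarith
  finally have tail: "z ^ ?k * (\<Sum>b\<in>UNIV. P (last v) b * (z ^ wheight ?m (tl v @ [b]) * poly (\<tau> (drop ?m (tl v @ [b]))) z))
    = z ^ wheight ?m v * (poly (\<tau> ?C) z - (if ?C = xw n then poly D z else 0))" .
  have "z ^ ?k * (\<Sum>b\<in>UNIV. P (last v) b * occ L z (tl v @ [b]))
    = poly D z * (z ^ ?k * (\<Sum>b\<in>UNIV. P (last v) b * overlaps L z (tl v @ [b])))
    + completion L ?m * (z ^ ?k * (\<Sum>b\<in>UNIV. P (last v) b * (z ^ wheight ?m (tl v @ [b]) * poly (\<tau> (drop ?m (tl v @ [b]))) z)))"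
  proof -
    have "z ^ ?k * (\<Sum>b\<in>UNIV. q b * (d * f b + c * g b)) = d * (z ^ ?k * (\<Sum>b\<in>UNIV. q b * f b)) + c * (z ^ ?k * (\<Sum>b\<in>UNIV. q b * g b))"
      for q f g :: "'a \<Rightarrow> real" and d c
      by (simp add: sum.distrib sum_distrib_left algebra_simps)
    then show ?thesis unfolding occ_def .
  qed
  also have "\<dots> = poly D z * (overlaps L z v - ?A 0 + ?A ?m)
    + completion L ?m * (z ^ wheight ?m v * (poly (\<tau> ?C) z - (if ?C = xw n then poly D z else 0)))"
    unfolding ovl tail ..
  \<comment> \<open>The new term of the shifted sum at index L - n, an overlap of exactly n letters,
    cancels against the source D in the recursion of \<tau> at \<open>xw n\<close>.\<close>
  also have "\<dots> = occ L z v - (if v = xw L then poly D z else 0)"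
    unfolding A0 Lm occ_def by (auto simp: algebra_simps)
  finally show ?thesis by simp
qed

text \<open>Both overlaps have more than n >= p letters and hence contain a full period; comparing
  them exhibits a recurrence of x at distance j' - j.\<close>

lemma drop_eq_xw_recurs:
  assumes "length v = L" "n < L" "j < L - n" "drop j v = xw (L - j)" "j' < L - n" "drop j' v = xw (L - j')" "j \<le> j'"
  shows "p dvd j' - j"
proof (rule dvd_if_recurs)
  fix i assume i: "i < p"
  have "p \<le> n" using pn n by (intro dvd_imp_le)
  then have iL: "i < L - j'" using i assms by linarith
  have "x (i + (j' - j)) = drop j v ! (i + (j' - j))" using iL assms by simp
  also have "\<dots> = v ! (j' + i)" using iL assms by (subst nth_drop) (auto simp: algebra_simps)
  also have "\<dots> = drop j' v ! i" using iL assms by (subst nth_drop) auto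
  also have "\<dots> = x i" using iL assms by simp
  finally show "x (i + (j' - j)) = x i" .
qed

lemma drop_xw: "p dvd j \<Longrightarrow> j \<le> L \<Longrightarrow> drop j (xw L) = xw (L - j)"
proof -
  assume "p dvd j" "j \<le> L"
  then obtain m where m: "j = m * p" by (metis dvd_div_mult_self)
  show ?thesis
    using \<open>j \<le> L\<close> x_add_mult_p by (intro nth_equalityI) (auto simp: m add.commute)
qed

lemma wheight_xw: "j + n \<le> Suc L \<Longrightarrow> wheight j (xw L) = height j x"
proof -
  assume j: "j + n \<le> Suc L"
  have "take n (drop i (xw L)) = map x [i..<i + n]" if "i < j" for i
    using that j by (simp add: drop_map take_map)
  then show ?thesis unfolding wheight_def height_def by (intro sum.cong) auto
qed

text \<open>Self-overlaps in more than n letters occur exactly at multiples of p, which produces a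
  geometric sum of ratio co z^ob.\<close>

lemma occ_xw:
  assumes L: "L = n + s * p" "s > 0"
  shows "occ L z (xw L) = poly D z * (\<Sum>i<s. (co * z ^ ob) ^ i) + (co * z ^ ob) ^ s * poly (\<tau> (xw n)) z"
proof -
  have Ln: "L - n = s * p" "n < L" using L p by auto
  have dr: "drop j (xw L) = xw (L - j) \<longleftrightarrow> p dvd j" if "j < L - n" for j
  proof
    assume "drop j (xw L) = xw (L - j)"
    then show "p dvd j" using drop_eq_xw_recurs[of "xw L" L 0 j] that Ln L(2) p by simp
  qed (use drop_xw that in auto)
  have "overlaps L z (xw L) = (\<Sum>j<s * p. if p dvd j then completion L j * z ^ height j x else 0)"
    unfolding overlaps_def Ln(1) using dr Ln by (intro sum.cong) (auto simp: wheight_xw)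
  also have "\<dots> = (\<Sum>j\<in>(\<lambda>i. i * p) ` {..<s}. completion L j * z ^ height j x)"
  proof (intro sum.mono_neutral_cong_right)
    show "\<forall>j\<in>{..<s * p} - (\<lambda>i. i * p) ` {..<s}. (if p dvd j then completion L j * z ^ height j x else 0) = 0"
    proof
      fix j assume j: "j \<in> {..<s * p} - (\<lambda>i. i * p) ` {..<s}"
      have "\<not> p dvd j"
      proof
        assume "p dvd j"
        then obtain i where i: "j = i * p" by (metis dvd_div_mult_self)
        then show False using j p by auto
      qed
      then show "(if p dvd j then completion L j * z ^ height j x else 0) = 0" by simp
    qed
  qed (use p in auto)
  also have "\<dots> = (\<Sum>i<s. completion L (i * p) * z ^ height (i * p) x)"
    using p by (subst sum.reindex) (auto simp: inj_on_def)
  also have "\<dots> = (\<Sum>i<s. (co * z ^ ob) ^ i)"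
  proof (intro sum.cong refl)
    fix i assume "i \<in> {..<s}"
    then have "i * p < s * p" using p by simp
    then have "i * p < L" using L by linarith
    then show "completion L (i * p) * z ^ height (i * p) x = (co * z ^ ob) ^ i"
      by (simp add: completion_mult_p height_mult_p power_mult_distrib power_mult[symmetric] mult.commute)
  qed
  finally have ov: "overlaps L z (xw L) = (\<Sum>i<s. (co * z ^ ob) ^ i)" .
  have "completion L (s * p) = co ^ s" using L n by (intro completion_mult_p) simp
  moreover have "wheight (s * p) (xw L) = s * ob" using L by (simp add: wheight_xw height_mult_p)
  moreover have "drop (s * p) (xw L) = xw n" using drop_xw[of "s * p" L] L by simp
  ultimately show ?thesis unfolding occ_def ov Ln(1)
    by (simp add: power_mult_distrib power_mult[symmetric] mult.commute mult.left_commute)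
qed

text \<open>As j > 0, the last transition of the hole word is still missing and contributes
  \<open>\<kappa>\<close>; the other j - 1 missing transitions contain (j - 1) div p full
  periods.\<close>

lemma completion_le:
  assumes L: "L = \<nu> * p" "n < L" and j: "0 < j" "j < L - n"
  shows "completion L j \<le> \<kappa> * co ^ ((j - 1) div p)"
proof -
  define i where "i = (j - 1) div p"
  define r where "r = (j - 1) mod p"
  have jr: "j = i * p + r + 1" using j by (simp add: i_def r_def)
  have L2: "L \<ge> 2" using L(2) n by linarith
  let ?a = "L - 1 - j"
  have b: "?a + i * p \<le> L - 2" "?a + i * p = L - 2 - r" "Suc (L - 2) = L - 1" using jr j L2 by linarith+
  have "completion L j = prod tr {?a..<?a + i * p} * (prod tr {?a + i * p..<L - 2} * tr (L - 2))"
  proof -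
    have "prod tr {?a..<L - 1} = prod tr {?a..<?a + i * p} * prod tr {?a + i * p..<Suc (L - 2)}"
      unfolding b(3) using b by (intro prod.atLeastLessThan_concat[symmetric]) linarith+
    also have "prod tr {?a + i * p..<Suc (L - 2)} = prod tr {?a + i * p..<L - 2} * tr (L - 2)"
      by (rule prod.atLeastLessThan_Suc) (rule b(1))
    finally show ?thesis by (simp add: completion_def)
  qed
  also have "prod tr {?a..<?a + i * p} = co ^ i" by (rule prod_tr_period)
  also have "tr (L - 2) = \<kappa>" unfolding L(1) using L2 L(1) by (intro tr_last) simp
  also have "co ^ i * (prod tr {?a + i * p..<L - 2} * \<kappa>) \<le> co ^ i * (1 * \<kappa>)"
    using co_pos prod_tr_bounds tr_pos by (intro mult_left_mono mult_right_mono) (auto simp: \<kappa>_def less_imp_le)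
  finally show ?thesis by (simp add: i_def mult.commute)
qed

text \<open>The offsets of overlaps are congruent modulo p, so (j - 1) div p is injective on them;
  offset 0 is excluded since v differs from the hole word. Hence the total is dominated by the
  geometric sum belonging to the hole word itself, with the gain \<open>\<kappa>\<close>.\<close>

lemma overlap_completions_le:
  assumes L: "L = \<nu> * p" "L = n + s * p" "s > 0" and v: "length v = L" "v \<noteq> xw L"
  shows "(\<Sum>j<L - n. if drop j v = xw (L - j) then completion L j else 0) \<le> \<kappa> * (\<Sum>i<s. co ^ i)"
proof -
  define J where "J = {j. j < L - n \<and> drop j v = xw (L - j)}"
  have Ln: "L - n = s * p" "n < L" using L(2,3) p by auto
  have J0: "j > 0" if "j \<in> J" for j using that v by (cases j) (auto simp: J_def)
  have finJ: "finite J" by (simp add: J_def)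
  let ?i = "\<lambda>j. (j - 1) div p"
  have inj: "inj_on ?i J"
  proof (rule inj_onI)
    have *: "j = j'" if "j \<in> J" "j' \<in> J" "?i j = ?i j'" "j \<le> j'" for j j'
    proof -
      have "p dvd j' - j" using drop_eq_xw_recurs[of v L j j'] that v Ln by (auto simp: J_def)
      then have "(j' - 1) mod p = (j - 1) mod p"
        using J0[OF that(1)] that(4) by (metis Suc_leI diff_diff_left le_add_diff_inverse mod_eq_dvd_iff_nat diff_le_mono One_nat_def diff_diff_eq plus_1_eq_Suc)
      then have "j' - 1 = j - 1" using that(3) by (metis div_mult_mod_eq)
      then show ?thesis using J0[OF that(1)] J0[OF that(2)] by linarith
    qed
    show "j = j'" if "j \<in> J" "j' \<in> J" "?i j = ?i j'" for j j'
      using *[OF that] *[OF that(2,1) that(3)[symmetric]] by linarith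
  qed
  have im: "?i ` J \<subseteq> {..<s}"
  proof
    fix i assume "i \<in> ?i ` J"
    then obtain j where j: "j \<in> J" "i = (j - 1) div p" by blast
    have "j - 1 < s * p" using j(1) Ln by (auto simp: J_def)
    then show "i \<in> {..<s}" unfolding j(2) by (simp add: less_mult_imp_div_less)
  qed
  have "(\<Sum>j<L - n. if drop j v = xw (L - j) then completion L j else 0) = (\<Sum>j\<in>J. completion L j)"
    by (rule sum.mono_neutral_cong_right) (auto simp: J_def)
  also have "\<dots> \<le> (\<Sum>j\<in>J. \<kappa> * co ^ ?i j)"
    using completion_le[OF L(1) Ln(2)] J0 by (intro sum_mono) (auto simp: J_def)
  also have "\<dots> = \<kappa> * (\<Sum>i\<in>?i ` J. co ^ i)"
    using inj by (simp add: sum.reindex sum_distrib_left)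
  also have "\<dots> \<le> \<kappa> * (\<Sum>i<s. co ^ i)"
    using im co_pos tr_pos by (intro mult_left_mono sum_mono2) (auto simp: \<kappa>_def less_imp_le)
  finally show ?thesis .
qed

text \<open>The common nonzero value of all \<tau> C at 1. Its sign is left open, and division by it
  is what makes the eigenfunction positive.\<close>

abbreviation c\<tau> :: real where "c\<tau> \<equiv> poly (\<tau> (xw n)) 1"

text \<open>Windows near the end of v are cut short by \<open>take\<close>, hence the sum over all
  words of length at most n.\<close>

lemma wheight_le: "wheight j v \<le> j * (\<Sum>u | length u \<le> n. kC u)"
proof -
  have fin: "finite {u :: 'a list. length u \<le> n}"
    using finite_lists_length_le[of "UNIV :: 'a set" n] by simp
  have "wheight j v \<le> (\<Sum>i<j. (\<Sum>u | length u \<le> n. kC u))"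
    unfolding wheight_def by (intro sum_mono member_le_sum) (auto simp: fin)
  then show ?thesis by simp
qed

text \<open>Multiplication by the positive sum \<open>Sg\<close> and the root relation eliminate
  D(z). What remains compares \<open>Sg\<close>, close to \<open>G0\<close>, with the overlaps of v,
  at most about \<open>\<kappa> * G0\<close>. On either side three quantities are estimated with a
  relative error \<epsilon>: a power of z, a normalised value of \<tau>, and one of these sums;
  hence the cubes.\<close>

lemma occ_positive:
  assumes L: "L = \<nu> * p" "L = n + s * p" "s > 0" and v: "length v = L" "admissible P v" "v \<noteq> xw L"
    and \<epsilon>: "0 < \<epsilon>" "\<epsilon> < 1" "\<kappa> * (1 + \<epsilon>) ^ 3 < (1 - \<epsilon>) ^ 3"
    and zpow: "\<And>k. k \<le> L * (\<Sum>u | length u \<le> n. kC u) \<Longrightarrow> 1 - \<epsilon> \<le> z ^ k \<and> z ^ k \<le> 1 + \<epsilon>"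
    and \<tau>near: "\<And>C. length C = n \<Longrightarrow> admissible P C \<Longrightarrow> 1 - \<epsilon> \<le> poly (\<tau> C) z / c\<tau> \<and> poly (\<tau> C) z / c\<tau> \<le> 1 + \<epsilon>"
    and root: "occ L z (xw L) = 0"
  shows "occ L z v / c\<tau> > 0"
proof -
  have Ln: "L - n = s * p" "n < L" using L(2,3) p by auto
  let ?C = "drop (L - n) v" and ?h = "wheight (L - n) v"
  define G0 where "G0 = (\<Sum>i<s. co ^ i)"
  define Sg where "Sg = (\<Sum>i<s. (co * z ^ ob) ^ i)"
  have hz: "1 - \<epsilon> \<le> z ^ wheight j u \<and> z ^ wheight j u \<le> 1 + \<epsilon>" if "j \<le> L" for j u
    using wheight_le[of j u] that by (intro zpow) (meson le_trans mult_le_mono1)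
  have oz: "1 - \<epsilon> \<le> z ^ (i * ob) \<and> z ^ (i * ob) \<le> 1 + \<epsilon>" if "i \<le> s" for i
  proof -
    have "i * p \<le> s * p" using that by simp
    then have "i * p + n \<le> Suc L" "i * p \<le> L" using L(2) by linarith+
    then have "wheight (i * p) (xw L) = i * ob" "i * p \<le> L" by (simp_all only: wheight_xw height_mult_p)
    then show ?thesis using hz[of "i * p" "xw L"] by simp
  qed
  have G0: "G0 > 0"
    unfolding G0_def using L(3) co_pos by (intro sum_pos) auto
  have tm: "(co * z ^ ob) ^ i = co ^ i * z ^ (i * ob)" for i
    by (simp add: power_mult_distrib power_mult[symmetric] mult.commute)
  have Sg: "(1 - \<epsilon>) * G0 \<le> Sg"
    unfolding G0_def Sg_def sum_distrib_left tm
  proof (intro sum_mono)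
    fix i assume "i \<in> {..<s}"
    then have "co ^ i * (1 - \<epsilon>) \<le> co ^ i * z ^ (i * ob)"
      using oz[of i] co_pos by (intro mult_left_mono) auto
    then show "(1 - \<epsilon>) * co ^ i \<le> co ^ i * z ^ (i * ob)" by (simp add: mult.commute)
  qed
  have Sg0: "Sg > 0" using Sg G0 \<epsilon> by (meson diff_gt_0_iff_gt less_le_trans mult_pos_pos)
  have comp: "completion L j > 0" for j unfolding completion_def by (rule prod_tr_bounds)
  have "overlaps L z v \<le> (\<Sum>j<L - n. (1 + \<epsilon>) * (if drop j v = xw (L - j) then completion L j else 0))"
    unfolding overlaps_def
  proof (intro sum_mono)
    fix j assume "j \<in> {..<L - n}"
    then have "completion L j * z ^ wheight j v \<le> completion L j * (1 + \<epsilon>)"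
      using hz[of j v] comp[of j] by (intro mult_left_mono) auto
    then show "(if drop j v = xw (L - j) then completion L j * z ^ wheight j v else 0)
      \<le> (1 + \<epsilon>) * (if drop j v = xw (L - j) then completion L j else 0)" by (simp add: mult.commute)
  qed
  also have "\<dots> = (1 + \<epsilon>) * (\<Sum>j<L - n. if drop j v = xw (L - j) then completion L j else 0)"
    by (simp add: sum_distrib_left)
  also have "\<dots> \<le> (1 + \<epsilon>) * (\<kappa> * G0)"
    unfolding G0_def using overlap_completions_le[OF L v(1,3)] \<epsilon> by (intro mult_left_mono) auto
  finally have ovl: "overlaps L z v \<le> (1 + \<epsilon>) * (\<kappa> * G0)" .
  have ovl0: "overlaps L z v \<ge> 0" unfolding overlaps_def
    using hz comp \<epsilon> by (intro sum_nonneg) (auto intro!: mult_nonneg_nonneg less_imp_le[OF comp] order_trans[OF _ conjunct1[OF hz]])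
  have cs: "completion L (L - n) = co ^ s"
    unfolding Ln by (rule completion_mult_p) (use L(2) n in linarith)
  have C: "length ?C = n" "admissible P ?C"
  proof -
    show "length ?C = n" using v Ln by simp
    show "admissible P ?C" using v(2) unfolding admissible_iff_successively
      by (metis append_take_drop_id successively_append_iff)
  qed
  have DSg: "poly D z * Sg = - (co ^ s * z ^ (s * ob) * poly (\<tau> (xw n)) z)"
  proof -
    have "poly D z * Sg + co ^ s * z ^ (s * ob) * poly (\<tau> (xw n)) z = 0"
      using root occ_xw[OF L(2,3), of z] unfolding Sg_def tm by simp
    then show ?thesis by linarith
  qed
  have "occ L z v * Sg = (poly D z * Sg) * overlaps L z v + co ^ s * (z ^ ?h * poly (\<tau> ?C) z) * Sg"
    by (simp add: occ_def cs algebra_simps)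
  also have "\<dots> = co ^ s * (z ^ ?h * poly (\<tau> ?C) z * Sg - z ^ (s * ob) * poly (\<tau> (xw n)) z * overlaps L z v)"
    unfolding DSg by (simp add: algebra_simps)
  finally have occ_Sg: "occ L z v * Sg = co ^ s * (z ^ ?h * poly (\<tau> ?C) z * Sg - z ^ (s * ob) * poly (\<tau> (xw n)) z * overlaps L z v)" .
  have "occ L z v / c\<tau> * Sg = occ L z v * Sg / c\<tau>" by simp
  then have key: "occ L z v / c\<tau> * Sg = co ^ s * (z ^ ?h * (poly (\<tau> ?C) z / c\<tau>) * Sg - z ^ (s * ob) * (poly (\<tau> (xw n)) z / c\<tau>) * overlaps L z v)"
    unfolding occ_Sg by (simp add: diff_divide_distrib[symmetric])
  have A: "(1 - \<epsilon>) * (1 - \<epsilon>) * ((1 - \<epsilon>) * G0) \<le> z ^ ?h * (poly (\<tau> ?C) z / c\<tau>) * Sg"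
    using hz[of "L - n" v] \<tau>near[OF C] Sg \<epsilon> G0 by (intro mult_mono mult_nonneg_nonneg) auto
  have B: "z ^ (s * ob) * (poly (\<tau> (xw n)) z / c\<tau>) * overlaps L z v \<le> (1 + \<epsilon>) * (1 + \<epsilon>) * ((1 + \<epsilon>) * (\<kappa> * G0))"
    using oz[of s] \<tau>near[OF Ct] ovl ovl0 \<epsilon>
    by (intro mult_mono mult_nonneg_nonneg) auto
  have "(1 + \<epsilon>) * (1 + \<epsilon>) * ((1 + \<epsilon>) * (\<kappa> * G0)) = (\<kappa> * (1 + \<epsilon>) ^ 3) * G0"
    "(1 - \<epsilon>) * (1 - \<epsilon>) * ((1 - \<epsilon>) * G0) = (1 - \<epsilon>) ^ 3 * G0" by (simp_all add: power3_eq_cube)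
  moreover have "(\<kappa> * (1 + \<epsilon>) ^ 3) * G0 < (1 - \<epsilon>) ^ 3 * G0" using \<epsilon>(3) G0 by (rule mult_strict_right_mono)
  ultimately have "z ^ (s * ob) * (poly (\<tau> (xw n)) z / c\<tau>) * overlaps L z v < z ^ ?h * (poly (\<tau> ?C) z / c\<tau>) * Sg"
    using A B by linarith
  then have "occ L z v / c\<tau> * Sg > 0"
    unfolding key using co_pos by (intro mult_pos_pos) (simp_all only: zero_less_power diff_gt_0_iff_gt)
  then show ?thesis by (rule zero_less_mult_pos2[OF _ Sg0])
qed

lemma escape_rate_at_root:
  assumes L: "L = \<nu> * p" "L = n + s * p" "s > 0"
    and \<epsilon>: "0 < \<epsilon>" "\<epsilon> < 1" "\<kappa> * (1 + \<epsilon>) ^ 3 < (1 - \<epsilon>) ^ 3"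
    and zpow: "\<And>k. k \<le> L * (\<Sum>u | length u \<le> n. kC u) \<Longrightarrow> 1 - \<epsilon> \<le> z ^ k \<and> z ^ k \<le> 1 + \<epsilon>"
    and \<tau>near: "\<And>C. length C = n \<Longrightarrow> admissible P C \<Longrightarrow> 1 - \<epsilon> \<le> poly (\<tau> C) z / c\<tau> \<and> poly (\<tau> C) z / c\<tau> \<le> 1 + \<epsilon>"
    and root: "occ L z (xw L) = 0" and z: "z > 0"
  shows "escape_rate P M (cyl P (xw L)) \<phi> = ln z"
proof (rule escape_rate_cyl[where h = "\<lambda>v. occ L z v / c\<tau>"])
  have Ln: "n < L" using L(2,3) p by auto
  have L2: "L \<ge> 2" using Ln n by linarith
  show "length (xw L) = L" "n \<le> L" "z > 0" using Ln z by auto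
  show "occ L z (xw L) / c\<tau> = 0" using root by simp
  show "occ L z v / c\<tau> > 0" if "length v = L" "admissible P v" "v \<noteq> xw L" for v
    using occ_positive[OF L that \<epsilon> zpow \<tau>near root] .
  show "occ L z v / c\<tau> = z ^ kC (take n v) * (\<Sum>b\<in>UNIV. P (last v) b * (occ L z (tl v @ [b]) / c\<tau>))"
    if "length v = L" "admissible P v" "v \<noteq> xw L" for v
    using occ_recursion[OF that(1,2) Ln, of z] that(3) by (simp add: sum_divide_distrib[symmetric])
  \<comment> \<open>Since \<open>\<kappa>\<close> < 1, the last letter of the hole word can be
    replaced by another one of positive probability.\<close>
  show "\<exists>v. length v = L \<and> admissible P v \<and> v \<noteq> xw L"
  proof -
    have S: "Suc (L - 2) = L - 1" "Suc (L - 1) = L" using L2 by auto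
    have "P (x (L - 2)) (x (L - 1)) < 1"
      using tr_last[of \<nu>] L2 L(1) \<kappa>_less_1 S by (simp add: tr_def)
    moreover have "(\<Sum>b\<in>UNIV. P (x (L - 2)) b) = P (x (L - 2)) (x (L - 1)) + (\<Sum>b\<in>UNIV - {x (L - 1)}. P (x (L - 2)) b)"
      by (rule sum.remove) auto
    ultimately have "(\<Sum>b\<in>UNIV - {x (L - 1)}. P (x (L - 2)) b) \<noteq> 0" using P0(2)[of "x (L - 2)"] by linarith
    then obtain b where b: "b \<noteq> x (L - 1)" "P (x (L - 2)) b \<noteq> 0" by (metis DiffD2 singletonI sum.neutral)
    have bpos: "P (x (L - 2)) b > 0" using b(2) P0(1)[of "x (L - 2)" b] by linarith
    have "xw L = xw (L - 1) @ [x (L - 1)]" by (subst S(2)[symmetric]) simp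
    then have "xw (L - 1) @ [b] \<noteq> xw L" using b(1) by simp
    moreover have "admissible P (xw (L - 1) @ [b])"
    proof -
      have "admissible P (xw (L - 1))" using x by (auto simp: admissible_def SigmaP_def)
      moreover have "last (xw (L - 1)) = x (L - 2)" using L2 by (subst last_map) (auto simp: numeral_2_eq_2)
      ultimately show ?thesis using bpos by (auto simp: admissible_iff_successively successively_append_iff)
    qed
    ultimately show ?thesis using L2 by (intro exI[of _ "xw (L - 1) @ [b]"]) auto
  qed
qed

end

text \<open>Bernoulli's inequality gives the lower bound; the upper one follows from it by (1 +
  \<delta>)^k (1 - \<delta>)^k <= 1.\<close>

lemma powers_near_one:
  fixes z \<delta> \<epsilon> :: real
  assumes z: "\<bar>z - 1\<bar> \<le> \<delta>" and \<delta>: "\<delta> < 1" "real k * \<delta> \<le> \<epsilon> / 2" and \<epsilon>: "0 < \<epsilon>" "\<epsilon> \<le> 1"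
  shows "1 - \<epsilon> \<le> z ^ k \<and> z ^ k \<le> 1 + \<epsilon>"
proof
  have \<delta>0: "0 \<le> \<delta>" using z by linarith
  have bern: "1 - real k * \<delta> \<le> (1 - \<delta>) ^ k"
    using Bernoulli_inequality[of "- \<delta>" k] \<delta> by simp
  have "(1 - \<delta>) ^ k \<le> z ^ k" using z \<delta> by (intro power_mono) linarith+
  then show "1 - \<epsilon> \<le> z ^ k" using bern \<delta> \<epsilon> by linarith
  define X where "X = (1 + \<delta>) ^ k"
  have X0: "X \<ge> 0" using \<delta>0 by (simp add: X_def)
  have "X * (1 - \<epsilon> / 2) \<le> X * (1 - \<delta>) ^ k" using bern \<delta> X0 by (intro mult_left_mono) linarith+
  also have "X * (1 - \<delta>) ^ k = ((1 + \<delta>) * (1 - \<delta>)) ^ k" by (simp only: X_def power_mult_distrib)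
  also have "\<dots> \<le> 1 ^ k"
  proof (rule power_mono)
    have "(1 + \<delta>) * (1 - \<delta>) = 1 - \<delta> * \<delta>" by (simp add: algebra_simps)
    then show "(1 + \<delta>) * (1 - \<delta>) \<le> 1" using \<delta>0 by simp
    show "0 \<le> (1 + \<delta>) * (1 - \<delta>)" using \<delta>0 \<delta> by simp
  qed
  also have "1 ^ k \<le> (1 + \<epsilon>) * (1 - \<epsilon> / 2)"
  proof -
    have "(1 + \<epsilon>) * (1 - \<epsilon> / 2) = 1 + \<epsilon> * (1 - \<epsilon>) / 2" by (simp add: field_simps)
    then show ?thesis using \<epsilon> by simp
  qed
  finally have "X \<le> 1 + \<epsilon>" by (rule mult_right_le_imp_le) (use \<epsilon> in linarith)
  moreover have "z ^ k \<le> X" unfolding X_def using z \<delta> by (intro power_mono) linarith+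
  ultimately show "z ^ k \<le> 1 + \<epsilon>" by linarith
qed

context periodic_hole
begin

section \<open>The root near 1 and its expansion\<close>

definition n0 :: nat where "n0 = n div p"

lemma n_eq: "n = n0 * p" using pn by (simp add: n0_def)

lemma length_split: "\<nu> > n0 \<Longrightarrow> \<nu> * p = n + (\<nu> - n0) * p"
proof -
  assume "n0 < \<nu>"
  then have "\<nu> * p = (n0 + (\<nu> - n0)) * p" by simp
  also have "\<dots> = n0 * p + (\<nu> - n0) * p" by (rule add_mult_distrib)
  also have "n0 * p = n" by (rule n_eq[symmetric])
  finally show ?thesis .
qed

abbreviation W :: nat where "W \<equiv> (\<Sum>u | length u \<le> n. kC u)"

text \<open>Divided by D'(1), the function has the form (z - 1) y + R with y > 1 / 2, where R has
  order co^\<nu>, the square of the distance allowed for z. At distance exactly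
  \<open>sqrt co ^ \<nu>\<close> from 1 the first term therefore decides the sign.\<close>

lemma root_near_one: "\<forall>\<^sub>F \<nu> in sequentially. \<exists>z. \<bar>z - 1\<bar> \<le> sqrt co ^ \<nu> \<and> occ (\<nu> * p) z (xw (\<nu> * p)) = 0"
proof -
  define r where "r = sqrt co"
  have r: "0 < r" "r < 1" "r * r = co" using co_pos co_less_1 by (auto simp: r_def)
  define b where "b = poly (pderiv D) 1"
  have b0: "b \<noteq> 0" unfolding b_def by (rule pderiv_D_1)
  have "[:-1, 1:] dvd D" using D_1 poly_eq_0_iff_dvd[of D 1] by blast
  then obtain D1 where D1: "D = [:-1, 1:] * D1" by (rule dvdE)
  have Dz: "poly D z = (z - 1) * poly D1 z" for z unfolding D1 by (simp add: algebra_simps)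
  have "b = poly D1 1" unfolding b_def D1 pderiv_mult by (simp add: pderiv_pCons)
  then have "((\<lambda>z. poly D1 z / b) \<longlongrightarrow> 1) (nhds 1)"
    using b0 tendsto_divide[OF tendsto_poly[OF filterlim_ident[of "nhds (1::real)"], of D1] tendsto_const[of b "nhds 1"]] by simp
  then have e1: "\<forall>\<^sub>F z in nhds 1. poly D1 z / b > 1 / 2" by (rule order_tendstoD) simp
  define C where "C = \<bar>c\<tau>\<bar> + 1"
  have "((\<lambda>z. \<bar>poly (\<tau> (xw n)) z\<bar>) \<longlongrightarrow> \<bar>c\<tau>\<bar>) (nhds 1)"
    by (intro tendsto_rabs tendsto_poly filterlim_ident)
  then have e2: "\<forall>\<^sub>F z in nhds 1. \<bar>poly (\<tau> (xw n)) z\<bar> < C" by (rule order_tendstoD) (simp add: C_def)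
  obtain \<eta> where \<eta>: "\<eta> > 0" "\<And>z. dist z 1 < \<eta> \<Longrightarrow> poly D1 z / b > 1 / 2 \<and> \<bar>poly (\<tau> (xw n)) z\<bar> < C"
    using eventually_conj[OF e1 e2] unfolding eventually_nhds_metric by blast
  have rlim: "(\<lambda>\<nu>. r ^ \<nu>) \<longlonglongrightarrow> 0" using r by (intro LIMSEQ_power_zero) simp
  have nrlim: "(\<lambda>\<nu>. real \<nu> * r ^ \<nu>) \<longlonglongrightarrow> 0" using r by (intro powser_times_n_limit_0) simp
  \<comment> \<open>Collects the constants of the estimate |R| <= (K r^\<nu>) (r^\<nu> / 2) below;
    co^n0 enters because s = \<nu> - n0.\<close>
  define K where "K = 4 * C / (\<bar>b\<bar> * co ^ n0)"
  have "(\<lambda>\<nu>. K * r ^ \<nu>) \<longlonglongrightarrow> 0" using tendsto_mult_right_zero[OF rlim] .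
  then have v1: "\<forall>\<^sub>F \<nu> in sequentially. K * r ^ \<nu> < 1" by (rule order_tendstoD) simp
  have v2: "\<forall>\<^sub>F \<nu> in sequentially. r ^ \<nu> < min \<eta> 1" using rlim \<eta> by (intro order_tendstoD(2)) auto
  have "(\<lambda>\<nu>. real (p * W) * (real \<nu> * r ^ \<nu>)) \<longlonglongrightarrow> 0" using tendsto_mult_right_zero[OF nrlim] .
  then have v3: "\<forall>\<^sub>F \<nu> in sequentially. real (p * W) * (real \<nu> * r ^ \<nu>) < 1 / 2" by (rule order_tendstoD) simp
  have "\<forall>\<^sub>F \<nu> in sequentially. \<exists>z. \<bar>z - 1\<bar> \<le> r ^ \<nu> \<and> occ (\<nu> * p) z (xw (\<nu> * p)) = 0"
    using v1 v2 v3 eventually_gt_at_top[of n0]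
  proof eventually_elim
    case (elim \<nu>)
    define s where "s = \<nu> - n0"
    have s: "s > 0" "\<nu> * p = n + s * p" using elim length_split by (auto simp: s_def)
    define F where "F z = (poly D z * (\<Sum>i<s. (co * z ^ ob) ^ i) + (co * z ^ ob) ^ s * poly (\<tau> (xw n)) z) / b" for z
    have occF: "occ (\<nu> * p) z (xw (\<nu> * p)) = b * F z" for z
      using b0 by (simp add: F_def occ_xw[OF s(2,1)])
    have r0: "r ^ \<nu> > 0" using r by simp
    \<comment> \<open>The exponent s ob grows at most linearly in \<nu>, so its product with r^\<nu>
      tends to 0 and z^(s ob) stays bounded.\<close>
    have sob: "s * ob \<le> \<nu> * p * W"
    proof -
      have "s * ob = wheight (s * p) (xw (\<nu> * p))" using s by (simp add: wheight_xw height_mult_p)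
      also have "\<dots> \<le> s * p * W" by (rule wheight_le)
      also have "\<dots> \<le> \<nu> * p * W" by (intro mult_le_mono1) (simp add: s_def)
      finally show ?thesis .
    qed
    have est: "\<exists>y R. F z = (z - 1) * y + R \<and> 1 / 2 < y \<and> \<bar>R\<bar> < r ^ \<nu> / 2" if z: "\<bar>z - 1\<bar> = r ^ \<nu>" for z
    proof -
      have near: "poly D1 z / b > 1 / 2" "\<bar>poly (\<tau> (xw n)) z\<bar> < C"
        using \<eta>(2)[of z] z elim(2) by (auto simp: dist_real_def)
      have z0: "z > 0" using z elim(2) by auto
      have "real (s * ob) * r ^ \<nu> \<le> real (\<nu> * p * W) * r ^ \<nu>"
        using sob r0 by (intro mult_right_mono) (simp_all only: of_nat_le_iff less_imp_le)
      also have "\<dots> = real (p * W) * (real \<nu> * r ^ \<nu>)" by (simp add: mult_ac)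
      finally have "real (s * ob) * r ^ \<nu> \<le> 1 / 2" using elim(3) by linarith
      then have zs: "z ^ (s * ob) \<le> 2"
        using powers_near_one[of z "r ^ \<nu>" "s * ob" 1] z elim(2) by simp
      let ?S = "\<Sum>i<s. (co * z ^ ob) ^ i"
      have "(\<Sum>i\<in>{0}. (co * z ^ ob) ^ i) \<le> ?S"
        using s z0 co_pos by (intro sum_mono2) (auto intro!: zero_le_power mult_nonneg_nonneg)
      then have S1: "?S \<ge> 1" by simp
      define y where "y = poly D1 z / b * ?S"
      define R where "R = (co * z ^ ob) ^ s * poly (\<tau> (xw n)) z / b"
      have "F z = (z - 1) * y + R" by (simp add: F_def y_def R_def Dz add_divide_distrib)
      moreover have "1 / 2 < y"
      proof -
        have "poly D1 z / b * 1 \<le> y" unfolding y_def using near S1 by (intro mult_left_mono) linarith+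
        then show ?thesis using near by linarith
      qed
      moreover have "\<bar>R\<bar> < r ^ \<nu> / 2"
      proof -
        have "(co * z ^ ob) ^ s = co ^ s * z ^ (s * ob)"
          by (simp add: power_mult_distrib power_mult[symmetric] mult.commute)
        also have "\<dots> \<le> co ^ s * 2" using zs co_pos by (intro mult_left_mono) auto
        finally have q: "(co * z ^ ob) ^ s \<le> co ^ s * 2" .
        have q0: "0 < (co * z ^ ob) ^ s" using co_pos z0 by simp
        have C0: "C > 0" by (simp add: C_def add_nonneg_pos)
        have "\<bar>R\<bar> = (co * z ^ ob) ^ s * \<bar>poly (\<tau> (xw n)) z\<bar> / \<bar>b\<bar>"
          unfolding R_def abs_divide abs_mult using q0 by simp
        also have "\<dots> \<le> co ^ s * 2 * C / \<bar>b\<bar>"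
          using q q0 near C0 co_pos by (intro divide_right_mono mult_mono) auto
        also have "co ^ s = r ^ \<nu> * r ^ \<nu> / co ^ n0"
        proof -
          have "r ^ \<nu> * r ^ \<nu> = co ^ \<nu>" using r(3) by (metis power_mult_distrib)
          also have "\<dots> = co ^ s * co ^ n0" using elim(4) by (simp add: s_def flip: power_add)
          finally show ?thesis using co_pos by simp
        qed
        also have "r ^ \<nu> * r ^ \<nu> / co ^ n0 * 2 * C / \<bar>b\<bar> = (K * r ^ \<nu>) * (r ^ \<nu> / 2)"
          using b0 co_pos by (simp add: K_def field_simps)
        also have "\<dots> < 1 * (r ^ \<nu> / 2)" using elim(1) r0 by (intro mult_strict_right_mono) auto
        finally show ?thesis by simp
      qed
      ultimately show ?thesis by blast
    qed
    have half: "r ^ \<nu> / 2 < r ^ \<nu> * y" if "1 / 2 < y" for y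
      using mult_strict_left_mono[OF that r0] by simp
    have "F (1 - r ^ \<nu>) \<le> 0"
    proof -
      obtain y R where "F (1 - r ^ \<nu>) = ((1 - r ^ \<nu>) - 1) * y + R" "1 / 2 < y" "\<bar>R\<bar> < r ^ \<nu> / 2"
        using est[of "1 - r ^ \<nu>"] r0 by auto
      then show ?thesis using half[of y] by (simp add: algebra_simps)
    qed
    moreover have "0 \<le> F (1 + r ^ \<nu>)"
    proof -
      obtain y R where "F (1 + r ^ \<nu>) = ((1 + r ^ \<nu>) - 1) * y + R" "1 / 2 < y" "\<bar>R\<bar> < r ^ \<nu> / 2"
        using est[of "1 + r ^ \<nu>"] r0 by auto
      then show ?thesis using half[of y] by (simp add: algebra_simps)
    qed
    moreover have "continuous_on {1 - r ^ \<nu>..1 + r ^ \<nu>} F"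
      unfolding F_def using b0 by (intro continuous_intros) auto
    ultimately obtain z where "1 - r ^ \<nu> \<le> z" "z \<le> 1 + r ^ \<nu>" "F z = 0"
      using IVT'[of F "1 - r ^ \<nu>" 0 "1 + r ^ \<nu>"] r0 by auto
    then show ?case by (intro exI[of _ z]) (auto simp: occF)
  qed
  then show ?thesis unfolding r_def .
qed

text \<open>For large \<nu> the root given by the sign change satisfies the smallness conditions of
  \<open>escape_rate_at_root\<close>. It is then the exponential of the escape rate, which inherits
  its position near 1.\<close>

lemma exp_escape_rate_root:
  "\<forall>\<^sub>F \<nu> in sequentially. let z = exp (escape_rate P M (cyl P (xw (\<nu> * p))) \<phi>)
    in \<bar>z - 1\<bar> \<le> sqrt co ^ \<nu> \<and> occ (\<nu> * p) z (xw (\<nu> * p)) = 0"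
proof -
  define r where "r = sqrt co"
  have r: "0 < r" "r < 1" using co_pos co_less_1 by (auto simp: r_def)
  have "((\<lambda>\<epsilon>::real. (1 - \<epsilon>) ^ 3 - \<kappa> * (1 + \<epsilon>) ^ 3) \<longlongrightarrow> (1 - 0) ^ 3 - \<kappa> * (1 + 0) ^ 3) (at_right 0)"
    by (intro tendsto_intros)
  then have "\<forall>\<^sub>F \<epsilon> in at_right (0::real). (1 - \<epsilon>) ^ 3 - \<kappa> * (1 + \<epsilon>) ^ 3 > 0"
    using \<kappa>_less_1 by (intro order_tendstoD(1)) auto
  moreover have "\<forall>\<^sub>F \<epsilon> in at_right (0::real). 0 < \<epsilon> \<and> \<epsilon> < 1"
    unfolding eventually_at_right_field by (intro exI[of _ 1]) auto
  ultimately have "\<forall>\<^sub>F \<epsilon> in at_right (0::real). (1 - \<epsilon>) ^ 3 - \<kappa> * (1 + \<epsilon>) ^ 3 > 0 \<and> 0 < \<epsilon> \<and> \<epsilon> < 1"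
    by (rule eventually_conj)
  then obtain \<epsilon> :: real where \<epsilon>: "0 < \<epsilon>" "\<epsilon> < 1" "\<kappa> * (1 + \<epsilon>) ^ 3 < (1 - \<epsilon>) ^ 3"
    using eventually_happens'[OF trivial_limit_at_right_real] by force
  have "\<forall>\<^sub>F z in nhds 1. \<forall>C\<in>{C. length C = n \<and> admissible P C}. dist (poly (\<tau> C) z / c\<tau>) 1 < \<epsilon>"
  proof (rule eventually_ball_finite)
    show "finite {C :: 'a list. length C = n \<and> admissible P C}"
      by (rule finite_subset[OF _ finite_lists_of_length[of n]]) auto
    show "\<forall>C\<in>{C. length C = n \<and> admissible P C}. \<forall>\<^sub>F z in nhds 1. dist (poly (\<tau> C) z / c\<tau>) 1 < \<epsilon>"
    proof
      fix C :: "'a list" assume C: "C \<in> {C. length C = n \<and> admissible P C}"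
      have "((\<lambda>z. poly (\<tau> C) z / c\<tau>) \<longlongrightarrow> poly (\<tau> C) 1 / c\<tau>) (nhds 1)"
        by (intro tendsto_divide tendsto_poly filterlim_ident tendsto_const \<tau>_1_nonzero)
      moreover have "poly (\<tau> C) 1 / c\<tau> = 1" using \<tau>_1_constant[of C] \<tau>_1_nonzero C by simp
      ultimately show "\<forall>\<^sub>F z in nhds 1. dist (poly (\<tau> C) z / c\<tau>) 1 < \<epsilon>" using tendstoD \<epsilon>(1) by force
    qed
  qed
  then obtain \<eta> where \<eta>: "\<eta> > 0" "\<And>z C. dist z 1 < \<eta> \<Longrightarrow> length C = n \<Longrightarrow> admissible P C \<Longrightarrow> dist (poly (\<tau> C) z / c\<tau>) 1 < \<epsilon>"
    unfolding eventually_nhds_metric by auto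
  have rlim: "(\<lambda>\<nu>. r ^ \<nu>) \<longlonglongrightarrow> 0" using r by (intro LIMSEQ_power_zero) simp
  have nrlim: "(\<lambda>\<nu>. real \<nu> * r ^ \<nu>) \<longlonglongrightarrow> 0" using r by (intro powser_times_n_limit_0) simp
  have v2: "\<forall>\<^sub>F \<nu> in sequentially. r ^ \<nu> < min \<eta> 1" using rlim \<eta> by (intro order_tendstoD(2)) auto
  have "(\<lambda>\<nu>. real (p * W) * (real \<nu> * r ^ \<nu>)) \<longlonglongrightarrow> 0" using tendsto_mult_right_zero[OF nrlim] .
  then have v3: "\<forall>\<^sub>F \<nu> in sequentially. real (p * W) * (real \<nu> * r ^ \<nu>) < \<epsilon> / 2" using \<epsilon> by (intro order_tendstoD(2)) auto
  show ?thesis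
    using root_near_one v2 v3 eventually_gt_at_top[of n0]
  proof eventually_elim
    case (elim \<nu>)
    obtain z where z: "\<bar>z - 1\<bar> \<le> r ^ \<nu>" "occ (\<nu> * p) z (xw (\<nu> * p)) = 0" using elim(1) unfolding r_def by blast
    have z0: "z > 0" using z elim(2) by auto
    have "escape_rate P M (cyl P (xw (\<nu> * p))) \<phi> = ln z"
    proof (rule escape_rate_at_root[OF refl length_split[OF elim(4)] _ \<epsilon> _ _ z(2) z0])
      show "0 < \<nu> - n0" using elim by simp
      show "1 - \<epsilon> \<le> z ^ k \<and> z ^ k \<le> 1 + \<epsilon>" if k: "k \<le> \<nu> * p * W" for k
      proof (rule powers_near_one[OF z(1)])
        have "real k * r ^ \<nu> \<le> real (\<nu> * p * W) * r ^ \<nu>"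
          using k r by (intro mult_right_mono) (simp_all only: of_nat_le_iff zero_le_power less_imp_le)
        also have "\<dots> = real (p * W) * (real \<nu> * r ^ \<nu>)" by (simp add: mult_ac)
        finally show "real k * r ^ \<nu> \<le> \<epsilon> / 2" using elim(3) by linarith
      qed (use elim \<epsilon> in auto)
      show "1 - \<epsilon> \<le> poly (\<tau> C) z / c\<tau> \<and> poly (\<tau> C) z / c\<tau> \<le> 1 + \<epsilon>" if "length C = n" "admissible P C" for C
      proof -
        have "dist z 1 < \<eta>" using z(1) elim(2) by (simp add: dist_real_def)
        from \<eta>(2)[OF this that] show ?thesis unfolding dist_real_def by linarith
      qed
    qed
    then have "exp (escape_rate P M (cyl P (xw (\<nu> * p))) \<phi>) = z" using z0 by simp
    then show ?case using z by (simp add: r_def)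
  qed
qed

text \<open>A word of length m p has m p - 1 transitions, one fewer than m full periods; the
  division takes out the extra one.\<close>

definition c1 :: real where "c1 = \<pi> (x 0) / tr (p - 1)"

lemma c1_pos: "c1 > 0" using pi tr_pos by (simp add: c1_def stationary_vector_def)

lemma measure_xw: "m > 0 \<Longrightarrow> measure M (cyl P (xw (m * p))) = c1 * co ^ m"
proof -
  assume m: "m > 0"
  have mp: "m * p > 0" using m p by simp
  have "measure M (cyl P (xw (m * p))) = \<pi> (x 0) * (\<Prod>i<m * p - 1. P (xw (m * p) ! i) (xw (m * p) ! Suc i))"
    using mp by (subst measure_cyl) (auto simp: word_weight_def hd_map)
  also have "(\<Prod>i<m * p - 1. P (xw (m * p) ! i) (xw (m * p) ! Suc i)) = prod tr {0..<m * p - 1}"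
    unfolding atLeast0LessThan by (intro prod.cong) (auto simp: tr_def)
  also have "prod tr {0..<m * p - 1} = co ^ m / tr (p - 1)"
  proof -
    obtain l where l: "m = Suc l" using m by (cases m) auto
    have "prod tr {0..<m * p - 1} * tr (m * p - 1) = prod tr {0..<Suc (m * p - 1)}" by simp
    also have "Suc (m * p - 1) = 0 + m * p" using mp by simp
    also have "prod tr {0..<0 + m * p} = co ^ m" by (rule prod_tr_period)
    finally have "prod tr {0..<m * p - 1} * tr (m * p - 1) = co ^ m" .
    moreover have "m * p - 1 = (p - 1) + l * p" using p by (simp add: l)
    then have "tr (m * p - 1) = tr (p - 1)" by (simp only: tr_add_mult_p)
    ultimately show ?thesis using tr_pos[of "p - 1"] by (simp add: field_simps)
  qed
  finally show ?thesis by (simp add: c1_def)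
qed

lemma Gpoly_factor: "(1 - z) * poly (Gpoly P kC N e) z = poly D z"
proof -
  have "[:-1, 1:] dvd D" using D_1 poly_eq_0_iff_dvd[of D 1] by blast
  then obtain D1 where D1: "D = [:-1, 1:] * D1" by (rule dvdE)
  have "D = [:1, -1:] * (- D1)" unfolding D1 by simp
  then have G: "[:1, -1:] * Gpoly P kC N e = D"
    unfolding Gpoly_def by (metis dvd_mult_div_cancel dvd_triv_left)
  have "(1 - z) * poly (Gpoly P kC N e) z = poly ([:1, -1:] * Gpoly P kC N e) z" by (simp add: algebra_simps)
  then show ?thesis unfolding G .
qed

lemma escape_rate_expansion:
  assumes g1: "g1 = (\<lambda>z. (1 - z) * poly (Gpoly P kC N e) z / (1 - co * z ^ ob))"
    and g2: "\<And>\<nu>. \<nu> > n0 \<Longrightarrow> g2 \<nu> = (\<lambda>z. poly (\<tau> (xw n)) z * z ^ ((\<nu> - n0) * ob) / measure M (cyl P (xw n))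
       - co powr (1 - real n / real p) / measure M (cyl P (xw p))
         * ((1 - z) * poly (Gpoly P kC N e) z * z ^ (ob * (\<nu> - n0)) / (1 - co * z ^ ob)))"
  shows "(\<lambda>\<nu>. \<bar>exp (escape_rate P M (cyl P (xw (\<nu> * p))) \<phi>)
      - (1 + (\<Sum>j=1..k. s_coeffs g1 (g2 \<nu>) k j * measure M (cyl P (xw (\<nu> * p))) ^ j))\<bar>)
    \<in> o(\<lambda>\<nu>. measure M (cyl P (xw (\<nu> * p))) ^ k)"
proof -
  define \<mu>t where "\<mu>t = c1 * co ^ n0"
  have "n0 * p > 0" using n n_eq by linarith
  then have n00: "n0 > 0" by simp
  have \<mu>t: "measure M (cyl P (xw n)) = \<mu>t" "\<mu>t > 0"
    using measure_xw[OF n00] c1_pos co_pos unfolding n_eq[symmetric] by (simp_all add: \<mu>t_def)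
  \<comment> \<open>Read off from (1 - co z^ob) (g1 + u g2) after splitting off D and the factor u
    z^(ob s); no \<nu> is left in it.\<close>
  define Y where "Y = Polynomial.smult (inverse \<mu>t) ((1 - Polynomial.smult co (monom 1 ob)) * \<tau> (xw n) - D)"
  have Yz: "poly Y z = ((1 - co * z ^ ob) * poly (\<tau> (xw n)) z - poly D z) / \<mu>t" for z
    by (simp add: Y_def poly_monom divide_inverse mult.commute)
  \<comment> \<open>The two normalisations in g2 agree, because mu_w = c1 co and mu_t = c1 co^(n /
    p).\<close>
  have co_powr: "co powr (1 - real n / real p) / measure M (cyl P (xw p)) = 1 / \<mu>t"
  proof -
    have "real n = real n0 * real p" using n_eq by (metis of_nat_mult)
    then have "real n / real p = real n0" using p by simp
    then have "co powr (1 - real n / real p) = co / co ^ n0"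
      using co_pos by (simp add: powr_diff powr_realpow)
    moreover have "measure M (cyl P (xw p)) = c1 * co" using measure_xw[of 1] by simp
    ultimately show ?thesis using co_pos c1_pos by (simp add: \<mu>t_def field_simps)
  qed
  let ?z = "\<lambda>\<nu>. exp (escape_rate P M (cyl P (xw (\<nu> * p))) \<phi>)"
  show ?thesis
  proof (rule implicit_root_expansion[where D = D and Y = Y and co = co and ?c1.0 = c1 and ob = ob and ?n0.0 = n0])
    show "poly D 1 = 0" by (rule D_1)
    show "poly (pderiv D) 1 \<noteq> 0" by (rule pderiv_D_1)
    show "0 < co" "co < 1" "0 < c1" by (fact co_pos co_less_1 c1_pos)+
    show "\<forall>\<^sub>F \<nu> in sequentially. measure M (cyl P (xw (\<nu> * p))) = c1 * co ^ \<nu>"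
      using eventually_gt_at_top[of 0] by eventually_elim (rule measure_xw)
    have r: "\<bar>sqrt co\<bar> < 1" using co_pos co_less_1 by simp
    show "?z \<longlonglongrightarrow> 1"
    proof (rule LIM_zero_cancel, rule Lim_null_comparison)
      show "\<forall>\<^sub>F \<nu> in sequentially. norm (?z \<nu> - 1) \<le> sqrt co ^ \<nu>"
        using exp_escape_rate_root by eventually_elim (simp add: Let_def)
      show "(\<lambda>\<nu>. sqrt co ^ \<nu>) \<longlonglongrightarrow> 0" by (intro LIMSEQ_power_zero) (use r in simp)
    qed
    show "\<forall>\<^sub>F \<nu> in sequentially. poly D (?z \<nu>) + measure M (cyl P (xw (\<nu> * p))) * (?z \<nu> ^ (ob * (\<nu> - n0)) * poly Y (?z \<nu>)) = 0"
      using exp_escape_rate_root eventually_gt_at_top[of n0]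
    proof eventually_elim
      case (elim \<nu>)
      define z where "z = ?z \<nu>"
      define s where "s = \<nu> - n0"
      define q where "q = co * z ^ ob"
      have s: "\<nu> * p = n + s * p" "s > 0" "\<nu> = n0 + s" using elim length_split by (auto simp: s_def)
      have "occ (\<nu> * p) z (xw (\<nu> * p)) = 0" using elim(1) by (simp add: Let_def z_def)
      then have root: "poly D z * (\<Sum>i<s. q ^ i) + q ^ s * poly (\<tau> (xw n)) z = 0"
        using occ_xw[OF s(1,2)] by (simp add: q_def)
      \<comment> \<open>Multiplication by 1 - q closes the geometric sum and brings the root
        equation to the form D + \<mu> z^(ob s) Y = 0.\<close>
      have "(1 - q) * (poly D z * (\<Sum>i<s. q ^ i) + q ^ s * poly (\<tau> (xw n)) z)
          = poly D z * (1 - q ^ s) + q ^ s * ((1 - q) * poly (\<tau> (xw n)) z)"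
        unfolding one_diff_power_eq by (simp add: algebra_simps)
      then have "poly D z + q ^ s * ((1 - q) * poly (\<tau> (xw n)) z - poly D z) = 0"
        unfolding root by (simp add: algebra_simps)
      moreover have "measure M (cyl P (xw (\<nu> * p))) * (z ^ (ob * s) * poly Y z) = q ^ s * ((1 - q) * poly (\<tau> (xw n)) z - poly D z)"
      proof -
        have "measure M (cyl P (xw (\<nu> * p))) = \<mu>t * co ^ s"
          using s measure_xw[of \<nu>] by (simp add: \<mu>t_def power_add)
        then show ?thesis unfolding power_mult using \<mu>t(2) by (simp add: Yz q_def power_mult_distrib mult_ac)
      qed
      ultimately have "poly D z + measure M (cyl P (xw (\<nu> * p))) * (z ^ (ob * s) * poly Y z) = 0" by linarith
      then show ?case by (simp only: z_def s_def)
    qed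
    show "\<forall>\<^sub>F \<nu> in sequentially. \<forall>z u. co * z ^ ob \<noteq> 1 \<longrightarrow> g1 z + u * g2 \<nu> z
        = (poly D z + u * (z ^ (ob * (\<nu> - n0)) * poly Y z)) / (1 - co * z ^ ob)"
      using eventually_gt_at_top[of n0]
    proof (eventually_elim, intro allI impI)
      fix \<nu> and z u :: real assume \<nu>: "n0 < \<nu>" and "co * z ^ ob \<noteq> 1"
      define b where "b = 1 - co * z ^ ob"
      define w where "w = z ^ (ob * (\<nu> - n0))"
      have b: "b \<noteq> 0" using \<open>co * z ^ ob \<noteq> 1\<close> by (simp add: b_def)
      have g1z: "g1 z = poly D z / b" by (simp add: g1 Gpoly_factor b_def)
      have g2z: "g2 \<nu> z = poly (\<tau> (xw n)) z * w / \<mu>t - 1 / \<mu>t * (poly D z * w / b)"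
        unfolding g2[OF \<nu>] co_powr \<mu>t(1) Gpoly_factor by (simp add: b_def w_def mult.commute)
      have Yb: "poly Y z = (b * poly (\<tau> (xw n)) z - poly D z) / \<mu>t" by (simp add: Yz b_def)
      show "g1 z + u * g2 \<nu> z
        = (poly D z + u * (z ^ (ob * (\<nu> - n0)) * poly Y z)) / (1 - co * z ^ ob)"
        unfolding w_def[symmetric] b_def[symmetric] g1z g2z Yb using b \<mu>t(2) by (simp add: field_simps)
    qed
  qed
qed

end

theorem theorem7p8:
  fixes P :: "'a::finite \<Rightarrow> 'a \<Rightarrow> real" and \<pi> :: "'a \<Rightarrow> real"
    and M :: "(nat \<Rightarrow> 'a) measure" and \<beta> :: real
    and x :: "nat \<Rightarrow> 'a" and p n k :: nat
    and \<phi> :: "(nat \<Rightarrow> 'a) \<Rightarrow> real" and kC :: "'a list \<Rightarrow> nat"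
    and e :: "nat \<Rightarrow> 'a list \<times> nat" and N :: nat
  assumes P: "stochastic_irreducible P"
    and pi: "stationary_vector P \<pi>"
    and M: "markov_measure P \<pi> M"
    and beta: "\<beta> > 0"
    and x: "x \<in> SigmaP P"
    and p: "p > 0" "(\<theta> ^^ p) x = x" "\<forall>q. 0 < q \<and> q < p \<longrightarrow> (\<theta> ^^ q) x \<noteq> x"
    and red: "reduced_word P (map x [0..<p])"
    and loc: "local_escape_rate_exists P M \<beta> x (\<lambda>_. 1)"
    and n: "n > 0" "p dvd n"
    and phi_cyl: "\<forall>y\<in>SigmaP P. \<phi> y = real (kC (map y [0..<n]))"
    and phi_pos: "\<forall>y\<in>SigmaP P. \<phi> y \<ge> 1"
    and N: "N = card (blocks P n kC)"
    and e: "bij_betw e {..<N} (blocks P n kC)"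
  shows
    "let G = Gpoly P kC N e;
         Mz = id_minus_zM P kC N e;
         co = (\<Prod>i<p. P (x i) (x (Suc i)));
         ob = nat \<lfloor>birk \<phi> p x\<rfloor>;
         t = inv_into {..<N} e (map x [0..<n], 1);
         mut = measure M (cyl P (map x [0..<n]));
         muw = measure M (cyl P (map x [0..<p]));
         g1 = (\<lambda>z. (1 - z) * poly G z / (1 - co * z ^ ob));
         g2 = (\<lambda>\<nu> z. let s = \<nu> - n div p;
                        r = inv_into {..<N} e (map x [\<nu> * p - n..<\<nu> * p], 1)
                    in poly (cofactor Mz t r) z * z ^ (s * ob) / mut
                       - co powr (1 - real n / real p) / muw
                         * ((1 - z) * poly G z * z ^ (ob * s) / (1 - co * z ^ ob)));
         s = (\<lambda>\<nu>. s_coeffs g1 (g2 \<nu>) k);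
         A = (\<lambda>\<nu>. cyl P (map x [0..<\<nu> * p]));
         \<mu> = (\<lambda>\<nu>. measure M (A \<nu>));
         z = (\<lambda>\<nu>. exp (escape_rate P M (A \<nu>) \<phi>))
     in (\<lambda>\<nu>. \<bar>z \<nu> - (1 + (\<Sum>j=1..k. s \<nu> j * \<mu> \<nu> ^ j))\<bar>) \<in> o(\<lambda>\<nu>. \<mu> \<nu> ^ k)"
proof -
  interpret markov_shift P \<pi> M using P pi M by unfold_locales
  interpret cylinder_flow P \<pi> M n kC \<phi>
    using n phi_cyl phi_pos by unfold_locales auto
  \<comment> \<open>The ceiling determines \<open>kC\<close> only on words seen in some point of the
    shift space. Positive measure of the cylinder provides such a point for each admissible
    word.\<close>
  have k1: "kC C \<ge> 1" if C: "length C = n" "admissible P C" for C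
  proof -
    have ne: "C \<noteq> []" using C n by auto
    have "measure M (cyl P C) > 0"
      unfolding measure_cyl[OF ne] using word_weight_pos_iff[OF P pi ne] C by blast
    then have "cyl P C \<noteq> {}" by auto
    then obtain y where y: "y \<in> SigmaP P" "\<forall>i<length C. y i = C ! i" unfolding cyl_def by blast
    have "map y [0..<n] = C" using y(2) C by (intro nth_equalityI) auto
    then have "\<phi> y = real (kC C)" using phi_cyl y(1) by simp
    then show ?thesis using phi_pos y(1) by force
  qed
  have adm: "admissible P (map x [0..<n])" using x by (auto simp: admissible_def SigmaP_def)
  interpret periodic_hole P \<pi> M n kC \<phi> N e x p
  proof unfold_locales
    show "reduced_word P (map x [0..<p])" by (rule red)
    show "(\<theta> ^^ q) x \<noteq> x" if "0 < q" "q < p" for q using p(3) that by blast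
  qed (use k1 assms adm in auto)
  have co_eq: "(\<Prod>i<p. P (x i) (x (Suc i))) = co"
    unfolding co_def tr_def atLeast0LessThan ..
  have ob_eq: "nat \<lfloor>birk \<phi> p x\<rfloor> = ob"
    unfolding birk_eq_height[OF x] ob_def by simp
  have cof: "cofactor Mz (idx (map x [0..<n], 1)) (idx (map x [0..<n], 1)) = \<tau> (map x [0..<n])"
    by (simp only: \<tau>_def)
  \<comment> \<open>By periodicity the last n letters of the hole word are its first n letters, so
    for large \<nu> the indices r and t coincide and the cofactor is the diagonal one.\<close>
  have window: "map x [\<nu> * p - n..<\<nu> * p] = map x [0..<n]" if \<nu>: "\<nu> > n0" for \<nu>
  proof -
    have L: "\<nu> * p = n + (\<nu> - n0) * p" using \<nu> by (rule length_split)
    show ?thesis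
    proof (rule nth_equalityI)
      fix i assume "i < length (map x [\<nu> * p - n..<\<nu> * p])"
      then have i: "i < n" by simp
      have "\<nu> * p - n + i = i + (\<nu> - n0) * p" unfolding L by simp
      then show "map x [\<nu> * p - n..<\<nu> * p] ! i = map x [0..<n] ! i"
        using i L x_add_mult_p[of i "\<nu> - n0"] by (simp add: add.commute)
    qed (use L in simp)
  qed
  show ?thesis
    unfolding Let_def co_eq ob_eq n0_def[symmetric]
    by (rule escape_rate_expansion[OF refl]) (simp only: window cof)
qed

end
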